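(* Let $u\in\mathbb{R}^d$, $\theta>0$, $\mathcal{E}=\mathcal{E}_{u,\theta}$ and $R_\theta=\sqrt{d\theta/2}$. Let $\mathcal{W}_2(F_0,F_1)$ denote the distance between any two points $F_0,F_1\in\mathcal{E}$ in the metric induced on $\mathcal{E}$ by the $2$-Wasserstein metric. Then $$W_2(F_0,F_1)=2R_\theta\sin\left(\frac{\mathcal{W}_2(F_0,F_1)}{2R_\theta}\right)\qquad\text{and}\qquad \mathcal{W}_2(F_0,F_1)=2R_\theta\arcsin\left(\frac{W_2(F_0,F_1)}{2R_\theta}\right).$$ Moreover, the geodesic on $\mathcal{E}$ between $F_0$ and $F_1$ is obtained from the chordal geodesic in $\mathcal{P}$ between $F_0$ and $F_1$ by the following procedure: let $t\mapsto F_t$, $t\in[0,1]$, denote the chordal geodesic. For each such $t$, let $\tilde F_t$ denote the unique point in $\mathcal{E}$ that is closest to $F_t$ in the $2$-Wasserstein metric, which is obtained from $F_t$ by dilating about the mean $u$. The path $t\mapsto\tilde F_t$, reparametrized to run at constant speed, is the geodesic on $\mathcal{E}$ between $F_0$ and $F_1$.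
   Context: $\mathcal{P}$ denotes the set of probability densities $F$ on $\mathbb{R}^d$ with $\int|v|^2F(v)\,dv<\infty$. For $u\in\mathbb{R}^d$, $\theta>0$, $$\mathcal{E}_{u,\theta}=\Big\{F\in\mathcal{P}:\ \tfrac1d\int_{\mathbb{R}^d}|v-u|^2F(v)\,dv=\theta,\ \int_{\mathbb{R}^d}vF(v)\,dv=u\Big\}.$$ The $2$-Wasserstein distance is normalized by $W_2^2(F_0,F_1)=\inf_\gamma\int\tfrac12|v-w|^2\,\gamma(dv,dw)$ over couplings $\gamma$ of $F_0(v)dv$, $F_1(w)dw$. For $F_0,F_1\in\mathcal{P}$ let $\psi$ be the convex function with $\nabla\psi\#F_0=F_1$ ($\nabla\psi$ is the optimal transport map). The chordal geodesic from $F_0$ to $F_1$ is the path $F_t=\big((1-t)v+t\nabla\psi(v)\big)\#F_0$, $0\le t\le1$, in $\mathcal{P}$; its midpoint is $F_{1/2}$. Induced distance on $\mathcal{E}$: for $F_0,F_1\in\mathcal{E}$ define finite sequences $\{F^{(k)}_0,\dots,F^{(k)}_{2^k}\}$ in $\mathcal{E}$ recursively. For $k=1$: $F^{(1)}_0=F_0$, $F^{(1)}_2=F_1$, and $F^{(1)}_1$ is the midpoint of the chordal geodesic from $F_0$ to $F_1$, projected onto $\mathcal{E}$ by dilation about $u$ (i.e. $G_{1/2}\mapsto a^dG_{1/2}(a(v-u)+u)$ with $a>0$ chosen so that the result lies in $\mathcal{E}$). Given the $k$-th sequence, $F^{(k+1)}_{2j}=F^{(k)}_j$ for $0\le j\le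 2^k$ and, for $0\le j\le 2^k-1$, $F^{(k+1)}_{2j+1}$ is the midpoint of the chordal geodesic from $F^{(k)}_j$ to $F^{(k)}_{j+1}$, projected onto $\mathcal{E}$ by dilation about $u$. Then $$\mathcal{W}_2(F_0,F_1)=\lim_{k\to\infty}\sum_{j=0}^{2^k-1}W_2(F^{(k)}_j,F^{(k)}_{j+1}),$$ the limit of an increasing sequence. A geodesic on $\mathcal{E}$ between $F_0$ and $F_1$ is a constant-speed continuous path in $\mathcal{E}$ from $F_0$ to $F_1$ whose length measured with $W_2$ (supremum over partitions of the sums of consecutive $W_2$-distances) equals $\mathcal{W}_2(F_0,F_1)$. *)

theory Defs
  imports "HOL-Analysis.Analysis"
begin

text \<open>
  A probability density \<open>F\<close> is represented by the law \<open>F(v) dv\<close>, so that densities which agree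
  almost everywhere are identified. The ambient space is a Euclidean space of dimension
  \<open>d = DIM('a)\<close>.
\<close>

definition densities :: "'a::euclidean_space measure set" where
  "densities = {density lborel (\<lambda>v. ennreal (f v)) | f.
     (\<forall>v. 0 \<le> f v) \<and> has_bochner_integral lborel f 1 \<and>
     integrable lborel (\<lambda>v. (norm v)\<^sup>2 * f v)}"

definition sphere_densities :: "'a::euclidean_space \<Rightarrow> real \<Rightarrow> 'a measure set" where
  "sphere_densities u \<theta> =
     {F \<in> densities. (\<integral>v. (norm (v - u))\<^sup>2 \<partial>F) / real DIM('a) = \<theta> \<and> (\<integral>v. v \<partial>F) = u}"

definition couplings :: "'a::euclidean_space measure \<Rightarrow> 'a measure \<Rightarrow> ('a \<times> 'a) measure set" where
  "couplings F G = {\<gamma>. sets \<gamma> = sets (borel \<Otimes>\<^sub>M borel) \<and>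
     distr \<gamma> borel fst = F \<and> distr \<gamma> borel snd = G}"

text \<open>
  The normalization includes the factor \<open>1/2\<close>. The cost is integrable for every coupling of two
  elements of \<^const>\<open>densities\<close>.
\<close>

definition W2 :: "'a::euclidean_space measure \<Rightarrow> 'a measure \<Rightarrow> real" where
  "W2 F G = sqrt (INF \<gamma>\<in>couplings F G. \<integral>p. (norm (fst p - snd p))\<^sup>2 / 2 \<partial>\<gamma>)"

text \<open>
  \<open>T\<close> is the gradient of a convex function that pushes \<open>F\<close> forward to \<open>G\<close>. The convex function
  may be infinite outside a convex set (as is unavoidable if, for instance, \<open>F\<close> has compact support
  and \<open>G\<close> does not), so it is given by its finite values \<open>\<psi>\<close> on the interior \<open>C\<close> of its effective
  domain; as \<open>F\<close> has a density, the boundary of the domain is negligible. The gradient exists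
  only almost everywhere, and \<open>T\<close> is a Borel representative of it.
\<close>

definition is_optimal_map :: "'a::euclidean_space measure \<Rightarrow> 'a measure \<Rightarrow> ('a \<Rightarrow> 'a) \<Rightarrow> bool" where
  "is_optimal_map F G T \<longleftrightarrow>
     T \<in> borel_measurable borel \<and>
     (\<exists>C \<psi>. open C \<and> convex C \<and> convex_on C \<psi> \<and>
        (AE v in F. v \<in> C \<and> (GDERIV \<psi> v :> T v))) \<and>
     distr F borel T = G"

text \<open>\<open>T\<close> is unique up to \<open>F\<close>-null sets, which do not affect the chordal geodesic.\<close>

definition optimal_map :: "'a::euclidean_space measure \<Rightarrow> 'a measure \<Rightarrow> 'a \<Rightarrow> 'a" where
  "optimal_map F G = (SOME T. is_optimal_map F G T)"

definition chordal_geodesic ::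
  "'a::euclidean_space measure \<Rightarrow> 'a measure \<Rightarrow> real \<Rightarrow> 'a measure" where
  "chordal_geodesic F G t = distr F borel (\<lambda>v. (1 - t) *\<^sub>R v + t *\<^sub>R optimal_map F G v)"

text \<open>
  On laws, the dilation \<open>g \<mapsto> a\<^sup>d g(a(v - u) + u)\<close> of densities is the push-forward under the
  inverse of \<open>v \<mapsto> a(v - u) + u\<close>; see \<open>dilate_density\<close> below.
\<close>

definition dilate :: "'a::euclidean_space \<Rightarrow> real \<Rightarrow> 'a measure \<Rightarrow> 'a measure" where
  "dilate u a G = distr G borel (\<lambda>w. u + (1 / a) *\<^sub>R (w - u))"

lemma dilate_density:
  fixes u :: "'a::euclidean_space" and g :: "'a \<Rightarrow> real"
  assumes a: "0 < a" and g[measurable]: "g \<in> borel_measurable borel"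
  shows "dilate u a (density lborel (\<lambda>v. ennreal (g v))) =
    density lborel (\<lambda>v. ennreal (a ^ DIM('a) * g (a *\<^sub>R (v - u) + u)))"
proof (rule measure_eqI)
  show "sets (dilate u a (density lborel (\<lambda>v. ennreal (g v)))) =
    sets (density lborel (\<lambda>v. ennreal (a ^ DIM('a) * g (a *\<^sub>R (v - u) + u))))"
    by (simp add: dilate_def)
next
  fix A assume "A \<in> sets (dilate u a (density lborel (\<lambda>v. ennreal (g v))))"
  then have A[measurable]: "A \<in> sets borel" by (simp add: dilate_def)
  let ?t = "u - a *\<^sub>R u"
  have lb: "lborel = density (distr lborel borel (\<lambda>x::'a. ?t + a *\<^sub>R x)) (\<lambda>_. ennreal (\<bar>a\<bar> ^ DIM('a)))"
    using a by (intro lborel_affine) simp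
  have inv: "u + (1 / a) *\<^sub>R (?t + a *\<^sub>R x - u) = x" for x
    using a by (simp add: algebra_simps)
  have arg: "a *\<^sub>R (x - u) + u = ?t + a *\<^sub>R x" for x
    by (simp add: algebra_simps)
  have "emeasure (dilate u a (density lborel (\<lambda>v. ennreal (g v)))) A =
      (\<integral>\<^sup>+ x. indicator A x \<partial>dilate u a (density lborel (\<lambda>v. ennreal (g v))))"
    by (simp add: dilate_def)
  also have "\<dots> = (\<integral>\<^sup>+ w. ennreal (g w) * indicator A (u + (1 / a) *\<^sub>R (w - u)) \<partial>lborel)"
    by (simp add: dilate_def nn_integral_distr nn_integral_density del: nn_integral_indicator)
  also have "\<dots> = (\<integral>\<^sup>+ x. ennreal (a ^ DIM('a)) * (ennreal (g (?t + a *\<^sub>R x)) * indicator A x) \<partial>lborel)"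
    using a inv by (subst lb) (simp add: nn_integral_density nn_integral_distr del: scaleR_right_diff_distrib)
  also have "\<dots> = (\<integral>\<^sup>+ x. ennreal (a ^ DIM('a) * g (a *\<^sub>R (x - u) + u)) * indicator A x \<partial>lborel)"
    using a by (intro nn_integral_cong) (simp add: arg ennreal_mult' mult.assoc)
  also have "\<dots> = emeasure (density lborel (\<lambda>v. ennreal (a ^ DIM('a) * g (a *\<^sub>R (v - u) + u)))) A"
    by (simp add: emeasure_density)
  finally show "emeasure (dilate u a (density lborel (\<lambda>v. ennreal (g v)))) A =
    emeasure (density lborel (\<lambda>v. ennreal (a ^ DIM('a) * g (a *\<^sub>R (v - u) + u)))) A" .
qed

definition dilation_projection ::
  "'a::euclidean_space \<Rightarrow> real \<Rightarrow> 'a measure \<Rightarrow> 'a measure" where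
  "dilation_projection u \<theta> G =
     dilate u (THE a. 0 < a \<and> dilate u a G \<in> sphere_densities u \<theta>) G"

text \<open>
  \<open>dyadic_points u \<theta> F G k j\<close> is the \<open>j\<close>-th point, \<open>0 \<le> j \<le> 2 ^ k\<close>, of the \<open>k\<close>-th sequence. The
  recursion starts from the pair \<open>F, G\<close> at \<open>k = 0\<close>; values at \<open>j > 2 ^ k\<close> are irrelevant.
\<close>

fun dyadic_points ::
  "'a::euclidean_space \<Rightarrow> real \<Rightarrow> 'a measure \<Rightarrow> 'a measure \<Rightarrow> nat \<Rightarrow> nat \<Rightarrow> 'a measure" where
  "dyadic_points u \<theta> F G 0 j = (if j = 0 then F else G)"
| "dyadic_points u \<theta> F G (Suc k) j =
     (if even j then dyadic_points u \<theta> F G k (j div 2)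
      else dilation_projection u \<theta>
        (chordal_geodesic (dyadic_points u \<theta> F G k (j div 2))
           (dyadic_points u \<theta> F G k (Suc (j div 2))) (1 / 2)))"

definition induced_distance ::
  "'a::euclidean_space \<Rightarrow> real \<Rightarrow> 'a measure \<Rightarrow> 'a measure \<Rightarrow> real" where
  "induced_distance u \<theta> F G =
     lim (\<lambda>k. \<Sum>j<2 ^ k. W2 (dyadic_points u \<theta> F G k j) (dyadic_points u \<theta> F G k (Suc j)))"

definition W2_length :: "(real \<Rightarrow> 'a::euclidean_space measure) \<Rightarrow> real \<Rightarrow> real \<Rightarrow> ereal" where
  "W2_length \<gamma> a b =
     Sup {ereal (\<Sum>i<n. W2 (\<gamma> (s i)) (\<gamma> (s (Suc i)))) | n s.
       s 0 = a \<and> s n = b \<and> mono_on {..n} s}"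

definition W2_continuous :: "(real \<Rightarrow> 'a::euclidean_space measure) \<Rightarrow> bool" where
  "W2_continuous \<gamma> \<longleftrightarrow>
     (\<forall>t\<in>{0..1}. ((\<lambda>s. W2 (\<gamma> s) (\<gamma> t)) \<longlongrightarrow> 0) (at t within {0..1}))"

definition constant_speed :: "(real \<Rightarrow> 'a::euclidean_space measure) \<Rightarrow> bool" where
  "constant_speed \<gamma> \<longleftrightarrow>
     (\<forall>s t. 0 \<le> s \<and> s \<le> t \<and> t \<le> 1 \<longrightarrow> W2_length \<gamma> s t = ereal (t - s) * W2_length \<gamma> 0 1)"

definition is_sphere_geodesic ::
  "'a::euclidean_space \<Rightarrow> real \<Rightarrow> 'a measure \<Rightarrow> 'a measure \<Rightarrow> (real \<Rightarrow> 'a measure) \<Rightarrow> bool" where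
  "is_sphere_geodesic u \<theta> F G \<gamma> \<longleftrightarrow>
     (\<forall>t\<in>{0..1}. \<gamma> t \<in> sphere_densities u \<theta>) \<and> \<gamma> 0 = F \<and> \<gamma> 1 = G \<and>
     W2_continuous \<gamma> \<and> constant_speed \<gamma> \<and>
     W2_length \<gamma> 0 1 = ereal (induced_distance u \<theta> F G)"

definition is_closest_point ::
  "'a::euclidean_space \<Rightarrow> real \<Rightarrow> 'a measure \<Rightarrow> 'a measure \<Rightarrow> bool" where
  "is_closest_point u \<theta> F H \<longleftrightarrow>
     H \<in> sphere_densities u \<theta> \<and> (\<forall>G\<in>sphere_densities u \<theta>. W2 F H \<le> W2 F G)"

definition closest_point_on_sphere ::
  "'a::euclidean_space \<Rightarrow> real \<Rightarrow> 'a measure \<Rightarrow> 'a measure" where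
  "closest_point_on_sphere u \<theta> F = (THE H. is_closest_point u \<theta> F H)"

definition projected_chord ::
  "'a::euclidean_space \<Rightarrow> real \<Rightarrow> 'a measure \<Rightarrow> 'a measure \<Rightarrow> real \<Rightarrow> 'a measure" where
  "projected_chord u \<theta> F G t = closest_point_on_sphere u \<theta> (chordal_geodesic F G t)"

definition is_reparametrization :: "(real \<Rightarrow> real) \<Rightarrow> bool" where
  "is_reparametrization \<tau> \<longleftrightarrow>
     continuous_on {0..1} \<tau> \<and> strict_mono_on {0..1} \<tau> \<and> \<tau> 0 = 0 \<and> \<tau> 1 = 1"

end

theory Submission
  imports "HOL-Probability.Probability" "HOL-Complex_Analysis.Great_Picard" Defs
begin

text \<open>
  Up to the factor \<open>V = d \<theta>\<close>, the set \<open>\<E>\<close> behaves like the unit sphere of an \<open>L\<^sup>2\<close> space: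
  \<open>W\<^sub>2\<^sup>2(F, G) = V - c(F, G)\<close>, where \<open>c(F, G)\<close> is the largest value of \<open>\<integral> (x - u) \<bullet> (y - u) d\<gamma>\<close> over the
  couplings \<open>\<gamma>\<close>, so that \<open>c = V cos \<alpha>\<close> defines an angle \<open>\<alpha>\<close> and \<open>W\<^sub>2 = 2 R sin (\<alpha> / 2)\<close>. Given \<open>F, G, H\<close> in
  \<open>\<E>\<close>, the optimal maps from \<open>G\<close> to \<open>F\<close> and \<open>H\<close> realize the three laws as vectors \<open>f, g, h\<close> of \<open>L\<^sup>2(G)\<close>
  with \<open>f \<bullet> g\<close> and \<open>g \<bullet> h\<close> optimal and \<open>f \<bullet> h\<close> at most optimal; hence \<open>\<alpha>\<close> inherits the triangle inequality
  of the sphere, and its equality case identifies \<open>G\<close> with a point of the great circle through \<open>f\<close> and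
  \<open>h\<close>, which is the projected chord.

  The optimal map itself is obtained from semidiscrete transport: for a finitely supported target it
  is the gradient of a maximum of affine functions whose heights minimize the dual functional. The
  \<open>L\<^sup>2\<close> bound on these gradients makes the convex functions locally equi-Lipschitz on the interior of
  the convex hull of the support of \<open>F\<close>, and gradients converge wherever the limit is differentiable.
\<close>

section \<open>Almost everywhere differentiability of convex functions\<close>

text \<open>\<open>optimal_map\<close> is merely some gradient map with the right push-forward, so
  its optimality and uniqueness must be extracted from convexity. Duality does this: the potentials
  bound every coupling by a quantity that sees only the marginals, and equality pins the second
  coordinate to the gradient.

  A law does not determine a vector of L2, so three laws are compared on the law in the middle.
  There the outer pair is merely a coupling, which bounds an angle from above only; that the angles
  along an arc are not smaller is then forced by the triangle inequality.

  Equal means give the independent coupling correlation 0, so no angle exceeds pi / 2. This rules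
  out antipodal points, keeps the sines invertible and makes the arc between two points unique.

  A geodesic is constrained through \<open>W2\<close>, which measures chords, while the triangle
  inequality that decides uniqueness is one for arcs. Arcs are recovered by arbitrarily fine
  subdivision, since n sin (c / n) tends to c.\<close>

lemma convex_on_if_subgradient:
  fixes \<psi> :: "'a::euclidean_space \<Rightarrow> real"
  assumes "convex C"
    and sub: "\<And>x z. x \<in> C \<Longrightarrow> z \<in> C \<Longrightarrow> \<psi> x + S x \<bullet> (z - x) \<le> \<psi> z"
  shows "convex_on C \<psi>"
  unfolding convex_on_def
proof (intro conjI ballI allI impI)
  fix x y and s t :: real assume xy: "x \<in> C" "y \<in> C" and st: "0 \<le> s" "0 \<le> t" "s + t = 1"
  let ?m = "s *\<^sub>R x + t *\<^sub>R y"
  have m: "?m \<in> C" using \<open>convex C\<close> xy st by (simp add: convex_def)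
  have "s * (\<psi> ?m + S ?m \<bullet> (x - ?m)) \<le> s * \<psi> x" "t * (\<psi> ?m + S ?m \<bullet> (y - ?m)) \<le> t * \<psi> y"
    using sub[OF m] xy st by (auto intro!: mult_left_mono)
  moreover have "s * (\<psi> ?m + S ?m \<bullet> (x - ?m)) + t * (\<psi> ?m + S ?m \<bullet> (y - ?m))
      = (s + t) * \<psi> ?m + S ?m \<bullet> (?m - (s + t) *\<^sub>R ?m)"
    by (simp add: algebra_simps inner_diff_right inner_add_right)
  ultimately show "\<psi> ?m \<le> s * \<psi> x + t * \<psi> y" using st by simp
qed (fact)

text \<open>On a line in direction \<open>b\<close> the slope given by \<open>S\<close> is monotone,
  hence continuous off a countable set, and at a continuity point the symmetric second difference is
  o(h). Fubini turns countable line sections into a null set. Second differences of \<psi> are used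
  because they are Borel, whereas \<open>S\<close> is an arbitrary selection of
  subgradients.\<close>

lemma AE_second_difference_quotient:
  fixes \<psi> :: "'a::euclidean_space \<Rightarrow> real"
  assumes "open C" "convex C"
    and sub: "\<And>x z. x \<in> C \<Longrightarrow> z \<in> C \<Longrightarrow> \<psi> x + S x \<bullet> (z - x) \<le> \<psi> z"
  shows "AE x in lborel. x \<in> C \<longrightarrow>
    (\<lambda>n. real (Suc n) * (\<psi> (x + (1 / real (Suc n)) *\<^sub>R b) + \<psi> (x - (1 / real (Suc n)) *\<^sub>R b) - 2 * \<psi> x)) \<longlonglongrightarrow> 0"
proof -
  have "continuous_on C \<psi>"
    using convex_on_continuous[OF \<open>open C\<close> convex_on_if_subgradient[OF \<open>convex C\<close> sub]] by simp
  \<comment> \<open>The cut-off makes the difference quotients Borel on the whole space; at a point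
    of the open set \<open>C\<close> they agree with those of \<psi> for large n.\<close>
  define \<psi>' where "\<psi>' x = indicator C x *\<^sub>R \<psi> x" for x
  have [measurable]: "C \<in> sets borel" using \<open>open C\<close> by simp
  have [measurable]: "\<psi>' \<in> borel_measurable borel"
    using borel_measurable_continuous_on_indicator[OF _ \<open>continuous_on C \<psi>\<close>]
    unfolding \<psi>'_def[abs_def] by simp
  define q where "q n x = real (Suc n) * (\<psi>' (x + (1 / real (Suc n)) *\<^sub>R b) + \<psi>' (x - (1 / real (Suc n)) *\<^sub>R b) - 2 * \<psi>' x)" for n x
  have [measurable]: "q n \<in> borel_measurable borel" for n unfolding q_def[abs_def] by measurable
  define N where "N = {x \<in> C. \<exists>k. \<forall>m. \<exists>n\<ge>m. 1 / real (Suc k) \<le> \<bar>q n x\<bar>}"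
  have N_meas[measurable]: "N \<in> sets borel" unfolding N_def by measurable
  have NI: "x \<in> N \<or> (\<lambda>n. q n x) \<longlonglongrightarrow> 0" if "x \<in> C" for x
  proof -
    have "(\<lambda>n. q n x) \<longlonglongrightarrow> 0" if "\<forall>k. \<exists>m. \<forall>n\<ge>m. \<bar>q n x\<bar> < 1 / real (Suc k)"
    proof (rule LIMSEQ_I)
      fix r :: real assume "0 < r"
      then obtain k where "1 / real (Suc k) < r" using nat_approx_posE by blast
      then show "\<exists>no. \<forall>n\<ge>no. norm (q n x - 0) < r" using that
        by (metis (no_types, lifting) diff_zero order.strict_trans real_norm_def)
    qed
    moreover have "x \<in> N" if "\<not> (\<forall>k. \<exists>m. \<forall>n\<ge>m. \<bar>q n x\<bar> < 1 / real (Suc k))"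
      using \<open>x \<in> C\<close> that unfolding N_def by (simp add: not_less)
    ultimately show ?thesis by blast
  qed
  have cnt: "countable {t. x + t *\<^sub>R b \<in> N}" for x
  proof -
    define I where "I = {t. x + t *\<^sub>R b \<in> C}"
    have "open I"
    proof -
      have "continuous_on UNIV (\<lambda>t. x + t *\<^sub>R b)" by (intro continuous_intros)
      from open_vimage[OF \<open>open C\<close> this] show ?thesis unfolding I_def vimage_def .
    qed
    define s where "s t = S (x + t *\<^sub>R b) \<bullet> b" for t
    have ineq: "\<psi> (x + t *\<^sub>R b) + s t * (r - t) \<le> \<psi> (x + r *\<^sub>R b)" if "t \<in> I" "r \<in> I" for r t
    proof -
      have "x + r *\<^sub>R b - (x + t *\<^sub>R b) = (r - t) *\<^sub>R b" by (simp add: scaleR_diff_left)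
      then show ?thesis
        using sub[of "x + t *\<^sub>R b" "x + r *\<^sub>R b"] that by (simp add: I_def s_def mult.commute)
    qed
    have "mono_on I s"
    proof (rule mono_onI)
      fix t r assume tr: "t \<in> I" "r \<in> I" "t \<le> r"
      have "(s r - s t) * (r - t) \<ge> 0"
        using ineq[OF tr(1,2)] ineq[OF tr(2,1)] by (simp add: algebra_simps)
      with \<open>t \<le> r\<close> show "s t \<le> s r"
        by (cases "t = r") (simp_all add: zero_le_mult_iff)
    qed
    then have ct: "countable {t\<in>I. \<not> continuous (at t within I) s}" by (rule mono_on_ctble_discont)
    have "{t. x + t *\<^sub>R b \<in> N} \<subseteq> {t\<in>I. \<not> continuous (at t within I) s}"
    proof (safe)
      fix t assume tN: "x + t *\<^sub>R b \<in> N"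
      then show "t \<in> I" by (auto simp: N_def I_def)
      assume "continuous (at t within I) s"
      with \<open>t \<in> I\<close> \<open>open I\<close> have "isCont s t" by (metis at_within_open)
      from \<open>t \<in> I\<close> \<open>open I\<close> obtain r where r: "r > 0" "ball t r \<subseteq> I" by (meson openE)
      from tN obtain k where k: "\<And>m. \<exists>n\<ge>m. 1 / real (Suc k) \<le> \<bar>q n (x + t *\<^sub>R b)\<bar>"
        unfolding N_def by blast
      have "(\<lambda>n. 1 / real (Suc n)) \<longlonglongrightarrow> 0" by (rule LIMSEQ_Suc[OF lim_1_over_n])
      then have "(\<lambda>n. t + 1 / real (Suc n)) \<longlonglongrightarrow> t + 0" "(\<lambda>n. t - 1 / real (Suc n)) \<longlonglongrightarrow> t - 0"
        by (rule tendsto_add[OF tendsto_const] tendsto_diff[OF tendsto_const]; assumption)+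
      then have "(\<lambda>n. s (t + 1 / real (Suc n)) - s (t - 1 / real (Suc n))) \<longlonglongrightarrow> s t - s t"
        by (intro tendsto_diff[OF isCont_tendsto_compose[OF \<open>isCont s t\<close>] isCont_tendsto_compose[OF \<open>isCont s t\<close>]]) simp_all
      then have l: "(\<lambda>n. s (t + 1 / real (Suc n)) - s (t - 1 / real (Suc n))) \<longlonglongrightarrow> 0" by simp
      have "eventually (\<lambda>n. s (t + 1 / real (Suc n)) - s (t - 1 / real (Suc n)) < 1 / real (Suc k)) sequentially"
        using order_tendstoD(2)[OF l, of "1 / real (Suc k)"] by simp
      moreover have "eventually (\<lambda>n. 1 / real (Suc n) < r) sequentially"
        using order_tendstoD(2)[OF \<open>(\<lambda>n. 1 / real (Suc n)) \<longlonglongrightarrow> 0\<close> \<open>0 < r\<close>] .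
      ultimately have "eventually (\<lambda>n. \<bar>q n (x + t *\<^sub>R b)\<bar> < 1 / real (Suc k)) sequentially"
      proof eventually_elim
        case (elim n)
        define h where "h = 1 / real (Suc n)"
        have h: "0 < h" "h < r" using elim(2) by (auto simp: h_def)
        have "t + h \<in> ball t r" "t - h \<in> ball t r" using h by (auto simp: dist_real_def)
        then have I: "t + h \<in> I" "t - h \<in> I" using r(2) by blast+
        have e1: "x + t *\<^sub>R b + h *\<^sub>R b = x + (t + h) *\<^sub>R b" "x + t *\<^sub>R b - h *\<^sub>R b = x + (t - h) *\<^sub>R b"
          by (simp_all add: scaleR_add_left scaleR_diff_left)
        have C: "x + (t + h) *\<^sub>R b \<in> C" "x + (t - h) *\<^sub>R b \<in> C" "x + t *\<^sub>R b \<in> C"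
          using I \<open>t \<in> I\<close> by (auto simp: I_def)
        let ?Q = "\<psi> (x + (t + h) *\<^sub>R b) + \<psi> (x + (t - h) *\<^sub>R b) - 2 * \<psi> (x + t *\<^sub>R b)"
        have q: "q n (x + t *\<^sub>R b) = ?Q / h"
          unfolding q_def h_def[symmetric] e1 \<psi>'_def using C by (simp add: h_def)
        \<comment> \<open>Subgradients at the centre give the lower bound; those at the two outer
          points give the upper bound, \<open>h\<close> times the increment of
          \<open>s\<close>.\<close>
        have "0 \<le> ?Q" using ineq[OF \<open>t \<in> I\<close> I(1)] ineq[OF \<open>t \<in> I\<close> I(2)] by simp
        moreover have "?Q \<le> (s (t + h) - s (t - h)) * h"
          using ineq[OF I(1) \<open>t \<in> I\<close>] ineq[OF I(2) \<open>t \<in> I\<close>] by (simp add: left_diff_distrib)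
        ultimately have "\<bar>?Q / h\<bar> \<le> s (t + h) - s (t - h)"
          using h(1) by (simp add: abs_of_nonneg pos_divide_le_eq)
        with elim(1) show ?case unfolding q by (simp add: h_def)
      qed
      then show False using k unfolding eventually_sequentially by (meson leD)
    qed
    then show ?thesis using ct countable_subset by blast
  qed
  \<comment> \<open>The double integral of the indicator vanishes because every line meets
    \<open>N\<close> in a countable set. In the other order each inner integral is the measure of
    \<open>N\<close> by translation invariance, and integrating this constant over the real line
    leaves only the value 0.\<close>
  have ps: "pair_sigma_finite (lborel :: 'a measure) (lborel :: real measure)" ..
  have "0 = (\<integral>\<^sup>+ x. (\<integral>\<^sup>+ t. indicator N (x + t *\<^sub>R b) \<partial>(lborel::real measure)) \<partial>(lborel::'a measure))"
  proof -
    have "(\<integral>\<^sup>+ t. indicator N (x + t *\<^sub>R b) \<partial>(lborel::real measure)) = 0" for x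
    proof -
      have "(\<integral>\<^sup>+ t. indicator N (x + t *\<^sub>R b) \<partial>(lborel::real measure))
          = (\<integral>\<^sup>+ t. indicator {t. x + t *\<^sub>R b \<in> N} t \<partial>(lborel::real measure))"
        by (intro nn_integral_cong) (auto simp: indicator_def)
      also have "\<dots> = emeasure lborel {t. x + t *\<^sub>R b \<in> N}"
        by (intro nn_integral_indicator) measurable
      also have "\<dots> = 0" using countable_imp_null_set_lborel[OF cnt] by auto
      finally show ?thesis .
    qed
    then show ?thesis by simp
  qed
  also have "\<dots> = (\<integral>\<^sup>+ t. (\<integral>\<^sup>+ x. indicator N (x + t *\<^sub>R b) \<partial>(lborel::'a measure)) \<partial>(lborel::real measure))"
    by (intro pair_sigma_finite.Fubini'[OF ps, symmetric]) measurable
  also have "\<dots> = (\<integral>\<^sup>+ t. emeasure lborel N \<partial>(lborel::real measure))"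
  proof (intro nn_integral_cong)
    fix t :: real
    have "emeasure lborel N = emeasure (distr lborel borel ((+) (t *\<^sub>R b))) N"
      by (simp add: lborel_distr_plus)
    also have "\<dots> = (\<integral>\<^sup>+ x. indicator N x \<partial>distr lborel borel ((+) (t *\<^sub>R b)))" by simp
    also have "\<dots> = (\<integral>\<^sup>+ x. indicator N (x + t *\<^sub>R b) \<partial>lborel)"
      by (subst nn_integral_distr) (auto simp: add.commute)
    finally show "(\<integral>\<^sup>+ x. indicator N (x + t *\<^sub>R b) \<partial>lborel) = emeasure lborel N" by simp
  qed
  finally have "emeasure lborel N = 0" by (simp add: ennreal_mult_top split: if_splits)
  then have "N \<in> null_sets lborel" by (auto simp: null_sets_def)
  from AE_not_in[OF this] show ?thesis
  proof eventually_elim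
    case (elim x)
    show ?case
    proof
      assume "x \<in> C"
      with NI elim have l: "(\<lambda>n. q n x) \<longlonglongrightarrow> 0" by blast
      from \<open>x \<in> C\<close> \<open>open C\<close> obtain r where r: "r > 0" "ball x r \<subseteq> C" by (meson openE)
      have "(\<lambda>n. (1 / real (Suc n)) * norm b) \<longlonglongrightarrow> 0"
        by (rule tendsto_mult_left_zero[OF LIMSEQ_Suc[OF lim_1_over_n]])
      from order_tendstoD(2)[OF this \<open>0 < r\<close>]
      have "eventually (\<lambda>n. (1 / real (Suc n)) * norm b < r) sequentially" .
      then have "eventually (\<lambda>n. q n x = real (Suc n) * (\<psi> (x + (1 / real (Suc n)) *\<^sub>R b) + \<psi> (x - (1 / real (Suc n)) *\<^sub>R b) - 2 * \<psi> x)) sequentially"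
      proof eventually_elim
        case (elim n)
        then have "x + (1 / real (Suc n)) *\<^sub>R b \<in> ball x r" "x - (1 / real (Suc n)) *\<^sub>R b \<in> ball x r"
          by (auto simp: dist_norm)
        then have "x + (1 / real (Suc n)) *\<^sub>R b \<in> C" "x - (1 / real (Suc n)) *\<^sub>R b \<in> C"
          using r(2) by blast+
        then show ?case using \<open>x \<in> C\<close> unfolding q_def \<psi>'_def by simp
      qed
      then show "(\<lambda>n. real (Suc n) * (\<psi> (x + (1 / real (Suc n)) *\<^sub>R b) + \<psi> (x - (1 / real (Suc n)) *\<^sub>R b) - 2 * \<psi> x)) \<longlonglongrightarrow> 0"
        using l by (rule Lim_transform_eventually[rotated])
    qed
  qed
qed

text \<open>After subtraction of the affine minorant, \<open>g\<close> is nonnegative, convex and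
  zero at the origin, so the second difference dominates its values at h b and at - h b separately.
  Convexity extends the smallness from the steps 1 / (n + 1) to all small multiples of
  \<open>b\<close>, and then from the axes to all directions, since a vector is the average of its
  rescaled components.\<close>

lemma GDERIV_if_second_difference_quotients:
  fixes \<psi> :: "'a::euclidean_space \<Rightarrow> real"
  assumes "open C" "convex_on C \<psi>" "x \<in> C"
    and sub: "\<And>z. z \<in> C \<Longrightarrow> \<psi> x + y \<bullet> (z - x) \<le> \<psi> z"
    and lim: "\<And>b. b \<in> Basis \<Longrightarrow> (\<lambda>n. real (Suc n) * (\<psi> (x + (1 / real (Suc n)) *\<^sub>R b)
      + \<psi> (x - (1 / real (Suc n)) *\<^sub>R b) - 2 * \<psi> x)) \<longlonglongrightarrow> 0"
  shows "GDERIV \<psi> x :> y"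
proof -
  obtain r where r: "r > 0" "ball x r \<subseteq> C" using \<open>open C\<close> \<open>x \<in> C\<close> by (meson openE)
  define g where "g z = \<psi> (x + z) - \<psi> x - y \<bullet> z" for z
  let ?d = "real DIM('a)"
  have B: "x + z \<in> C" if "norm z < r" for z
    using that r(2) by (auto simp: dist_norm subset_iff)
  have g0: "g 0 = 0" by (simp add: g_def)
  have g_nonneg: "0 \<le> g z" if "norm z < r" for z
    using sub[OF B[OF that]] by (simp add: g_def)
  have "convex_on (ball 0 r) g"
    unfolding convex_on_def
  proof (intro conjI ballI allI impI)
    fix a b :: 'a and s t :: real
    assume ab: "a \<in> ball 0 r" "b \<in> ball 0 r" and st: "0 \<le> s" "0 \<le> t" "s + t = 1"
    have e: "x + (s *\<^sub>R a + t *\<^sub>R b) = s *\<^sub>R (x + a) + t *\<^sub>R (x + b)"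
      using st(3) by (simp add: algebra_simps flip: scaleR_add_left)
    have "\<psi> (x + (s *\<^sub>R a + t *\<^sub>R b)) \<le> s * \<psi> (x + a) + t * \<psi> (x + b)"
      unfolding e using \<open>convex_on C \<psi>\<close> ab B st by (simp add: convex_on_def)
    moreover have "\<psi> x = s * \<psi> x + t * \<psi> x" using st(3) by (simp flip: distrib_right)
    ultimately show "g (s *\<^sub>R a + t *\<^sub>R b) \<le> s * g a + t * g b"
      by (simp add: g_def algebra_simps inner_add_right)
  qed simp
  then have gc: "g (t *\<^sub>R z) \<le> t * g z" if "norm z < r" "0 \<le> t" "t \<le> 1" for t z
  proof -
    have "g (t *\<^sub>R z + (1 - t) *\<^sub>R 0) \<le> t * g z + (1 - t) * g 0"
      using \<open>convex_on (ball 0 r) g\<close>[unfolded convex_on_def, THEN conjunct2, rule_format, of z 0 t "1 - t"] that r(1)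
      by simp
    then show ?thesis using g0 by simp
  qed
  have "(\<psi> has_derivative (\<lambda>h. h \<bullet> y)) (at x)"
    unfolding has_derivative_at_alt
  proof (intro conjI allI impI)
    show "bounded_linear (\<lambda>h. h \<bullet> y)" by (rule bounded_linear_inner_left)
    fix e :: real assume "e > 0"
    \<comment> \<open>Writing \<open>w\<close> as an average over d basis vectors stretches each
      component by d, so the axis estimate must be d times better.\<close>
    define e' where "e' = e / ?d"
    have "e' > 0" using \<open>e > 0\<close> by (simp add: e'_def)
    have "\<forall>b\<in>Basis. eventually (\<lambda>n. real (Suc n) * (\<psi> (x + (1 / real (Suc n)) *\<^sub>R b)
      + \<psi> (x - (1 / real (Suc n)) *\<^sub>R b) - 2 * \<psi> x) < e') sequentially"
      using order_tendstoD(2)[OF lim \<open>0 < e'\<close>] by blast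
    then have "eventually (\<lambda>n. \<forall>b\<in>Basis. real (Suc n) * (\<psi> (x + (1 / real (Suc n)) *\<^sub>R b)
      + \<psi> (x - (1 / real (Suc n)) *\<^sub>R b) - 2 * \<psi> x) < e') sequentially"
      by (simp add: eventually_ball_finite_distrib)
    moreover have "eventually (\<lambda>n. 1 / real (Suc n) < r) sequentially"
      using order_tendstoD(2)[OF LIMSEQ_Suc[OF lim_1_over_n] \<open>0 < r\<close>] .
    ultimately have "eventually (\<lambda>n. \<forall>b\<in>Basis. 1 / real (Suc n) < r \<and> real (Suc n) * (\<psi> (x + (1 / real (Suc n)) *\<^sub>R b)
      + \<psi> (x - (1 / real (Suc n)) *\<^sub>R b) - 2 * \<psi> x) < e') sequentially"
      by eventually_elim auto
    then obtain m where m: "\<And>n b. n \<ge> m \<Longrightarrow> b \<in> Basis \<Longrightarrow> 1 / real (Suc n) < r \<and>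
      real (Suc n) * (\<psi> (x + (1 / real (Suc n)) *\<^sub>R b) + \<psi> (x - (1 / real (Suc n)) *\<^sub>R b) - 2 * \<psi> x) < e'"
      unfolding eventually_sequentially by blast
    have small: "g (c *\<^sub>R b) \<le> e' * \<bar>c\<bar>" if "b \<in> Basis" "\<bar>c\<bar> < 1 / real (Suc m)" for b c
    proof (cases "c = 0")
      case False
      \<comment> \<open>The step \<open>h = 1 / Suc n\<close> is then at least |c|, so c b lies
        between 0 and one of h b, - h b; the \<open>- 1\<close> compensates
        \<open>Suc\<close>.\<close>
      define n where "n = nat \<lfloor>1 / \<bar>c\<bar>\<rfloor> - 1"
      have c1: "real (Suc m) < 1 / \<bar>c\<bar>" using that(2) False by (simp add: field_simps)
      then have "Suc m \<le> nat \<lfloor>1 / \<bar>c\<bar>\<rfloor>" by linarith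
      then have "m \<le> n" and Sn: "Suc n = nat \<lfloor>1 / \<bar>c\<bar>\<rfloor>" by (auto simp: n_def)
      have "real (Suc n) \<le> 1 / \<bar>c\<bar>" unfolding Sn by (simp add: of_nat_nat)
      define h where "h = 1 / real (Suc n)"
      have "0 < h" by (simp add: h_def)
      have ch: "\<bar>c\<bar> / h \<le> 1" using \<open>real (Suc n) \<le> 1 / \<bar>c\<bar>\<close> False by (simp add: h_def field_simps)
      have hr: "h < r" and q: "(\<psi> (x + h *\<^sub>R b) + \<psi> (x - h *\<^sub>R b) - 2 * \<psi> x) / h < e'"
        using m[OF \<open>m \<le> n\<close> \<open>b \<in> Basis\<close>] by (simp_all add: h_def mult.commute)
      have nb: "norm (h *\<^sub>R b) < r" "norm ((- h) *\<^sub>R b) < r" using hr \<open>0 < h\<close> \<open>b \<in> Basis\<close> by auto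
      have "g (h *\<^sub>R b) + g ((- h) *\<^sub>R b) = \<psi> (x + h *\<^sub>R b) + \<psi> (x - h *\<^sub>R b) - 2 * \<psi> x"
        by (simp add: g_def)
      with g_nonneg[OF nb(1)] g_nonneg[OF nb(2)]
      have le: "g (h *\<^sub>R b) \<le> \<psi> (x + h *\<^sub>R b) + \<psi> (x - h *\<^sub>R b) - 2 * \<psi> x"
        "g ((- h) *\<^sub>R b) \<le> \<psi> (x + h *\<^sub>R b) + \<psi> (x - h *\<^sub>R b) - 2 * \<psi> x" by auto
      define k where "k = sgn c * h"
      have k: "k = h \<or> k = - h" using False by (auto simp: k_def sgn_if)
      have "c = (\<bar>c\<bar> / h) * k" using \<open>0 < h\<close> by (simp add: k_def abs_mult_sgn)
      then have "c *\<^sub>R b = (\<bar>c\<bar> / h) *\<^sub>R (k *\<^sub>R b)" by simp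
      then have "g (c *\<^sub>R b) \<le> \<bar>c\<bar> / h * g (k *\<^sub>R b)"
        using gc[of "k *\<^sub>R b" "\<bar>c\<bar> / h"] k nb ch \<open>0 < h\<close> by (metis abs_ge_zero divide_nonneg_pos)
      also have "\<dots> \<le> \<bar>c\<bar> / h * (\<psi> (x + h *\<^sub>R b) + \<psi> (x - h *\<^sub>R b) - 2 * \<psi> x)"
        using k le \<open>0 < h\<close> by (intro mult_left_mono) auto
      also have "\<dots> = \<bar>c\<bar> * ((\<psi> (x + h *\<^sub>R b) + \<psi> (x - h *\<^sub>R b) - 2 * \<psi> x) / h)" by simp
      also have "\<dots> \<le> \<bar>c\<bar> * e'" using q by (intro mult_left_mono) auto
      finally show ?thesis by (simp add: mult.commute)
    qed (use g0 in simp)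
    define \<delta> where "\<delta> = min r (min r (1 / real (Suc m)) / ?d)"
    have "\<delta> > 0" using r(1) by (simp add: \<delta>_def)
    have "norm (\<psi> z - \<psi> x - (z - x) \<bullet> y) \<le> e * norm (z - x)" if "norm (z - x) < \<delta>" for z
    proof -
      define w where "w = z - x"
      have w: "norm w < r" "?d * norm w < 1 / real (Suc m)" "?d * norm w < r"
        using that by (auto simp: w_def \<delta>_def field_simps)
      have "w = (\<Sum>b\<in>Basis. (1 / ?d) *\<^sub>R ((?d * (w \<bullet> b)) *\<^sub>R b))"
        by (simp add: euclidean_representation)
      then have "g w = g (\<Sum>b\<in>Basis. (1 / ?d) *\<^sub>R ((?d * (w \<bullet> b)) *\<^sub>R b))" by simp
      also have "\<dots> \<le> (\<Sum>b\<in>Basis. (1 / ?d) * g ((?d * (w \<bullet> b)) *\<^sub>R b))"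
      proof (rule convex_on_sum[OF _ _ \<open>convex_on (ball 0 r) g\<close>])
        fix b :: 'a assume "b \<in> Basis"
        then have "?d * \<bar>w \<bullet> b\<bar> \<le> ?d * norm w" by (intro mult_left_mono Basis_le_norm) auto
        with w(3) have "?d * \<bar>w \<bullet> b\<bar> < r" by linarith
        then show "(?d * (w \<bullet> b)) *\<^sub>R b \<in> ball 0 r" using \<open>b \<in> Basis\<close> by (simp add: abs_mult)
      qed auto
      also have "\<dots> \<le> (\<Sum>b\<in>(Basis::'a set). (1 / ?d) * (e' * (?d * norm w)))"
      proof (intro sum_mono mult_left_mono)
        fix b :: 'a assume b: "b \<in> Basis"
        then have 1: "?d * \<bar>w \<bullet> b\<bar> \<le> ?d * norm w" by (intro mult_left_mono Basis_le_norm) auto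
        then have "g ((?d * (w \<bullet> b)) *\<^sub>R b) \<le> e' * \<bar>?d * (w \<bullet> b)\<bar>"
          using w(2) 1 by (intro small b) (simp only: abs_mult abs_of_nat)
        also have "\<dots> \<le> e' * (?d * norm w)"
          using 1 \<open>0 < e'\<close> by (intro mult_left_mono) (auto simp: abs_mult)
        finally show "g ((?d * (w \<bullet> b)) *\<^sub>R b) \<le> e' * (?d * norm w)" .
      qed simp
      also have "\<dots> = e * norm w" by (simp add: e'_def)
      finally have "g w \<le> e * norm w" .
      moreover have "g w = \<psi> z - \<psi> x - (z - x) \<bullet> y" by (simp add: g_def w_def inner_commute)
      ultimately show ?thesis using g_nonneg[OF w(1)] by (simp add: w_def)
    qed
    with \<open>\<delta> > 0\<close> show "\<exists>d>0. \<forall>z. norm (z - x) < d \<longrightarrow> norm (\<psi> z - \<psi> x - (z - x) \<bullet> y) \<le> e * norm (z - x)"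
      by blast
  qed
  then show ?thesis by (simp add: gderiv_def)
qed

text \<open>One null set serves the finitely many basis directions; off it an arbitrary subgradient
  selection is forced to be the gradient.\<close>

theorem AE_GDERIV_subgradient:
  fixes \<psi> :: "'a::euclidean_space \<Rightarrow> real"
  assumes "open C" "convex C"
    and sub: "\<And>x z. x \<in> C \<Longrightarrow> z \<in> C \<Longrightarrow> \<psi> x + S x \<bullet> (z - x) \<le> \<psi> z"
  shows "AE x in lborel. x \<in> C \<longrightarrow> GDERIV \<psi> x :> S x"
proof -
  have "AE x in lborel. \<forall>b\<in>Basis. x \<in> C \<longrightarrow> (\<lambda>n. real (Suc n) * (\<psi> (x + (1 / real (Suc n)) *\<^sub>R b)
      + \<psi> (x - (1 / real (Suc n)) *\<^sub>R b) - 2 * \<psi> x)) \<longlonglongrightarrow> 0"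
    using AE_second_difference_quotient[OF assms] by (intro AE_finite_allI) auto
  then show ?thesis
  proof eventually_elim
    case (elim x)
    then show ?case
      using GDERIV_if_second_difference_quotients[OF \<open>open C\<close> convex_on_if_subgradient[OF \<open>convex C\<close> sub], of x "S x"] sub
      by blast
  qed
qed

section \<open>Semidiscrete optimal transport\<close>

text \<open>The members of \<open>densities\<close> without a chosen density (see
  \<open>densities_iff_ac_prob\<close>): absolute continuity can be checked on push-forwards by
  following null sets.\<close>

locale ac_prob = prob_space F for F :: "'a::euclidean_space measure" +
  assumes sets_F[measurable_cong, simp]: "sets F = sets borel"
    and ac: "absolutely_continuous lborel F"
    and square_integrable: "integrable F (\<lambda>x. (norm x)\<^sup>2)"
begin

lemma space_F[simp]: "space F = UNIV"
  using sets_eq_imp_space_eq[OF sets_F] by simp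

lemma prob_UNIV[simp]: "prob UNIV = 1"
  using prob_space by simp

lemma measurable_F[simp]: "measurable F N = measurable borel N"
  by (rule measurable_cong_sets) simp_all

lemma AE_lborel: "AE x in lborel. P x \<Longrightarrow> AE x in F. P x"
  by (rule absolutely_continuous_AE[OF _ ac]) simp_all

lemma AE_not_in_negligible: "negligible N \<Longrightarrow> AE x in F. x \<notin> N"
  using AE_not_in[of N lebesgue] by (intro AE_lborel) (simp add: negligible_iff_null_sets AE_completion_iff)

lemma norm_integrable: "integrable F norm"
proof (rule Bochner_Integration.integrable_bound[OF Bochner_Integration.integrable_add[OF square_integrable integrable_const[of 1]]])
  have "norm x \<le> (norm x)\<^sup>2 + 1" for x :: 'a
  proof -
    have "0 \<le> (norm x - 1)\<^sup>2" by simp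
    then have "2 * norm x \<le> (norm x)\<^sup>2 + 1" by (simp add: power2_diff)
    then show ?thesis using norm_ge_zero[of x] by linarith
  qed
  then show "AE x in F. norm (norm x) \<le> norm ((norm x)\<^sup>2 + 1)" by simp
qed simp

text \<open>Formally, the derivative of \<Phi> in the height \<open>h y\<close> is
  \<open>p y\<close> minus the mass of the cell where y attains the maximum. A one-sided variation
  at a minimizer gives each closed cell mass at least \<open>p y\<close>. The cells overlap only in
  hyperplanes and both families of masses sum to 1, so all these inequalities are
  equalities.\<close>

theorem semidiscrete_transport:
  fixes p :: "'a \<Rightarrow> real"
  assumes fin: "finite Y" and p_pos: "\<And>y. y \<in> Y \<Longrightarrow> 0 < p y" and p_sum: "sum p Y = 1"
  shows "\<exists>\<psi> S. S \<in> borel_measurable borel \<and> (\<forall>x. S x \<in> Y) \<and>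
    (\<forall>x z. \<psi> x + S x \<bullet> (z - x) \<le> \<psi> z) \<and> (\<forall>y\<in>Y. prob {x. S x = y} = p y)"
proof -
  have ne: "Y \<noteq> {}" using p_sum by auto
  have p_le1: "p y \<le> 1" if "y \<in> Y" for y
    using member_le_sum[OF that, of p] fin p_pos p_sum by (metis DiffE less_imp_le)
  define m where "m h x = Max ((\<lambda>y. x \<bullet> y - h y) ` Y)" for h and x :: 'a
  have m_ge: "x \<bullet> y - h y \<le> m h x" if "y \<in> Y" for h x y
    unfolding m_def using fin that by simp
  have m_le: "m h x \<le> c" if "\<And>y. y \<in> Y \<Longrightarrow> x \<bullet> y - h y \<le> c" for h x c
    unfolding m_def using fin ne that by simp
  have m_att: "\<exists>y\<in>Y. m h x = x \<bullet> y - h y" for h x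
  proof -
    have "m h x \<in> (\<lambda>y. x \<bullet> y - h y) ` Y" unfolding m_def using fin ne by (intro Max_in) auto
    then show ?thesis by auto
  qed
  have m_meas[measurable]: "m h \<in> borel_measurable borel" for h
    unfolding m_def[abs_def] using fin by (intro borel_measurable_Max) auto
  define M where "M = (\<Sum>y\<in>Y. norm y)"
  have M: "norm y \<le> M" if "y \<in> Y" for y
    unfolding M_def using member_le_sum[OF that, of norm] fin by simp
  have xy: "\<bar>x \<bullet> y\<bar> \<le> M * norm x" if "y \<in> Y" for x y
    using Cauchy_Schwarz_ineq2[of x y] M[OF that] mult_left_mono[OF M[OF that], of "norm x"]
    by (simp add: mult.commute)
  have m_bound: "\<bar>m h x\<bar> \<le> M * norm x + (\<Sum>y\<in>Y. \<bar>h y\<bar>)" for h x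
  proof -
    obtain y where y: "y \<in> Y" "m h x = x \<bullet> y - h y" using m_att by blast
    have "\<bar>h y\<bar> \<le> (\<Sum>y\<in>Y. \<bar>h y\<bar>)" using member_le_sum[OF y(1), of "\<lambda>y. \<bar>h y\<bar>"] fin by simp
    then show ?thesis using xy[OF y(1), of x] y(2) by linarith
  qed
  have m_int[simp]: "integrable F (m h)" for h
  proof (rule Bochner_Integration.integrable_bound)
    show "integrable F (\<lambda>x. M * norm x + (\<Sum>y\<in>Y. \<bar>h y\<bar>))"
      using norm_integrable by simp
    show "AE x in F. norm (m h x) \<le> norm (M * norm x + (\<Sum>y\<in>Y. \<bar>h y\<bar>))"
      using m_bound[of h] by (auto intro: order_trans[OF _ abs_ge_self])
  qed simp
  define \<Phi> where "\<Phi> h = (\<integral>x. m h x \<partial>F) + (\<Sum>y\<in>Y. p y * h y)" for h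
  have \<Phi>_lip: "\<Phi> h \<le> \<Phi> h' + 2 * (\<Sum>y\<in>Y. \<bar>h y - h' y\<bar>)" for h h'
  proof -
    let ?s = "\<Sum>y\<in>Y. \<bar>h y - h' y\<bar>"
    have "m h x \<le> m h' x + ?s" for x
    proof (rule m_le)
      fix y assume y: "y \<in> Y"
      have "\<bar>h y - h' y\<bar> \<le> ?s" using member_le_sum[OF y, of "\<lambda>y. \<bar>h y - h' y\<bar>"] fin by simp
      then show "x \<bullet> y - h y \<le> m h' x + ?s" using m_ge[OF y, of x h'] by linarith
    qed
    then have "(\<integral>x. m h x \<partial>F) \<le> (\<integral>x. m h' x + ?s \<partial>F)" by (intro integral_mono) auto
    also have "\<dots> = (\<integral>x. m h' x \<partial>F) + ?s" by (simp add: prob_space)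
    finally have 1: "(\<integral>x. m h x \<partial>F) \<le> (\<integral>x. m h' x \<partial>F) + ?s" .
    have "(\<Sum>y\<in>Y. p y * h y) \<le> (\<Sum>y\<in>Y. p y * h' y + \<bar>h y - h' y\<bar>)"
    proof (rule sum_mono)
      fix y assume y: "y \<in> Y"
      have "p y * (h y - h' y) \<le> p y * \<bar>h y - h' y\<bar>" using p_pos[OF y] by (intro mult_left_mono) auto
      also have "\<dots> \<le> 1 * \<bar>h y - h' y\<bar>" using p_le1[OF y] by (intro mult_right_mono) auto
      finally show "p y * h y \<le> p y * h' y + \<bar>h y - h' y\<bar>" by (simp add: right_diff_distrib)
    qed
    then show ?thesis using 1 by (simp add: \<Phi>_def sum.distrib)
  qed
  \<comment> \<open>Since \<open>p\<close> sums to 1, a common shift of the heights is free; it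
    suffices to compare with heights whose minimum is 0.\<close>
  have \<Phi>_shift: "\<Phi> (\<lambda>y. h y - c) = \<Phi> h" for h c
  proof -
    have "m (\<lambda>y. h y - c) x = m h x + c" for x
    proof (rule antisym)
      show "m (\<lambda>y. h y - c) x \<le> m h x + c" using m_ge[of _ x h] by (intro m_le) force
      have "m h x \<le> m (\<lambda>y. h y - c) x - c"
        using m_ge[of _ x "\<lambda>y. h y - c"] by (intro m_le) force
      then show "m h x + c \<le> m (\<lambda>y. h y - c) x" by simp
    qed
    moreover have "(\<Sum>y\<in>Y. p y * (h y - c)) = (\<Sum>y\<in>Y. p y * h y) - c"
      by (simp add: right_diff_distrib sum_subtractf p_sum flip: sum_distrib_right)
    ultimately show ?thesis by (simp add: \<Phi>_def prob_space)
  qed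
  define c0 where "c0 = M * (\<integral>x. norm x \<partial>F)"
  have "0 \<le> M" unfolding M_def by (intro sum_nonneg) auto
  then have "0 \<le> c0" unfolding c0_def by (intro mult_nonneg_nonneg integral_nonneg) auto
  have \<Phi>0: "\<Phi> (\<lambda>_. 0) \<le> c0"
  proof -
    have "m (\<lambda>_. 0) x \<le> M * norm x" for x using m_bound[of "\<lambda>_. 0" x] by simp
    then have "(\<integral>x. m (\<lambda>_. 0) x \<partial>F) \<le> (\<integral>x. M * norm x \<partial>F)"
      using norm_integrable by (intro integral_mono) auto
    then have "\<Phi> (\<lambda>_. 0) \<le> (\<integral>x. M * norm x \<partial>F)" unfolding \<Phi>_def by simp
    then show ?thesis by (simp add: c0_def)
  qed
  have \<Phi>_low: "- c0 + p y1 * h y1 \<le> \<Phi> h" if "y0 \<in> Y" "h y0 = 0" "\<And>y. y \<in> Y \<Longrightarrow> 0 \<le> h y" "y1 \<in> Y" for h y0 y1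
  proof -
    have "(\<integral>x. - (M * norm x) \<partial>F) \<le> (\<integral>x. m h x \<partial>F)"
    proof (intro integral_mono)
      fix x show "- (M * norm x) \<le> m h x"
        using m_ge[OF that(1), of x h] xy[OF that(1), of x] that(2) by linarith
    qed (use norm_integrable in auto)
    moreover have "p y1 * h y1 \<le> (\<Sum>y\<in>Y. p y * h y)"
      using fin that p_pos
      by (intro member_le_sum[of y1 Y "\<lambda>y. p y * h y"]) (auto intro!: mult_nonneg_nonneg intro: less_imp_le)
    ultimately show ?thesis by (simp add: \<Phi>_def c0_def)
  qed
  \<comment> \<open>If the least height is 0 and some height exceeds
    \<open>(2 * c0 + 1) / p y\<close>, then \<open>\<Phi>_low\<close> gives a value above c0 + 1,
    worse than all heights zero. So a minimizer over the box [0, K] is global; the sum over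
    \<open>Y\<close> dominates every threshold.\<close>
  define K where "K = (\<Sum>y\<in>Y. (2 * c0 + 1) / p y)"
  have K: "(2 * c0 + 1) / p y \<le> K" if "y \<in> Y" for y
    unfolding K_def using fin that p_pos \<open>0 \<le> c0\<close>
    by (intro member_le_sum[of y Y "\<lambda>y. (2 * c0 + 1) / p y"]) (auto intro!: divide_nonneg_pos)
  have "0 \<le> K"
  proof -
    obtain y where y: "y \<in> Y" using ne by blast
    have "0 \<le> (2 * c0 + 1) / p y" using p_pos[OF y] \<open>0 \<le> c0\<close> by simp
    with K[OF y] show ?thesis by linarith
  qed
  define B where "B = {h :: 'a \<Rightarrow> real. \<forall>y\<in>Y. 0 \<le> h y \<and> h y \<le> K}"
  obtain h where hB: "h \<in> B" and hmin: "\<And>h'. h' \<in> B \<Longrightarrow> \<Phi> h \<le> \<Phi> h'"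
  proof -
    have bdd: "bdd_below (\<Phi> ` B)"
    proof (rule bdd_belowI2)
      fix h' assume "h' \<in> B"
      then have "(\<Sum>y\<in>Y. \<bar>0 - h' y\<bar>) \<le> (\<Sum>y\<in>Y. K)" by (intro sum_mono) (auto simp: B_def)
      then show "\<Phi> (\<lambda>_. 0) - 2 * (\<Sum>y\<in>Y. K) \<le> \<Phi> h'" using \<Phi>_lip[of "\<lambda>_. 0" h'] by linarith
    qed
    have "(\<lambda>_. 0) \<in> B" using \<open>0 \<le> K\<close> by (simp add: B_def)
    then have ne': "\<Phi> ` B \<noteq> {}" by auto
    have "\<exists>h'\<in>B. \<Phi> h' < Inf (\<Phi> ` B) + 1 / real (Suc n)" for n
      using cInf_lessD[OF ne', of "Inf (\<Phi> ` B) + 1 / real (Suc n)"] by auto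
    then obtain H where H: "\<And>n. H n \<in> B" "\<And>n. \<Phi> (H n) < Inf (\<Phi> ` B) + 1 / real (Suc n)" by metis
    obtain k where k: "strict_mono (k::nat\<Rightarrow>nat)" "\<And>y. y \<in> Y \<Longrightarrow> \<exists>l. (\<lambda>n. H (k n) y) \<longlonglongrightarrow> l"
      using function_convergent_subsequence[of Y H K] H(1) fin by (auto simp: B_def countable_finite)
    then obtain h where h: "\<And>y. y \<in> Y \<Longrightarrow> (\<lambda>n. H (k n) y) \<longlonglongrightarrow> h y" by metis
    have "h \<in> B" unfolding B_def
    proof (safe)
      fix y assume "y \<in> Y"
      show "0 \<le> h y" by (rule LIMSEQ_le_const[OF h[OF \<open>y \<in> Y\<close>]]) (use H(1) \<open>y \<in> Y\<close> in \<open>auto simp: B_def\<close>)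
      show "h y \<le> K" by (rule LIMSEQ_le_const2[OF h[OF \<open>y \<in> Y\<close>]]) (use H(1) \<open>y \<in> Y\<close> in \<open>auto simp: B_def\<close>)
    qed
    have "(\<lambda>n. Inf (\<Phi> ` B) + 1 / real (Suc (k n)) + 2 * (\<Sum>y\<in>Y. \<bar>h y - H (k n) y\<bar>)) \<longlonglongrightarrow> Inf (\<Phi> ` B) + 0 + 2 * (\<Sum>y\<in>Y. \<bar>h y - h y\<bar>)"
      using h LIMSEQ_subseq_LIMSEQ[OF LIMSEQ_Suc[OF lim_1_over_n] k(1)]
      by (intro tendsto_add tendsto_const tendsto_mult tendsto_sum tendsto_rabs tendsto_diff) (auto simp: o_def)
    moreover have "\<Phi> h \<le> Inf (\<Phi> ` B) + 1 / real (Suc (k n)) + 2 * (\<Sum>y\<in>Y. \<bar>h y - H (k n) y\<bar>)" for n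
      using \<Phi>_lip[of h "H (k n)"] H(2)[of "k n"] by linarith
    ultimately have "\<Phi> h \<le> Inf (\<Phi> ` B) + 0 + 2 * (\<Sum>y\<in>Y. \<bar>h y - h y\<bar>)"
      by (intro LIMSEQ_le_const) auto
    then have "\<Phi> h \<le> Inf (\<Phi> ` B)" by simp
    then show ?thesis using that[OF \<open>h \<in> B\<close>] cINF_lower[OF bdd] by (meson order_trans)
  qed
  have hglob: "\<Phi> h \<le> \<Phi> h'" for h'
  proof -
    obtain y0 where y0: "y0 \<in> Y" "\<And>y. y \<in> Y \<Longrightarrow> h' y0 \<le> h' y"
      using Min_in[of "h' ` Y"] fin ne by (metis (no_types, lifting) Min_le finite_imageI image_iff image_is_empty)
    define h'' where "h'' y = h' y - h' y0" for y
    have e: "\<Phi> h'' = \<Phi> h'" unfolding h''_def[abs_def] by (rule \<Phi>_shift)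
    have h'': "h'' y0 = 0" "\<And>y. y \<in> Y \<Longrightarrow> 0 \<le> h'' y" using y0 by (auto simp: h''_def)
    show ?thesis
    proof (cases "h'' \<in> B")
      case False
      then obtain y1 where y1: "y1 \<in> Y" "K < h'' y1" using h''(2) by (force simp: B_def)
      have "(2 * c0 + 1) / p y1 < h'' y1" using K[OF y1(1)] y1(2) by linarith
      then have "2 * c0 + 1 < p y1 * h'' y1" using p_pos[OF y1(1)] by (simp add: field_simps)
      then have "c0 \<le> \<Phi> h''" using \<Phi>_low[of y0 h'' y1, OF y0(1) h'' y1(1)] by linarith
      moreover have "\<Phi> h \<le> \<Phi> (\<lambda>_. 0)" using \<open>0 \<le> K\<close> by (intro hmin) (simp add: B_def)
      ultimately show ?thesis using \<Phi>0 e by linarith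
    qed (use hmin e in force)
  qed
  define A where "A y = {x. m h x \<le> x \<bullet> y - h y}" for y
  have A_meas[measurable]: "A y \<in> sets borel" for y unfolding A_def by measurable
  have pA: "p y \<le> prob (A y)" if y: "y \<in> Y" for y
  proof -
    define D where "D e = {x. m h x \<le> x \<bullet> y - h y + e}" for e
    have D_meas[measurable]: "D e \<in> sets borel" for e unfolding D_def by measurable
    have pD: "p y \<le> prob (D e)" if "e > 0" for e
    proof -
      \<comment> \<open>Lowering one height by \<open>e\<close> raises the maximum by at most
        \<open>e\<close>, and only where y was within \<open>e\<close> of attaining it. Minimality
        then forces \<open>p y \<le> prob (D e)\<close>.\<close>
      let ?h = "h(y := h y - e)"
      have "m ?h x \<le> m h x + e * indicator (D e) x" for x
      proof (rule m_le)
        fix y' assume "y' \<in> Y"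
        then show "x \<bullet> y' - ?h y' \<le> m h x + e * indicator (D e) x"
          using m_ge[of y' x h] m_ge[OF y, of x h] \<open>e > 0\<close> by (auto simp: D_def indicator_def)
      qed
      then have "(\<integral>x. m ?h x \<partial>F) \<le> (\<integral>x. m h x + e * indicator (D e) x \<partial>F)"
        by (intro integral_mono) (auto simp: emeasure_eq_measure)
      also have "\<dots> = (\<integral>x. m h x \<partial>F) + e * prob (D e)"
        by (subst Bochner_Integration.integral_add) (auto simp: emeasure_eq_measure)
      finally have "\<Phi> ?h \<le> (\<integral>x. m h x \<partial>F) + e * prob (D e) + (\<Sum>z\<in>Y. p z * ?h z)" by (simp add: \<Phi>_def)
      also have "(\<Sum>z\<in>Y. p z * ?h z) = (\<Sum>z\<in>Y. p z * h z) - p y * e"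
        using fin y by (simp add: sum.remove[OF fin y] right_diff_distrib)
      finally have "\<Phi> ?h \<le> \<Phi> h + e * (prob (D e) - p y)"
        unfolding \<Phi>_def[of h] by (simp add: right_diff_distrib mult.commute del: fun_upd_apply)
      with hglob[of ?h] have "0 \<le> e * (prob (D e) - p y)" by linarith
      with \<open>e > 0\<close> show ?thesis by (simp add: zero_le_mult_iff)
    qed
    have "(\<lambda>n. prob (D (1 / real (Suc n)))) \<longlonglongrightarrow> prob (\<Inter>n. D (1 / real (Suc n)))"
    proof (rule finite_Lim_measure_decseq)
      show "decseq (\<lambda>n. D (1 / real (Suc n)))"
      proof (rule decseq_SucI, rule subsetI)
        fix n x assume "x \<in> D (1 / real (Suc (Suc n)))"
        moreover have "1 / real (Suc (Suc n)) \<le> 1 / real (Suc n)" by (simp add: frac_le)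
        ultimately show "x \<in> D (1 / real (Suc n))" unfolding D_def by simp
      qed
    qed auto
    moreover have "(\<Inter>n. D (1 / real (Suc n))) = A y"
    proof (rule antisym; rule subsetI)
      fix x assume x: "x \<in> (\<Inter>n. D (1 / real (Suc n)))"
      have "(\<lambda>n. x \<bullet> y - h y + 1 / real (Suc n)) \<longlonglongrightarrow> x \<bullet> y - h y + 0"
        by (intro tendsto_add tendsto_const LIMSEQ_Suc[OF lim_1_over_n])
      then have "m h x \<le> x \<bullet> y - h y + 0" by (rule LIMSEQ_le_const) (use x in \<open>auto simp: D_def\<close>)
      then show "x \<in> A y" by (simp add: A_def)
    next
      fix x assume "x \<in> A y"
      then have "m h x \<le> x \<bullet> y - h y + 1 / real (Suc n)" for n
        by (simp add: A_def add_increasing2)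
      then show "x \<in> (\<Inter>n. D (1 / real (Suc n)))" by (simp add: D_def)
    qed
    ultimately show ?thesis using pD by (metis (no_types, lifting) LIMSEQ_le_const of_nat_0_less_iff zero_less_Suc zero_less_divide_1_iff)
  qed
  \<comment> \<open>The enumeration breaks ties by the least index, which keeps the selection
    \<open>S\<close> Borel.\<close>
  obtain e where e: "bij_betw e {..<card Y} Y" using ex_bij_betw_nat_finite[OF fin] by (auto simp: atLeast0LessThan)
  define L where "L x = (LEAST i. i < card Y \<and> x \<in> A (e i))" for x
  have L: "L x < card Y \<and> x \<in> A (e (L x))" for x
  proof -
    obtain y where "y \<in> Y" "x \<in> A y" using m_att[of h x] by (auto simp: A_def)
    then obtain i where "i < card Y \<and> x \<in> A (e i)" using e by (metis bij_betw_iff_bijections lessThan_iff)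
    then show ?thesis unfolding L_def by (rule LeastI)
  qed
  have L_meas: "L \<in> measurable borel (count_space UNIV)"
    unfolding L_def[abs_def] by (intro measurable_Least) measurable
  define S where "S x = e (L x)" for x
  have S_meas[measurable]: "S \<in> borel_measurable borel"
    unfolding S_def[abs_def] by (rule measurable_compose[OF L_meas]) simp
  have SY: "S x \<in> Y" and SA: "x \<in> A (S x)" for x
    using L[of x] e by (auto simp: S_def bij_betw_def)
  have sub: "m h x + S x \<bullet> (z - x) \<le> m h z" for x z
    using SA[of x] m_ge[OF SY[of x], of z h] by (simp add: A_def inner_diff_right inner_commute)
  have SP: "p y \<le> prob {x. S x = y}" if y: "y \<in> Y" for y
  proof -
    \<comment> \<open>Two distinct slopes tie only on a hyperplane, which the absolutely continuous
      \<open>F\<close> does not charge; almost everywhere on the cell \<open>A y\<close> the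
      selection is therefore y.\<close>
    have "AE x in F. \<forall>y'\<in>Y - {y}. x \<notin> {x. (y - y') \<bullet> x = h y - h y'}"
      using fin by (intro AE_finite_allI AE_not_in_negligible negligible_hyperplane) auto
    then have "AE x in F. x \<in> A y \<longrightarrow> x \<in> {x. S x = y}"
    proof eventually_elim
      case (elim x)
      show ?case
      proof (intro impI CollectI, rule ccontr)
        assume xA: "x \<in> A y" and "S x \<noteq> y"
        then have "(y - S x) \<bullet> x \<noteq> h y - h (S x)" using elim SY by blast
        moreover have "x \<bullet> y - h y = x \<bullet> S x - h (S x)"
          using xA SA[of x] m_ge[OF y, of x h] m_ge[OF SY[of x], of x h] by (auto simp: A_def)
        ultimately show False by (simp add: inner_diff_right inner_diff_left inner_commute)
      qed
    qed
    then have "prob (A y) \<le> prob {x. S x = y}" by (intro finite_measure_mono_AE) measurable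
    then show ?thesis using pA[OF y] by linarith
  qed
  have "(\<Sum>y\<in>Y. prob {x. S x = y}) = prob (\<Union>y\<in>Y. {x. S x = y})"
    by (intro finite_measure_finite_Union[symmetric] fin) (auto simp: disjoint_family_on_def)
  also have "(\<Union>y\<in>Y. {x. S x = y}) = space F" using SY by auto
  finally have "(\<Sum>y\<in>Y. prob {x. S x = y} - p y) = 0" by (simp add: sum_subtractf p_sum prob_space)
  then have "\<forall>y\<in>Y. prob {x. S x = y} - p y = 0"
    using SP fin by (subst (asm) sum_nonneg_eq_0_iff) auto
  then show ?thesis using S_meas SY sub by (intro exI[of _ "m h"] exI[of _ S]) auto
qed

end

section \<open>Existence of optimal maps\<close>

text \<open>Closed sets form an intersection-stable generator, and the continuous functions max 0 (1
  - k dist(x, A)) decrease to the indicator of a nonempty closed set A.\<close>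

lemma borel_measure_eqI_continuous:
  fixes M N :: "'a::metric_space measure"
  assumes "finite_measure M" "finite_measure N" and sets: "sets M = sets borel" "sets N = sets borel"
    and eq: "\<And>f :: 'a \<Rightarrow> real. continuous_on UNIV f \<Longrightarrow> (\<And>x. 0 \<le> f x \<and> f x \<le> 1) \<Longrightarrow> (\<integral>x. f x \<partial>M) = (\<integral>x. f x \<partial>N)"
  shows "M = N"
proof -
  interpret M: finite_measure M by fact
  interpret N: finite_measure N by fact
  have closed_eq: "emeasure M A = emeasure N A" if "closed A" "A \<noteq> {}" for A
  proof -
    define f where "f k x = max 0 (1 - real k * infdist x A)" for k x
    have cont: "continuous_on UNIV (f k)" for k
      unfolding f_def[abs_def] by (intro continuous_intros)
    have b: "0 \<le> f k x \<and> f k x \<le> 1" for k x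
      by (simp add: f_def infdist_nonneg)
    have lim: "(\<lambda>k. f k x) \<longlonglongrightarrow> indicator A x" for x
    proof (cases "x \<in> A")
      case True
      then show ?thesis using that by (simp add: f_def in_closed_iff_infdist_zero)
    next
      case False
      then have p: "0 < infdist x A" using that by (meson infdist_pos_not_in_closed)
      obtain K where K: "1 / infdist x A < real K" using reals_Archimedean2 by blast
      have "f k x = 0" if "k \<ge> K" for k
      proof -
        have "1 / infdist x A < real k" using K that by linarith
        with p have "1 < real k * infdist x A" by (simp add: field_simps)
        then show ?thesis by (simp add: f_def)
      qed
      then have "eventually (\<lambda>k. f k x = 0) sequentially" unfolding eventually_sequentially by blast
      then show ?thesis using False by (simp add: tendsto_eventually)
    qed
    have A: "A \<in> sets borel" using that by simp
    have conv: "(\<lambda>k. \<integral>x. f k x \<partial>L) \<longlonglongrightarrow> measure L A" if "finite_measure L" "sets L = sets borel" for L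
    proof -
      interpret L: finite_measure L by fact
      note [measurable_cong] = \<open>sets L = sets borel\<close>
      have [measurable]: "f k \<in> borel_measurable borel" for k by (rule borel_measurable_continuous_onI[OF cont])
      note [measurable] = A
      have "(\<lambda>k. \<integral>x. f k x \<partial>L) \<longlonglongrightarrow> (\<integral>x. indicator A x \<partial>L)"
      proof (rule integral_dominated_convergence[where w = "\<lambda>_. 1"])
        show "AE x in L. (\<lambda>k. f k x) \<longlonglongrightarrow> indicator A x" using lim by simp
        show "AE x in L. norm (f k x) \<le> 1" for k using b[of k] by simp
      qed auto
      then show ?thesis using A \<open>sets L = sets borel\<close> by (simp add: sets_eq_imp_space_eq)
    qed
    have "measure M A = measure N A"
      using conv[OF \<open>finite_measure M\<close> sets(1)] conv[OF \<open>finite_measure N\<close> sets(2)] eq[OF cont b]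
      by (simp add: LIMSEQ_unique)
    then show ?thesis by (simp add: M.emeasure_eq_measure N.emeasure_eq_measure)
  qed
  show ?thesis
  proof (rule measure_eqI_generator_eq[where E = "Collect closed" and \<Omega> = UNIV and A = "\<lambda>_. UNIV"])
    show "Int_stable (Collect (closed :: 'a set \<Rightarrow> bool))" by (auto simp: Int_stable_def)
    show "sets M = sigma_sets UNIV (Collect closed)" "sets N = sigma_sets UNIV (Collect closed)"
      using sets by (simp_all add: borel_eq_closed)
    show "emeasure M X = emeasure N X" if "X \<in> Collect closed" for X
      using closed_eq that by (cases "X = {}") auto
  qed (use M.emeasure_finite in auto)
qed

text \<open>Dominated convergence for bounded continuous test functions carries the equality of laws
  to the limit. This is how the push-forward condition survives the approximation of the
  target.\<close>

lemma distr_eq_if_AE_tendsto: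
  fixes S :: "nat \<Rightarrow> 'a \<Rightarrow> 'c::{metric_space,second_countable_topology}" and q :: "nat \<Rightarrow> 'b \<Rightarrow> 'c"
  assumes "finite_measure M" "finite_measure N"
    and meas[measurable]: "\<And>n. S n \<in> borel_measurable M" "\<And>n. q n \<in> borel_measurable N"
      "T \<in> borel_measurable M" "r \<in> borel_measurable N"
    and eq: "\<And>n. distr M borel (S n) = distr N borel (q n)"
    and S: "AE x in M. (\<lambda>n. S n x) \<longlonglongrightarrow> T x" and q: "AE x in N. (\<lambda>n. q n x) \<longlonglongrightarrow> r x"
  shows "distr M borel T = distr N borel r"
proof (rule borel_measure_eqI_continuous)
  interpret M: finite_measure M by fact
  interpret N: finite_measure N by fact
  show "finite_measure (distr M borel T)" "finite_measure (distr N borel r)"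
    by (auto intro: M.finite_measure_distr N.finite_measure_distr)
  fix f :: "'c \<Rightarrow> real" assume cont: "continuous_on UNIV f" and b: "\<And>x. 0 \<le> f x \<and> f x \<le> 1"
  have [measurable]: "f \<in> borel_measurable borel" by (rule borel_measurable_continuous_onI[OF cont])
  have isc: "isCont f x" for x using cont by (simp add: continuous_on_eq_continuous_at)
  have "(\<lambda>n. \<integral>x. f (S n x) \<partial>M) \<longlonglongrightarrow> (\<integral>x. f (T x) \<partial>M)"
  proof (rule integral_dominated_convergence[where w = "\<lambda>_. 1"])
    show "AE x in M. (\<lambda>n. f (S n x)) \<longlonglongrightarrow> f (T x)"
      using S by eventually_elim (rule isCont_tendsto_compose[OF isc])
  qed (use b in auto)
  moreover have "(\<lambda>n. \<integral>x. f (q n x) \<partial>N) \<longlonglongrightarrow> (\<integral>x. f (r x) \<partial>N)"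
  proof (rule integral_dominated_convergence[where w = "\<lambda>_. 1"])
    show "AE x in N. (\<lambda>n. f (q n x)) \<longlonglongrightarrow> f (r x)"
      using q by eventually_elim (rule isCont_tendsto_compose[OF isc])
  qed (use b in auto)
  moreover have "(\<integral>x. f (S n x) \<partial>M) = (\<integral>x. f (q n x) \<partial>N)" for n
    using arg_cong[OF eq[of n], of "\<lambda>L. \<integral>x. f x \<partial>L"] by (simp add: integral_distr)
  ultimately show "(\<integral>x. f x \<partial>distr M borel T) = (\<integral>x. f x \<partial>distr N borel r)"
    by (simp add: integral_distr LIMSEQ_unique)
qed auto

text \<open>The function \<open>\<psi> z - z \<bullet> y\<close> is minimal on \<open>C\<close> at
  the interior point \<open>x\<close>, so its derivative vanishes there.\<close>

lemma subgradient_unique: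
  fixes \<psi> :: "'a::euclidean_space \<Rightarrow> real"
  assumes "open C" "x \<in> C" "GDERIV \<psi> x :> s" and "\<And>z. z \<in> C \<Longrightarrow> \<psi> x + y \<bullet> (z - x) \<le> \<psi> z"
  shows "y = s"
proof -
  have "((\<lambda>z. \<psi> z - z \<bullet> y) has_derivative (\<lambda>h. h \<bullet> s - h \<bullet> y)) (at x)"
    using \<open>GDERIV \<psi> x :> s\<close> unfolding gderiv_def
    by (intro has_derivative_diff bounded_linear_imp_has_derivative bounded_linear_inner_left)
  moreover have "\<forall>z\<in>C. \<psi> x - x \<bullet> y \<le> \<psi> z - z \<bullet> y"
    using assms(4) by (force simp: inner_diff_right inner_commute)
  ultimately have "(\<lambda>h. h \<bullet> s - h \<bullet> y) = (\<lambda>h. 0)"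
    using differential_zero_maxmin[OF \<open>x \<in> C\<close> \<open>open C\<close>] by blast
  then have "(s - y) \<bullet> s - (s - y) \<bullet> y = 0" by metis
  then have "(s - y) \<bullet> (s - y) = 0" by (simp add: inner_diff_right)
  then show ?thesis by simp
qed

lemma bounded_unique_limit_point_imp_tendsto:
  fixes f :: "nat \<Rightarrow> 'a::euclidean_space"
  assumes bound: "\<And>n. norm (f n) \<le> b"
    and unique: "\<And>r l'. strict_mono r \<Longrightarrow> (\<lambda>n. f (r n)) \<longlonglongrightarrow> l' \<Longrightarrow> l' = l"
  shows "f \<longlonglongrightarrow> l"
proof (rule ccontr)
  assume "\<not> f \<longlonglongrightarrow> l"
  then obtain e where e: "e > 0" "\<not> eventually (\<lambda>n. dist (f n) l < e) sequentially"
    by (auto simp: tendsto_iff)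
  then obtain r :: "nat \<Rightarrow> nat" where r: "strict_mono r" "\<And>n. \<not> dist (f (r n)) l < e"
    using not_eventually_sequentiallyD by blast
  obtain l' k where k: "strict_mono (k :: nat \<Rightarrow> nat)" "((\<lambda>n. f (r n)) \<circ> k) \<longlonglongrightarrow> l'"
    using compact_cball[of "0::'a" b] bound unfolding compact_def by (metis mem_cball_0)
  have "l' = l" using unique[of "r \<circ> k" l'] strict_mono_o[OF r(1) k(1)] k(2) by (simp add: o_def)
  with k(2) have "eventually (\<lambda>n. dist (f (r (k n))) l < e) sequentially"
    using e(1) by (auto simp: tendsto_iff o_def)
  then show False using r(2) by (simp add: eventually_sequentially)
qed

section \<open>Deep points of a law and compactness of gradients\<close>

context ac_prob
begin

text \<open>The interior of the convex hull of the support of \<open>F\<close>.\<close>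

definition deep_set :: "'a set" where
  "deep_set = {x. \<exists>\<delta>>0. \<forall>e. norm e = 1 \<longrightarrow> \<delta> \<le> prob {z. \<delta> \<le> e \<bullet> (z - x)}}"

text \<open>Moving the base point by less than half the depth shortens every half-space margin by at
  most that much. Beyond openness, this makes the gradient bounds uniform near a deep point.\<close>

lemma deep_perturb:
  assumes \<delta>: "0 < \<delta>" "\<And>e. norm e = 1 \<Longrightarrow> \<delta> \<le> prob {z. \<delta> \<le> e \<bullet> (z - x)}"
    and "dist x y < \<delta> / 2" "norm e = 1"
  shows "\<delta> / 2 \<le> prob {z. \<delta> / 2 \<le> e \<bullet> (z - y)}"
proof -
  have "e \<bullet> (y - x) \<le> \<delta> / 2"
    using norm_cauchy_schwarz[of e "y - x"] assms(3,4) by (simp add: dist_norm norm_minus_commute)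
  then have "{z. \<delta> \<le> e \<bullet> (z - x)} \<subseteq> {z. \<delta> / 2 \<le> e \<bullet> (z - y)}"
    by (auto simp: inner_diff_right)
  then have "prob {z. \<delta> \<le> e \<bullet> (z - x)} \<le> prob {z. \<delta> / 2 \<le> e \<bullet> (z - y)}"
    by (intro finite_measure_mono) auto
  then show ?thesis using \<delta>(2)[OF assms(4)] \<delta>(1) by linarith
qed

lemma open_deep_set: "open deep_set"
proof (rule openI)
  fix x assume "x \<in> deep_set"
  then obtain \<delta> where \<delta>: "0 < \<delta>" "\<And>e. norm e = 1 \<Longrightarrow> \<delta> \<le> prob {z. \<delta> \<le> e \<bullet> (z - x)}"
    by (auto simp: deep_set_def)
  have "ball x (\<delta> / 2) \<subseteq> deep_set"
    unfolding deep_set_def using deep_perturb[OF \<delta>] \<delta>(1)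
    by (auto intro!: exI[of _ "\<delta> / 2"])
  then show "\<exists>e>0. ball x e \<subseteq> deep_set" using \<delta>(1) by (intro exI[of _ "\<delta> / 2"]) simp
qed

text \<open>In any direction at least one of the two end points lies as far out as the convex
  combination, and its half-space of large mass is contained in the corresponding one at the
  combination.\<close>

lemma convex_deep_set: "convex deep_set"
proof (rule convexI)
  fix x y and u v :: real assume xy: "x \<in> deep_set" "y \<in> deep_set" and uv: "0 \<le> u" "0 \<le> v" "u + v = 1"
  obtain a where a: "0 < a" "\<And>e. norm e = 1 \<Longrightarrow> a \<le> prob {z. a \<le> e \<bullet> (z - x)}"
    using xy(1) by (auto simp: deep_set_def)
  obtain b where b: "0 < b" "\<And>e. norm e = 1 \<Longrightarrow> b \<le> prob {z. b \<le> e \<bullet> (z - y)}"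
    using xy(2) by (auto simp: deep_set_def)
  let ?w = "u *\<^sub>R x + v *\<^sub>R y" and ?d = "min a b"
  have "?d \<le> prob {z. ?d \<le> e \<bullet> (z - ?w)}" if "norm e = 1" for e
  proof -
    have ew: "e \<bullet> ?w = u * (e \<bullet> x) + v * (e \<bullet> y)" by (simp add: inner_add_right)
    have "e \<bullet> ?w \<le> e \<bullet> x \<or> e \<bullet> ?w \<le> e \<bullet> y"
      unfolding ew using uv convex_bound_lt[of "e \<bullet> x" "u * (e \<bullet> x) + v * (e \<bullet> y)" "e \<bullet> y" u v]
      by (metis less_irrefl not_le)
    then show ?thesis
    proof
      assume "e \<bullet> ?w \<le> e \<bullet> x"
      then have "{z. a \<le> e \<bullet> (z - x)} \<subseteq> {z. ?d \<le> e \<bullet> (z - ?w)}" by (auto simp: inner_diff_right)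
      then have "prob {z. a \<le> e \<bullet> (z - x)} \<le> prob {z. ?d \<le> e \<bullet> (z - ?w)}"
        by (intro finite_measure_mono) auto
      then show ?thesis using a(2)[OF that] by linarith
    next
      assume "e \<bullet> ?w \<le> e \<bullet> y"
      then have "{z. b \<le> e \<bullet> (z - y)} \<subseteq> {z. ?d \<le> e \<bullet> (z - ?w)}" by (auto simp: inner_diff_right)
      then have "prob {z. b \<le> e \<bullet> (z - y)} \<le> prob {z. ?d \<le> e \<bullet> (z - ?w)}"
        by (intro finite_measure_mono) auto
      then show ?thesis using b(2)[OF that] by linarith
    qed
  qed
  then show "?w \<in> deep_set" unfolding deep_set_def using a(1) b(1) by (auto intro!: exI[of _ ?d])
qed

text \<open>By Lindelof the union of all null open half-spaces is null, and its complement
  \<open>K\<close> is convex, with negligible frontier. An interior point of \<open>K\<close> is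
  deep: failing half-spaces of margin and mass 1 / (n + 1) would, by compactness of the unit sphere,
  converge to a null half-space with the point on its boundary, which cuts into
  \<open>K\<close>.\<close>

lemma AE_deep_set: "AE x in F. x \<in> deep_set"
proof -
  define \<U> where "\<U> = {U. (\<exists>e c. U = {z::'a. c < e \<bullet> z}) \<and> emeasure F U = 0}"
  obtain \<V> where \<V>: "\<V> \<subseteq> \<U>" "countable \<V>" "\<Union>\<V> = \<Union>\<U>"
  proof (rule Lindelof[of \<U>])
    show "open U" if "U \<in> \<U>" for U using that by (auto simp: \<U>_def open_halfspace_gt)
  qed auto
  have "\<Union>\<V> \<in> null_sets F"
  proof (rule null_sets_UN'[of \<V> "\<lambda>x. x", simplified])
    show "U \<in> null_sets F" if "U \<in> \<V>" for U
      using that \<V>(1) by (auto simp: \<U>_def null_sets_def)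
  qed (use \<V> in auto)
  then have N: "\<Union>\<U> \<in> null_sets F" using \<V>(3) by simp
  define K where "K = \<Inter> (uminus ` \<U>)"
  have K: "x \<in> K \<longleftrightarrow> x \<notin> \<Union>\<U>" for x by (auto simp: K_def)
  have "convex K" unfolding K_def
  proof (rule convex_Inter)
    fix s assume "s \<in> uminus ` \<U>"
    then obtain e c where "s = - {z. c < e \<bullet> z}" by (auto simp: \<U>_def)
    then have "s = {z. e \<bullet> z \<le> c}" by auto
    then show "convex s" by (simp add: convex_halfspace_le)
  qed
  have deep: "x \<in> deep_set" if "x \<notin> \<Union>\<U>" "x \<notin> frontier K" for x
  proof (rule ccontr)
    assume "x \<notin> deep_set"
    have "x \<in> closure K" using that(1) K closure_subset by blast
    then have "x \<in> interior K" using that(2) by (simp add: frontier_def)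
    then obtain r where r: "0 < r" "ball x r \<subseteq> K" by (auto simp: mem_interior)
    have "\<exists>e. norm e = 1 \<and> prob {z. 1 / real (Suc n) \<le> e \<bullet> (z - x)} < 1 / real (Suc n)" for n
      using \<open>x \<notin> deep_set\<close> unfolding deep_set_def mem_Collect_eq not_ex
      by (auto simp: not_le dest: spec[of _ "1 / real (Suc n)"])
    then obtain e where e: "\<And>n. norm (e n) = 1"
        "\<And>n. prob {z. 1 / real (Suc n) \<le> e n \<bullet> (z - x)} < 1 / real (Suc n)" by metis
    obtain l k where l: "l \<in> sphere 0 1" and k: "strict_mono (k :: nat \<Rightarrow> nat)" "(e \<circ> k) \<longlonglongrightarrow> l"
      using compact_sphere[of "0::'a" 1] e(1) unfolding compact_def
      by (metis dist_0_norm mem_sphere)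
    define U where "U = {z. l \<bullet> x < l \<bullet> z}"
    have U_meas[measurable]: "U \<in> sets borel" unfolding U_def by measurable
    define A where "A n = {z. 1 / real (Suc (k n)) \<le> e (k n) \<bullet> (z - x)}" for n
    have A_meas[measurable]: "A n \<in> sets borel" for n unfolding A_def by measurable
    have sk: "(\<lambda>n. 1 / real (Suc (k n))) \<longlonglongrightarrow> 0"
      using LIMSEQ_subseq_LIMSEQ[OF LIMSEQ_Suc[OF lim_1_over_n] k(1)] by (simp add: o_def)
    \<comment> \<open>Inside \<open>U\<close> the limiting strict inequality holds eventually along
      the sequence, so the masses of \<open>A n \<inter> U\<close> converge to that of
      \<open>U\<close>; they tend to 0, so \<open>U\<close> is null.\<close>
    have "(\<lambda>n. \<integral>z. indicator (A n \<inter> U) z \<partial>F) \<longlonglongrightarrow> (\<integral>z. indicator U z \<partial>F :: real)"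
    proof (rule integral_dominated_convergence[where w = "\<lambda>_. 1"])
      have "(\<lambda>n. indicator (A n \<inter> U) z :: real) \<longlonglongrightarrow> indicator U z" for z
      proof (cases "z \<in> U")
        case True
        then have "0 < l \<bullet> (z - x)" by (simp add: U_def inner_diff_right)
        moreover have "(\<lambda>n. e (k n) \<bullet> (z - x) - 1 / real (Suc (k n))) \<longlonglongrightarrow> l \<bullet> (z - x) - 0"
          using k(2) by (intro tendsto_diff tendsto_inner sk tendsto_const) (simp add: o_def)
        ultimately have "eventually (\<lambda>n. 0 < e (k n) \<bullet> (z - x) - 1 / real (Suc (k n))) sequentially"
          by (intro order_tendstoD) auto
        then have "eventually (\<lambda>n. indicator (A n \<inter> U) z = (1::real)) sequentially"
          by eventually_elim (use True in \<open>simp add: A_def\<close>)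
        then show ?thesis using True by (simp add: tendsto_eventually)
      qed simp
      then show "AE z in F. (\<lambda>n. indicator (A n \<inter> U) z :: real) \<longlonglongrightarrow> indicator U z" by simp
    qed (auto simp: indicator_def)
    then have lim: "(\<lambda>n. prob (A n \<inter> U)) \<longlonglongrightarrow> prob U" by simp
    have "prob (A n \<inter> U) \<le> 1 / real (Suc (k n))" for n
    proof -
      have "prob (A n \<inter> U) \<le> prob (A n)" by (intro finite_measure_mono) auto
      then show ?thesis using e(2)[of "k n"] unfolding A_def by linarith
    qed
    then have "prob U \<le> 0" by (intro LIMSEQ_le[OF lim sk]) auto
    then have "emeasure F U = 0" by (simp add: emeasure_eq_measure measure_le_0_iff)
    then have "U \<in> \<U>" by (auto simp: \<U>_def U_def)
    have "norm l = 1" using l by simp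
    \<comment> \<open>A point of the ball inside \<open>K\<close> that nevertheless lies in the null
      half-space.\<close>
    define w where "w = x + (r / 2) *\<^sub>R l"
    have "w \<in> ball x r" using r(1) \<open>norm l = 1\<close> by (simp add: w_def dist_norm)
    moreover have "w \<in> U"
      using r(1) \<open>norm l = 1\<close> by (simp add: U_def w_def inner_add_right dot_square_norm)
    ultimately show False using r(2) \<open>U \<in> \<U>\<close> K by blast
  qed
  show ?thesis
    using AE_not_in[OF N] AE_not_in_negligible[OF negligible_convex_frontier[OF \<open>convex K\<close>]]
    by eventually_elim (rule deep)
qed

text \<open>In the direction of \<open>S x\<close> a mass of at least \<delta> lies at distance at
  least \<delta>. There monotonicity of subgradients gives |S x| \<delta> \<le> S x \<bullet> (z -
  x) \<le> S z \<bullet> (z - x), whose mean is controlled by second moments. One factor \<delta> of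
  the denominator comes from the distance, the other from the mass.\<close>

lemma subgradient_bound:
  fixes S :: "'a \<Rightarrow> 'a"
  assumes sub: "\<And>x z. \<psi> x + S x \<bullet> (z - x) \<le> \<psi> z"
    and [measurable]: "S \<in> borel_measurable borel" and "integrable F (\<lambda>x. (norm (S x))\<^sup>2)"
    and B: "(\<integral>x. (norm (S x))\<^sup>2 \<partial>F) \<le> B"
    and \<delta>: "0 < \<delta>" "\<And>e. norm e = 1 \<Longrightarrow> \<delta> \<le> prob {z. \<delta> \<le> e \<bullet> (z - x)}"
  shows "norm (S x) \<le> (B / 2 + (\<integral>z. (norm z)\<^sup>2 \<partial>F) + (norm x)\<^sup>2) / \<delta>\<^sup>2"
proof (cases "S x = 0")
  case True
  have "0 \<le> (\<integral>x. (norm (S x))\<^sup>2 \<partial>F)" by simp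
  then have "0 \<le> B" using B by linarith
  then show ?thesis using True by simp
next
  case False
  define e where "e = S x /\<^sub>R norm (S x)"
  have "norm e = 1" using False by (simp add: e_def)
  let ?A = "{z. \<delta> \<le> e \<bullet> (z - x)}"
  have pt: "norm (S x) * \<delta> * indicator ?A z \<le> (norm (S z))\<^sup>2 / 2 + (norm z)\<^sup>2 + (norm x)\<^sup>2" for z
  proof (cases "z \<in> ?A")
    case True
    have "norm (S x) * \<delta> \<le> norm (S x) * (e \<bullet> (z - x))" using True by (intro mult_left_mono) auto
    also have "\<dots> = S x \<bullet> (z - x)" using False by (simp add: e_def)
    also have "\<dots> \<le> S z \<bullet> (z - x)" using sub[of x z] sub[of z x] by (simp add: inner_diff_right)
    also have "\<dots> \<le> norm (S z) * norm (z - x)" by (rule norm_cauchy_schwarz)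
    also have "\<dots> \<le> (norm (S z))\<^sup>2 / 2 + (norm (z - x))\<^sup>2 / 2"
      using sum_squares_bound[of "norm (S z)" "norm (z - x)"] by simp
    also have "(norm (z - x))\<^sup>2 \<le> 2 * (norm z)\<^sup>2 + 2 * (norm x)\<^sup>2"
    proof -
      have "(norm (z - x))\<^sup>2 + (norm (z + x))\<^sup>2 = 2 * (norm z)\<^sup>2 + 2 * (norm x)\<^sup>2"
        by (simp add: power2_norm_eq_inner inner_diff_left inner_diff_right inner_add_left inner_add_right inner_commute)
      then show ?thesis using zero_le_power2[of "norm (z + x)"] by linarith
    qed
    finally show ?thesis using True by (simp add: add_divide_distrib)
  qed simp
  have "norm (S x) * \<delta> * \<delta> \<le> norm (S x) * \<delta> * prob ?A"
    using \<delta>(2)[OF \<open>norm e = 1\<close>] \<delta>(1) by (intro mult_left_mono) auto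
  also have "\<dots> = (\<integral>z. norm (S x) * \<delta> * indicator ?A z \<partial>F)" by simp
  also have "\<dots> \<le> (\<integral>z. (norm (S z))\<^sup>2 / 2 + (norm z)\<^sup>2 + (norm x)\<^sup>2 \<partial>F)"
    using pt square_integrable assms(3) by (intro integral_mono) (auto simp: emeasure_eq_measure)
  also have "\<dots> = (\<integral>z. (norm (S z))\<^sup>2 \<partial>F) / 2 + (\<integral>z. (norm z)\<^sup>2 \<partial>F) + (norm x)\<^sup>2"
    using square_integrable assms(3) by simp
  also have "\<dots> \<le> B / 2 + (\<integral>z. (norm z)\<^sup>2 \<partial>F) + (norm x)\<^sup>2" using B by simp
  finally show ?thesis using \<delta>(1) by (simp add: field_simps power2_eq_square)
qed

text \<open>Limit points of the gradients at a deep point are subgradients of the limit function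
  there. Where that function is differentiable there is only one, so the gradients converge along
  the subsequence already chosen for the potentials, with no further extraction.\<close>

theorem subgradient_compactness:
  fixes \<psi> :: "nat \<Rightarrow> 'a \<Rightarrow> real" and S :: "nat \<Rightarrow> 'a \<Rightarrow> 'a"
  assumes sub: "\<And>n x z. \<psi> n x + S n x \<bullet> (z - x) \<le> \<psi> n z"
    and S_meas[measurable]: "\<And>n. S n \<in> borel_measurable borel"
    and int: "\<And>n. integrable F (\<lambda>x. (norm (S n x))\<^sup>2)"
    and B: "\<And>n. (\<integral>x. (norm (S n x))\<^sup>2 \<partial>F) \<le> B"
  obtains k \<phi> T where "strict_mono (k :: nat \<Rightarrow> nat)" "convex_on deep_set \<phi>"
    "T \<in> borel_measurable borel" "AE x in F. x \<in> deep_set \<and> GDERIV \<phi> x :> T x \<and> (\<lambda>n. S (k n) x) \<longlonglongrightarrow> T x"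
proof -
  let ?C = deep_set
  have "?C \<noteq> {}" using AE_deep_set by auto
  then obtain x0 where x0: "x0 \<in> ?C" by blast
  have locb: "\<exists>r>0. \<exists>L\<ge>0. \<forall>y. dist x y < r \<longrightarrow> (\<forall>n. norm (S n y) \<le> L)" if "x \<in> ?C" for x
  proof -
    obtain \<delta> where \<delta>: "0 < \<delta>" "\<And>e. norm e = 1 \<Longrightarrow> \<delta> \<le> prob {z. \<delta> \<le> e \<bullet> (z - x)}"
      using \<open>x \<in> ?C\<close> by (auto simp: deep_set_def)
    define L where "L = (B / 2 + (\<integral>z. (norm z)\<^sup>2 \<partial>F) + (norm x + \<delta>)\<^sup>2) / (\<delta> / 2)\<^sup>2"
    have SL: "norm (S n y) \<le> L" if "dist x y < \<delta> / 2" for n y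
    proof -
      have "norm (S n y) \<le> (B / 2 + (\<integral>z. (norm z)\<^sup>2 \<partial>F) + (norm y)\<^sup>2) / (\<delta> / 2)\<^sup>2"
        using deep_perturb[OF \<delta> that] \<delta>(1) by (intro subgradient_bound[OF sub S_meas int B]) auto
      also have "norm y \<le> norm x + \<delta>"
        using norm_triangle_ineq2[of y x] that \<delta>(1) by (simp add: dist_norm norm_minus_commute)
      then have "(norm y)\<^sup>2 \<le> (norm x + \<delta>)\<^sup>2" by (intro power_mono) auto
      then have "(B / 2 + (\<integral>z. (norm z)\<^sup>2 \<partial>F) + (norm y)\<^sup>2) / (\<delta> / 2)\<^sup>2 \<le> L"
        unfolding L_def by (intro divide_right_mono) auto
      finally show ?thesis .
    qed
    have "0 \<le> norm (S 0 x)" by simp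
    also have "\<dots> \<le> L" using SL[of x 0] \<delta>(1) by simp
    finally show ?thesis using SL \<delta>(1) by (intro exI[of _ "\<delta> / 2"] conjI exI[of _ L]) auto
  qed
  have "\<exists>b\<ge>0. \<forall>n. norm (S n x) \<le> b" if "x \<in> ?C" for x
    using locb[OF that] by (metis dist_self)
  then obtain b where b: "\<And>x. x \<in> ?C \<Longrightarrow> 0 \<le> b x" "\<And>x n. x \<in> ?C \<Longrightarrow> norm (S n x) \<le> b x" by metis
  \<comment> \<open>The potentials are determined up to constants only, so they are anchored at
    \<open>x0\<close> before compactness is applied.\<close>
  define f where "f n x = \<psi> n x - \<psi> n x0" for n x
  have fsub: "f n x + S n x \<bullet> (z - x) \<le> f n z" for n x z using sub[of n x z] by (simp add: f_def)
  have flip: "\<bar>f n x - f n y\<bar> \<le> L * norm (x - y)" if "norm (S n x) \<le> L" "norm (S n y) \<le> L" for n x y L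
  proof -
    have "\<bar>S n x \<bullet> (y - x)\<bar> \<le> L * norm (x - y)" "\<bar>S n y \<bullet> (x - y)\<bar> \<le> L * norm (x - y)"
      using Cauchy_Schwarz_ineq2[of "S n x" "y - x"] Cauchy_Schwarz_ineq2[of "S n y" "x - y"]
        mult_right_mono[OF that(1), of "norm (x - y)"] mult_right_mono[OF that(2), of "norm (x - y)"]
      by (simp_all add: norm_minus_commute)
    then show ?thesis using fsub[of n x y] fsub[of n y x] by linarith
  qed
  \<comment> \<open>A bound on \<open>f n x\<close> uniform in \<open>n\<close> but not in
    \<open>x\<close>. Division by it prepares the diagonal argument, and the summand 1 keeps it away
    from 0.\<close>
  define c where "c x = 1 + (b x + b x0) * norm (x - x0)" for x
  have c: "1 \<le> c x" "\<bar>f n x\<bar> \<le> c x" if "x \<in> ?C" for x n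
  proof -
    show "1 \<le> c x" using b(1)[OF that] b(1)[OF x0] by (simp add: c_def)
    have "\<bar>f n x - f n x0\<bar> \<le> (b x + b x0) * norm (x - x0)"
      using b(1)[OF that] b(1)[OF x0] b(2)[OF that, of n] b(2)[OF x0, of n] by (intro flip) linarith+
    then show "\<bar>f n x\<bar> \<le> c x" by (simp add: c_def f_def)
  qed
  obtain D :: "'a set" where D: "countable D" "\<And>X. open X \<Longrightarrow> X \<noteq> {} \<Longrightarrow> \<exists>d\<in>D. d \<in> X"
    using countable_dense_setE by blast
  obtain k where k: "strict_mono (k :: nat \<Rightarrow> nat)" "\<And>x. x \<in> D \<inter> ?C \<Longrightarrow> \<exists>l. (\<lambda>n. f (k n) x / c x) \<longlonglongrightarrow> l"
  proof (rule function_convergent_subsequence[where S = "D \<inter> ?C" and f = "\<lambda>n x. f n x / c x" and M = 1])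
    show "norm (f n x / c x) \<le> 1" if "x \<in> D \<inter> ?C" for n x
      using c(1)[of x] c(2)[of x n] that by (simp add: abs_divide)
  qed (use D(1) in auto)
  have convD: "convergent (\<lambda>n. f (k n) d)" if d: "d \<in> D \<inter> ?C" for d
  proof -
    obtain l where "(\<lambda>n. f (k n) d / c d) \<longlonglongrightarrow> l" using k(2)[OF d] by blast
    then have "(\<lambda>n. f (k n) d / c d * c d) \<longlonglongrightarrow> l * c d" by (intro tendsto_mult tendsto_const)
    moreover have "c d \<noteq> 0" using c(1)[of d] d by auto
    ultimately show ?thesis by (auto simp: convergent_def)
  qed
  have "convergent (\<lambda>n. f (k n) x)" if xC: "x \<in> ?C" for x
  proof -
    obtain r L where r: "0 < r" "0 \<le> L" "\<And>y n. dist x y < r \<Longrightarrow> norm (S n y) \<le> L"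
      using locb[OF xC] by blast
    have "Cauchy (\<lambda>n. f (k n) x)"
    proof (rule metric_CauchyI)
      fix e :: real assume "0 < e"
      \<comment> \<open>Within this radius every \<open>f n\<close> changes by less than e / 3
        between \<open>x\<close> and a dense point, so the Cauchy property transfers to
        \<open>x\<close>; \<open>L + 1\<close> avoids a zero denominator.\<close>
      define s where "s = min r (e / (4 * (L + 1)))"
      have "0 < s" using r(1,2) \<open>0 < e\<close> by (simp add: s_def)
      have "open (ball x s \<inter> ?C)" "x \<in> ball x s \<inter> ?C"
        using open_deep_set \<open>0 < s\<close> xC by auto
      then obtain d where d: "d \<in> D" "d \<in> ball x s" "d \<in> ?C" using D(2)[of "ball x s \<inter> ?C"] by blast
      have "L * norm (x - d) \<le> L * s" using d(2) r(2) by (intro mult_left_mono) (auto simp: dist_norm)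
      also have "\<dots> \<le> L * (e / (4 * (L + 1)))" using r(2) by (intro mult_left_mono) (auto simp: s_def)
      also have "\<dots> < e / 3" using r(2) \<open>0 < e\<close> by (simp add: field_simps add_strict_increasing)
      finally have Ld: "L * norm (x - d) < e / 3" .
      have fd: "\<bar>f n x - f n d\<bar> < e / 3" for n
      proof -
        have "\<bar>f n x - f n d\<bar> \<le> L * norm (x - d)"
          using d(2) r(1) by (intro flip r(3)) (auto simp: s_def)
        then show ?thesis using Ld by linarith
      qed
      have "Cauchy (\<lambda>n. f (k n) d)" using convD[of d] d by (simp add: Cauchy_convergent_iff)
      then obtain M where M: "\<And>m n. m \<ge> M \<Longrightarrow> n \<ge> M \<Longrightarrow> dist (f (k m) d) (f (k n) d) < e / 3"
        using metric_CauchyD[of _ "e / 3"] \<open>0 < e\<close> by (metis divide_pos_pos zero_less_numeral)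
      have "dist (f (k m) x) (f (k n) x) < e" if "m \<ge> M" "n \<ge> M" for m n
        using M[OF that] fd[of "k m"] fd[of "k n"] unfolding dist_real_def by linarith
      then show "\<exists>M. \<forall>m\<ge>M. \<forall>n\<ge>M. dist (f (k m) x) (f (k n) x) < e" by blast
    qed
    then show ?thesis by (simp add: Cauchy_convergent_iff)
  qed
  then obtain \<phi> where \<phi>: "\<And>x. x \<in> ?C \<Longrightarrow> (\<lambda>n. f (k n) x) \<longlonglongrightarrow> \<phi> x"
    unfolding convergent_def by metis
  have limsub: "\<phi> x + y \<bullet> (z - x) \<le> \<phi> z"
    if "strict_mono (r :: nat \<Rightarrow> nat)" "(\<lambda>n. S (k (r n)) x) \<longlonglongrightarrow> y" "x \<in> ?C" "z \<in> ?C" for r x y z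
  proof (rule LIMSEQ_le)
    show "(\<lambda>n. f (k (r n)) x + S (k (r n)) x \<bullet> (z - x)) \<longlonglongrightarrow> \<phi> x + y \<bullet> (z - x)"
      using LIMSEQ_subseq_LIMSEQ[OF \<phi>[OF \<open>x \<in> ?C\<close>] that(1)]
      by (intro tendsto_add tendsto_inner that tendsto_const) (simp add: o_def)
    show "(\<lambda>n. f (k (r n)) z) \<longlonglongrightarrow> \<phi> z"
      using LIMSEQ_subseq_LIMSEQ[OF \<phi>[OF \<open>z \<in> ?C\<close>] that(1)] by (simp add: o_def)
  qed (use fsub in blast)
  have "\<exists>y. \<forall>z\<in>?C. \<phi> x + y \<bullet> (z - x) \<le> \<phi> z" if xC: "x \<in> ?C" for x
  proof -
    obtain y r where "strict_mono (r :: nat \<Rightarrow> nat)" "((\<lambda>n. S (k n) x) \<circ> r) \<longlonglongrightarrow> y"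
      using compact_cball[of "0::'a" "b x"] b(2)[OF xC] unfolding compact_def by (metis mem_cball_0)
    then show ?thesis using limsub[of r x y] xC by (auto simp: o_def)
  qed
  then obtain s where s: "\<And>x z. x \<in> ?C \<Longrightarrow> z \<in> ?C \<Longrightarrow> \<phi> x + s x \<bullet> (z - x) \<le> \<phi> z" by metis
  have "AE x in F. x \<in> ?C \<longrightarrow> GDERIV \<phi> x :> s x"
    by (intro AE_lborel AE_GDERIV_subgradient open_deep_set convex_deep_set s)
  \<comment> \<open>As a pointwise limit, \<open>T\<close> is Borel everywhere; where the sequence
    diverges, \<open>lim\<close> returns a default value, which happens on an F-null set
    only.\<close>
  define T where "T x = lim (\<lambda>n. S (k n) x)" for x
  show thesis
  proof (rule that)
    show "convex_on ?C \<phi>" by (rule convex_on_if_subgradient[OF convex_deep_set s])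
    show "T \<in> borel_measurable borel" unfolding T_def[abs_def] by measurable
    show "AE x in F. x \<in> deep_set \<and> GDERIV \<phi> x :> T x \<and> (\<lambda>n. S (k n) x) \<longlonglongrightarrow> T x"
      using AE_deep_set \<open>AE x in F. x \<in> ?C \<longrightarrow> GDERIV \<phi> x :> s x\<close>
    proof eventually_elim
      case (elim x)
      then have C: "x \<in> ?C" and G: "GDERIV \<phi> x :> s x" by auto
      have "(\<lambda>n. S (k n) x) \<longlonglongrightarrow> s x"
      proof (rule bounded_unique_limit_point_imp_tendsto[OF b(2)[OF C]])
        fix r l' assume "strict_mono (r :: nat \<Rightarrow> nat)" "(\<lambda>n. S (k (r n)) x) \<longlonglongrightarrow> l'"
        then show "l' = s x" using limsub[of r x l'] C by (intro subgradient_unique[OF open_deep_set C G]) auto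
      qed
      moreover from this have "T x = s x" by (simp add: T_def limI)
      ultimately show ?case using C G by simp
    qed
  qed (fact k(1))
qed

text \<open>The target is discretized by simple functions \<open>q n\<close> tending to the
  identity. The bound by \<open>2 * dist y 0\<close> keeps their second moments below the constant
  \<open>B\<close>, as the compactness of the semidiscrete maps requires; the laws then pass to the
  limit on both sides.\<close>

theorem exists_optimal_map:
  assumes "prob_space G" "sets G = sets borel" and G2: "integrable G (\<lambda>x. (norm x)\<^sup>2)"
  shows "\<exists>T. is_optimal_map F G T"
proof -
  interpret G: prob_space G by fact
  note [measurable_cong, simp] = \<open>sets G = sets borel\<close>
  have space_G[simp]: "space G = UNIV" using sets_eq_imp_space_eq[OF \<open>sets G = sets borel\<close>] by simp
  have id: "(\<lambda>y. y) \<in> borel_measurable G" by measurable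
  obtain q :: "nat \<Rightarrow> 'a \<Rightarrow> 'a" where q: "\<And>i. simple_function G (q i)" "\<And>y. (\<lambda>i. q i y) \<longlonglongrightarrow> y"
      "\<And>i y. dist (q i y) 0 \<le> 2 * dist y 0"
    using borel_measurable_implies_sequence_metric[OF id, of 0] by auto
  have q_meas[measurable]: "q i \<in> borel_measurable borel" for i
    using borel_measurable_simple_function[OF q(1)[of i]] by simp
  have q2: "(norm (q i y))\<^sup>2 \<le> 4 * (norm y)\<^sup>2" for i y
    using power_mono[OF q(3)[of i y], of 2] by (simp add: power_mult_distrib)
  have q_int: "integrable G (\<lambda>y. (norm (q i y))\<^sup>2)" for i
    by (rule Bochner_Integration.integrable_bound[where f = "\<lambda>y. 4 * (norm y)\<^sup>2"]) (use G2 q2 in auto)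
  define B where "B = (\<integral>y. 4 * (norm y)\<^sup>2 \<partial>G)"
  have "\<exists>\<psi> S. S \<in> borel_measurable borel \<and> (\<forall>x z. \<psi> x + S x \<bullet> (z - x) \<le> \<psi> z)
      \<and> distr F borel S = distr G borel (q n)" for n
  proof -
    define R where "R = range (q n)"
    have "finite R" using q(1)[of n] by (simp add: simple_function_def R_def)
    define p where "p y = G.prob {z. q n z = y}" for y
    \<comment> \<open>Values taken with probability 0 are discarded, since the semidiscrete problem
      needs positive weights.\<close>
    define Y where "Y = {y \<in> R. p y > 0}"
    have zero: "p y = 0" if "y \<in> R - Y" for y
      using that measure_nonneg[of G "{z. q n z = y}"] by (auto simp: Y_def p_def)
    have sumR: "measure M {x. X x \<in> A} = (\<Sum>y\<in>R \<inter> A. measure M {x. X x = y})"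
      if "prob_space M" "sets M = sets borel" "X \<in> borel_measurable borel" "range X \<subseteq> R" "A \<in> sets borel"
      for M :: "'a measure" and X A
    proof -
      interpret M: prob_space M by fact
      note [measurable_cong] = \<open>sets M = sets borel\<close>
      note [measurable] = \<open>X \<in> borel_measurable borel\<close>
      have "{x. X x \<in> A} = (\<Union>y\<in>R \<inter> A. {x. X x = y})" using that(4) by auto
      also have "measure M \<dots> = (\<Sum>y\<in>R \<inter> A. measure M {x. X x = y})"
        using \<open>finite R\<close> by (intro M.finite_measure_finite_Union) (auto simp: disjoint_family_on_def \<open>sets M = sets borel\<close>)
      finally show ?thesis .
    qed
    have "1 = measure G {x. q n x \<in> UNIV}" using G.prob_space by simp
    also have "\<dots> = sum p R" by (subst sumR) (auto simp: p_def R_def G.prob_space_axioms)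
    also have "\<dots> = sum p Y" using \<open>finite R\<close> zero by (intro sum.mono_neutral_right) (auto simp: Y_def)
    finally have "sum p Y = 1" by simp
    moreover have "finite Y" using \<open>finite R\<close> by (simp add: Y_def)
    moreover have "0 < p y" if "y \<in> Y" for y using that by (simp add: Y_def)
    ultimately have "\<exists>\<psi> S. S \<in> borel_measurable borel \<and> (\<forall>x. S x \<in> Y) \<and>
        (\<forall>x z. \<psi> x + S x \<bullet> (z - x) \<le> \<psi> z) \<and> (\<forall>y\<in>Y. prob {x. S x = y} = p y)"
      by (intro semidiscrete_transport)
    then obtain \<psi> S where S: "S \<in> borel_measurable borel" "\<And>x. S x \<in> Y"
        "\<forall>x z. \<psi> x + S x \<bullet> (z - x) \<le> \<psi> z" "\<forall>y\<in>Y. prob {x. S x = y} = p y"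
      by blast
    note [measurable] = S(1)
    have eq: "prob {x. S x = y} = p y" if "y \<in> R" for y
    proof (cases "y \<in> Y")
      case False
      then have "{x. S x = y} = {}" using S(2) by auto
      then show ?thesis using zero[of y] that False by simp
    qed (use S(4) in blast)
    have "distr F borel S = distr G borel (q n)"
    proof (rule measure_eqI)
      fix A assume "A \<in> sets (distr F borel S)"
      then have [measurable]: "A \<in> sets borel" by simp
      have "prob {x. S x \<in> A} = (\<Sum>y\<in>R \<inter> A. prob {x. S x = y})"
        using S(2) by (intro sumR) (auto simp: prob_space_axioms Y_def)
      also have "\<dots> = (\<Sum>y\<in>R \<inter> A. p y)" using eq by (intro sum.cong) auto
      also have "\<dots> = measure G {x. q n x \<in> A}"
        unfolding p_def by (intro sumR[symmetric]) (auto simp: G.prob_space_axioms R_def)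
      finally show "emeasure (distr F borel S) A = emeasure (distr G borel (q n)) A"
        by (simp add: emeasure_distr vimage_def emeasure_eq_measure G.emeasure_eq_measure)
    qed simp
    with S show ?thesis by blast
  qed
  then have "\<forall>n. \<exists>\<psi> S. S \<in> borel_measurable borel \<and> (\<forall>x z. \<psi> x + S x \<bullet> (z - x) \<le> \<psi> z)
      \<and> distr F borel S = distr G borel (q n)" ..
  from choice[OF this] obtain \<psi> where
    "\<forall>n. \<exists>S. S \<in> borel_measurable borel \<and> (\<forall>x z. \<psi> n x + S x \<bullet> (z - x) \<le> \<psi> n z)
      \<and> distr F borel S = distr G borel (q n)" ..
  from choice[OF this] obtain S where S[measurable]: "\<And>n. S n \<in> borel_measurable borel"
      and sub: "\<And>n x z. \<psi> n x + S n x \<bullet> (z - x) \<le> \<psi> n z"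
      and distr: "\<And>n. distr F borel (S n) = distr G borel (q n)" by auto
  have int: "integrable F (\<lambda>x. (norm (S n x))\<^sup>2)" for n
    using arg_cong[OF distr[of n], of "\<lambda>M. integrable M (\<lambda>y. (norm y)\<^sup>2)"] q_int[of n]
    by (simp add: integrable_distr_eq)
  have "(\<integral>x. (norm (S n x))\<^sup>2 \<partial>F) = (\<integral>y. (norm (q n y))\<^sup>2 \<partial>G)" for n
    using arg_cong[OF distr[of n], of "\<lambda>M. \<integral>y. (norm y)\<^sup>2 \<partial>M"] by (simp add: integral_distr)
  moreover have "(\<integral>y. (norm (q n y))\<^sup>2 \<partial>G) \<le> B" for n
    unfolding B_def using q2 q_int G2 by (intro integral_mono) auto
  ultimately have bnd: "(\<integral>x. (norm (S n x))\<^sup>2 \<partial>F) \<le> B" for n by simp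
  obtain k \<phi> T where k: "strict_mono (k :: nat \<Rightarrow> nat)" and \<phi>: "convex_on deep_set \<phi>"
      and T[measurable]: "T \<in> borel_measurable borel"
      and AE: "AE x in F. x \<in> deep_set \<and> GDERIV \<phi> x :> T x \<and> (\<lambda>n. S (k n) x) \<longlonglongrightarrow> T x"
    by (rule subgradient_compactness[OF sub S int bnd])
  have "distr F borel T = distr G borel (\<lambda>y. y)"
  proof (rule distr_eq_if_AE_tendsto)
    show "finite_measure F" "finite_measure G" by unfold_locales
    show "distr F borel (S (k n)) = distr G borel (q (k n))" for n by (rule distr)
    show "AE x in F. (\<lambda>n. S (k n) x) \<longlonglongrightarrow> T x" using AE by eventually_elim simp
    show "AE y in G. (\<lambda>n. q (k n) y) \<longlonglongrightarrow> y"
      using LIMSEQ_subseq_LIMSEQ[OF q(2) k] by (simp add: o_def)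
  qed auto
  also have "distr G borel (\<lambda>y. y) = G" by (rule distr_id2) simp
  finally have "distr F borel T = G" .
  moreover have "AE x in F. x \<in> deep_set \<and> GDERIV \<phi> x :> T x" using AE by eventually_elim simp
  ultimately show ?thesis
    unfolding is_optimal_map_def using T open_deep_set convex_deep_set \<phi> by blast
qed

end

section \<open>Square integrable functions\<close>

definition square_integrable :: "'b measure \<Rightarrow> ('b \<Rightarrow> 'a::euclidean_space) \<Rightarrow> bool" where
  "square_integrable M f \<longleftrightarrow> f \<in> borel_measurable M \<and> integrable M (\<lambda>x. (norm (f x))\<^sup>2)"

lemma square_integrable_measurable[measurable_dest]: "square_integrable M f \<Longrightarrow> f \<in> borel_measurable M"
  by (simp add: square_integrable_def)

lemma square_integrable_inner:
  assumes "square_integrable M f" "square_integrable M g"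
  shows "integrable M (\<lambda>x. f x \<bullet> g x)"
proof (rule Bochner_Integration.integrable_bound)
  show "integrable M (\<lambda>x. (norm (f x))\<^sup>2 + (norm (g x))\<^sup>2)"
    using assms by (simp add: square_integrable_def)
  show "(\<lambda>x. f x \<bullet> g x) \<in> borel_measurable M"
    using assms by (auto simp: square_integrable_def)
  have "\<bar>f x \<bullet> g x\<bar> \<le> (norm (f x))\<^sup>2 + (norm (g x))\<^sup>2" for x
  proof -
    have "2 * (norm (f x) * norm (g x)) \<le> (norm (f x))\<^sup>2 + (norm (g x))\<^sup>2"
      using sum_squares_bound[of "norm (f x)" "norm (g x)"] by simp
    moreover have "0 \<le> norm (f x) * norm (g x)" by simp
    ultimately show ?thesis using Cauchy_Schwarz_ineq2[of "f x" "g x"] by linarith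
  qed
  then show "AE x in M. norm (f x \<bullet> g x) \<le> norm ((norm (f x))\<^sup>2 + (norm (g x))\<^sup>2)"
    by (auto intro: order_trans)
qed

lemma square_integrable_add:
  assumes f: "square_integrable M f" and g: "square_integrable M g"
  shows "square_integrable M (\<lambda>x. f x + g x)"
proof -
  have "(norm (f x + g x))\<^sup>2 = (norm (f x))\<^sup>2 + 2 * (f x \<bullet> g x) + (norm (g x))\<^sup>2" for x
    by (simp add: power2_norm_eq_inner inner_add_left inner_add_right inner_commute)
  then show ?thesis
    using f g square_integrable_inner[OF f g] by (auto simp: square_integrable_def)
qed

lemma square_integrable_scaleR:
  "square_integrable M f \<Longrightarrow> square_integrable M (\<lambda>x. c *\<^sub>R f x)"
  by (auto simp: square_integrable_def power_mult_distrib)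

lemma square_integrable_diff:
  assumes "square_integrable M f" "square_integrable M g"
  shows "square_integrable M (\<lambda>x. f x - g x)"
  using square_integrable_add[OF assms(1) square_integrable_scaleR[OF assms(2), of "-1"]] by simp

lemma (in finite_measure) square_integrable_const: "square_integrable M (\<lambda>x. c)"
  by (simp add: square_integrable_def)

lemma square_integrable_distr:
  assumes "f \<in> borel_measurable M"
  shows "square_integrable (distr M borel f) (\<lambda>x. x) \<longleftrightarrow> square_integrable M f"
  using assms by (simp add: square_integrable_def integrable_distr_eq)

lemma (in finite_measure) square_integrable_imp_integrable:
  assumes "square_integrable M f"
  shows "integrable M f"
proof (rule Bochner_Integration.integrable_bound)
  show "integrable M (\<lambda>x. (norm (f x))\<^sup>2 + 1)" using assms by (simp add: square_integrable_def)
  have "norm (f x) \<le> (norm (f x))\<^sup>2 + 1" for x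
    using sum_squares_bound[of "norm (f x)" 1] norm_ge_zero[of "f x"] by (simp, linarith)
  then show "AE x in M. norm (f x) \<le> norm ((norm (f x))\<^sup>2 + 1)" by simp
qed (use assms in measurable)

lemma integral_norm_combination:
  assumes "square_integrable M f" "square_integrable M g"
  shows "(\<integral>x. (norm (a *\<^sub>R f x + b *\<^sub>R g x))\<^sup>2 \<partial>M)
    = a\<^sup>2 * (\<integral>x. f x \<bullet> f x \<partial>M) + b\<^sup>2 * (\<integral>x. g x \<bullet> g x \<partial>M) + 2 * a * b * (\<integral>x. f x \<bullet> g x \<partial>M)"
proof -
  have "(norm (a *\<^sub>R f x + b *\<^sub>R g x))\<^sup>2
      = a\<^sup>2 * (f x \<bullet> f x) + b\<^sup>2 * (g x \<bullet> g x) + 2 * a * b * (f x \<bullet> g x)" for x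
    unfolding power2_norm_eq_inner
    by (simp add: inner_add_left inner_add_right inner_commute[of "g x" "f x"] power2_eq_square algebra_simps)
  then show ?thesis
    using square_integrable_inner[OF assms(1) assms(1)] square_integrable_inner[OF assms(2) assms(2)]
      square_integrable_inner[OF assms] by simp
qed

text \<open>The squared norm of s f + t g is a nonnegative quadratic form in s and t. Its value at
  (B, - P) is B times A B - P P; if B = 0 it is affine in t at s = 1, which forces P = 0.\<close>

lemma Cauchy_Schwarz_integral:
  assumes f: "square_integrable M f" and g: "square_integrable M g"
  shows "(\<integral>x. f x \<bullet> g x \<partial>M)\<^sup>2 \<le> (\<integral>x. f x \<bullet> f x \<partial>M) * (\<integral>x. g x \<bullet> g x \<partial>M)"
proof -
  define A B P where "A = (\<integral>x. f x \<bullet> f x \<partial>M)" "B = (\<integral>x. g x \<bullet> g x \<partial>M)" "P = (\<integral>x. f x \<bullet> g x \<partial>M)"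
  have q: "0 \<le> s\<^sup>2 * A + t\<^sup>2 * B + 2 * s * t * P" for s t
    using integral_norm_combination[OF f g, of s t] Bochner_Integration.integral_nonneg[of M "\<lambda>x. (norm (s *\<^sub>R f x + t *\<^sub>R g x))\<^sup>2"]
    by (simp add: A_B_P_def)
  have "0 \<le> B" unfolding A_B_P_def by (intro Bochner_Integration.integral_nonneg) simp
  show ?thesis
  proof (cases "B = 0")
    case False
    have "0 \<le> B * (A * B - P\<^sup>2)" using q[of B "- P"] by (simp add: power2_eq_square algebra_simps)
    then have "P\<^sup>2 \<le> A * B" using False \<open>0 \<le> B\<close> by (simp add: zero_le_mult_iff)
    then show ?thesis by (simp add: A_B_P_def)
  next
    case True
    have "P = 0"
    proof (rule ccontr)
      assume "P \<noteq> 0"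
      then have "2 * 1 * (- (A + 1) / (2 * P)) * P = - (A + 1)" by simp
      then have "0 \<le> A - (A + 1)" using q[of 1 "- (A + 1) / (2 * P)"] unfolding True by simp
      then show False by simp
    qed
    then show ?thesis using True by (simp add: A_B_P_def)
  qed
qed

section \<open>Optimality and uniqueness of gradient maps\<close>

text \<open>The difference quotients of \<psi> along the segment from \<open>x\<close> to
  \<open>z\<close> are at most \<open>\<psi> z - \<psi> x\<close>, and from the right they tend to
  the directional derivative.\<close>

lemma convex_on_GDERIV_le:
  fixes \<psi> :: "'a::euclidean_space \<Rightarrow> real"
  assumes "convex_on C \<psi>" "x \<in> C" "z \<in> C" "GDERIV \<psi> x :> s"
  shows "\<psi> x + s \<bullet> (z - x) \<le> \<psi> z"
proof -
  define g where "g t = \<psi> (x + t *\<^sub>R (z - x))" for t :: real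
  have "(\<psi> has_derivative (\<lambda>h. h \<bullet> s)) (at (x + 0 *\<^sub>R (z - x)))"
    using assms(4) by (simp add: gderiv_def)
  moreover have "((\<lambda>t. x + t *\<^sub>R (z - x)) has_derivative (\<lambda>h. h *\<^sub>R (z - x))) (at (0::real))"
    by (auto intro!: derivative_eq_intros)
  ultimately have "((\<lambda>t. \<psi> (x + t *\<^sub>R (z - x))) has_derivative (\<lambda>h. (h *\<^sub>R (z - x)) \<bullet> s)) (at 0)"
    by (rule has_derivative_compose[rotated])
  moreover have "(\<lambda>h. (h *\<^sub>R (z - x)) \<bullet> s) = (*) ((z - x) \<bullet> s)" by (auto simp: fun_eq_iff)
  ultimately have "(g has_field_derivative ((z - x) \<bullet> s)) (at 0)"
    unfolding g_def[abs_def] has_field_derivative_def by simp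
  then have "((\<lambda>h. (g h - g 0) / h) \<longlongrightarrow> (z - x) \<bullet> s) (at 0)"
    by (simp add: DERIV_def)
  then have lim: "((\<lambda>h. (g h - g 0) / h) \<longlongrightarrow> (z - x) \<bullet> s) (at_right 0)"
    by (rule tendsto_mono[rotated]) (simp add: at_le)
  have ev: "eventually (\<lambda>h. (g h - g 0) / h \<le> \<psi> z - \<psi> x) (at_right 0)"
  proof -
    have "eventually (\<lambda>h::real. h \<in> {0<..<1}) (at_right 0)" by (rule eventually_at_right_real) simp
    then show ?thesis
    proof eventually_elim
      case (elim h)
      then have h: "0 < h" "h < 1" by auto
      have "g h = \<psi> ((1 - h) *\<^sub>R x + h *\<^sub>R z)" by (simp add: g_def algebra_simps)
      also have "\<dots> \<le> (1 - h) * \<psi> x + h * \<psi> z"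
        using assms(1-3) h by (intro convex_onD) auto
      finally have "g h - g 0 \<le> h * (\<psi> z - \<psi> x)" by (simp add: g_def algebra_simps)
      then show ?case using h by (simp add: pos_divide_le_eq mult.commute)
    qed
  qed
  have "(z - x) \<bullet> s \<le> \<psi> z - \<psi> x"
    by (rule tendsto_upperbound[OF lim ev]) simp
  then show ?thesis by (simp add: inner_commute)
qed

context ac_prob
begin

lemma square_integrable_id: "square_integrable F (\<lambda>x. x)"
  using square_integrable by (simp add: square_integrable_def)

lemma square_integrable_if_distr:
  assumes "f \<in> borel_measurable M" "distr M borel f = F"
  shows "square_integrable M f"
  using square_integrable_id square_integrable_distr[OF assms(1)] assms(2) by simp

lemma optimal_map_measurable: "is_optimal_map F G T \<Longrightarrow> T \<in> borel_measurable borel"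
  and optimal_map_distr: "is_optimal_map F G T \<Longrightarrow> distr F borel T = G"
  by (simp_all add: is_optimal_map_def)

lemma optimal_map_square_integrable:
  assumes "is_optimal_map F G T" "integrable G (\<lambda>x. (norm x)\<^sup>2)"
  shows "integrable F (\<lambda>x. (norm (T x))\<^sup>2)"
  using assms by (auto simp: is_optimal_map_def integrable_distr_eq)

text \<open>Monotonicity is the part of the gradient structure that gives interpolations with a
  positive share of the identity a Lipschitz inverse, hence a density.\<close>

lemma optimal_map_monotone:
  assumes "is_optimal_map F G T"
  shows "\<exists>A. (AE x in F. x \<in> A) \<and> (\<forall>x\<in>A. \<forall>y\<in>A. 0 \<le> (T x - T y) \<bullet> (x - y))"
proof -
  obtain C \<psi> where C: "convex_on C \<psi>" "AE v in F. v \<in> C \<and> GDERIV \<psi> v :> T v"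
    using assms by (auto simp: is_optimal_map_def)
  show ?thesis
  proof (intro exI[of _ "{v. v \<in> C \<and> GDERIV \<psi> v :> T v}"] conjI ballI)
    show "AE x in F. x \<in> {v. v \<in> C \<and> GDERIV \<psi> v :> T v}" using C(2) by simp
    fix x y assume "x \<in> {v. v \<in> C \<and> GDERIV \<psi> v :> T v}" "y \<in> {v. v \<in> C \<and> GDERIV \<psi> v :> T v}"
    then show "0 \<le> (T x - T y) \<bullet> (x - y)"
      using convex_on_GDERIV_le[OF C(1), of x y "T x"] convex_on_GDERIV_le[OF C(1), of y x "T y"]
      by (simp add: inner_diff_left inner_diff_right)
  qed
qed

text \<open>\<open>\<psi>\<close> and \<open>\<phi>\<close> are the Kantorovich potentials: \<open>\<phi>\<close> is the convex conjugate of \<open>\<psi>\<close>.\<close>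

lemma optimal_map_potentials:
  assumes opt: "is_optimal_map F G T" and G2: "integrable G (\<lambda>x. (norm x)\<^sup>2)"
  obtains \<psi> \<phi> :: "'a \<Rightarrow> real" and C Y :: "'a set" where
    "integrable F \<psi>" "integrable G \<phi>" "AE x in F. x \<in> C" "AE y in G. y \<in> Y"
    "\<And>x y. x \<in> C \<Longrightarrow> y \<in> Y \<Longrightarrow> x \<bullet> y \<le> \<psi> x + \<phi> y"
    "AE x in F. \<forall>y\<in>Y. x \<bullet> y = \<psi> x + \<phi> y \<longrightarrow> y = T x"
    "AE x in F. x \<bullet> T x = \<psi> x + \<phi> (T x)"
proof -
  obtain C \<psi>0 where C: "open C" "convex C" "convex_on C \<psi>0"
      and good: "AE v in F. v \<in> C \<and> GDERIV \<psi>0 v :> T v"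
    using opt by (auto simp: is_optimal_map_def)
  note [measurable] = optimal_map_measurable[OF opt]
  have G: "G = distr F borel T" using optimal_map_distr[OF opt] by simp
  have [measurable]: "C \<in> sets borel" using C(1) by simp
  have cont: "continuous_on C \<psi>0" using convex_on_continuous[OF C(1,3)] .
  define \<psi> where "\<psi> x = indicator C x *\<^sub>R \<psi>0 x" for x
  have [measurable]: "\<psi> \<in> borel_measurable borel"
    unfolding \<psi>_def[abs_def] by (rule borel_measurable_continuous_on_indicator[OF _ cont]) simp
  have \<psi>C: "\<psi> x = \<psi>0 x" if "x \<in> C" for x using that by (simp add: \<psi>_def)
  obtain D :: "'a set" where D: "countable D" "\<And>X. open X \<Longrightarrow> X \<noteq> {} \<Longrightarrow> \<exists>d\<in>D. d \<in> X"
    using countable_dense_setE by blast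
  have "\<exists>x. x \<in> C \<and> GDERIV \<psi>0 x :> T x"
  proof (rule ccontr)
    assume none: "\<not> ?thesis"
    have "AE x in F. False" using good by eventually_elim (use none in blast)
    then show False by simp
  qed
  then obtain x0 where x0: "x0 \<in> C" "GDERIV \<psi>0 x0 :> T x0" by blast
  obtain d0 where d0: "d0 \<in> D \<inter> C" using D(2)[OF C(1)] x0(1) by blast
  \<comment> \<open>The conjugate of \<open>\<psi>0\<close> as a supremum over a countable dense
    set, which makes it Borel; continuity of \<open>\<psi>0\<close> on the open set \<open>C\<close>
    recovers the Young inequality at every point of \<open>C\<close>.\<close>
  define E where "E y = (SUP d\<in>D \<inter> C. ereal (d \<bullet> y - \<psi>0 d))" for y
  have [measurable]: "E \<in> borel_measurable borel"
    unfolding E_def[abs_def] using D(1) by (intro borel_measurable_SUP) auto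
  define Y where "Y = {y. E y < \<infinity>}"
  define \<phi> where "\<phi> y = real_of_ereal (E y)" for y
  have [measurable]: "\<phi> \<in> borel_measurable borel" "Y \<in> sets borel"
    unfolding \<phi>_def[abs_def] Y_def by measurable
  have E\<phi>: "E y = ereal (\<phi> y)" if "y \<in> Y" for y
  proof -
    have "ereal (d0 \<bullet> y - \<psi>0 d0) \<le> E y" unfolding E_def by (rule SUP_upper[OF d0])
    then have "- \<infinity> < E y" by (rule less_le_trans[rotated]) simp
    then show ?thesis using that by (cases "E y") (auto simp: Y_def \<phi>_def)
  qed
  have le: "x \<bullet> y \<le> \<psi>0 x + \<phi> y" if x: "x \<in> C" and y: "y \<in> Y" for x y
  proof (rule ccontr)
    assume "\<not> ?thesis"
    then have "x \<in> C \<inter> (\<lambda>x. x \<bullet> y - \<psi>0 x) -` {\<phi> y<..}" using x by auto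
    moreover have "open (C \<inter> (\<lambda>x. x \<bullet> y - \<psi>0 x) -` {\<phi> y<..})"
      using C(1) cont by (intro continuous_open_preimage continuous_intros) auto
    ultimately obtain d where d: "d \<in> D" "d \<in> C" "\<phi> y < d \<bullet> y - \<psi>0 d" using D(2) by blast
    have "ereal (d \<bullet> y - \<psi>0 d) \<le> E y" unfolding E_def by (rule SUP_upper) (use d in simp)
    with d(3) E\<phi>[OF y] show False by simp
  qed
  have TY: "T x \<in> Y \<and> x \<bullet> T x = \<psi>0 x + \<phi> (T x)" if x: "x \<in> C" "GDERIV \<psi>0 x :> T x" for x
  proof -
    have "E (T x) \<le> ereal (x \<bullet> T x - \<psi>0 x)"
      unfolding E_def
    proof (rule SUP_least)
      fix d assume "d \<in> D \<inter> C"
      then show "ereal (d \<bullet> T x - \<psi>0 d) \<le> ereal (x \<bullet> T x - \<psi>0 x)"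
        using convex_on_GDERIV_le[OF C(3) x(1) _ x(2), of d] by (simp add: inner_diff_right inner_commute)
    qed
    moreover from this have y: "T x \<in> Y" by (auto simp: Y_def intro: le_less_trans)
    ultimately have "\<phi> (T x) \<le> x \<bullet> T x - \<psi>0 x" using E\<phi>[OF y] by simp
    with le[OF x(1) y] y show ?thesis by simp
  qed
  have AE_pot: "AE x in F. x \<in> C \<and> T x \<in> Y \<and> x \<bullet> T x = \<psi> x + \<phi> (T x)"
    using good by eventually_elim (use TY \<psi>C in auto)
  have sqT: "square_integrable F T"
    using optimal_map_square_integrable[OF opt G2] by (simp add: square_integrable_def)
  note int = square_integrable_inner[OF _ sqT, OF square_integrable_id]
    square_integrable_inner[OF _ sqT, OF square_integrable_const]
    square_integrable_inner[OF square_integrable_id square_integrable_const]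
  let ?y0 = "T x0"
  have y0: "?y0 \<in> Y" using TY[OF x0] by simp
  \<comment> \<open>The Young inequality with the fixed slope \<open>T x0\<close> bounds \<psi> from
    below; with the fixed point \<open>x0\<close> it bounds \<open>\<phi> (T x)\<close> from below,
    hence \<psi> from above on the graph of \<open>T\<close>. Both bounds are integrable by the
    second moments.\<close>
  have int\<psi>: "integrable F \<psi>"
  proof (rule Bochner_Integration.integrable_bound)
    show "integrable F (\<lambda>x. \<bar>x \<bullet> ?y0 - \<phi> ?y0\<bar> + \<bar>x \<bullet> T x - (x0 \<bullet> T x - \<psi>0 x0)\<bar>)"
      by (intro int Bochner_Integration.integrable_add integrable_abs Bochner_Integration.integrable_diff integrable_const)
    show "AE x in F. norm (\<psi> x) \<le> norm (\<bar>x \<bullet> ?y0 - \<phi> ?y0\<bar> + \<bar>x \<bullet> T x - (x0 \<bullet> T x - \<psi>0 x0)\<bar>)"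
      using AE_pot
    proof eventually_elim
      case (elim x)
      then have "x \<bullet> ?y0 - \<phi> ?y0 \<le> \<psi> x" "\<psi> x \<le> x \<bullet> T x - (x0 \<bullet> T x - \<psi>0 x0)"
        using le[of x ?y0] le[OF x0(1), of "T x"] y0 \<psi>C[of x] by auto
      then show ?case by simp
    qed
  qed simp
  have "integrable F (\<lambda>x. \<phi> (T x))"
  proof (rule integrable_cong_AE_imp[OF Bochner_Integration.integrable_diff[OF int(1) int\<psi>]])
    show "AE x in F. x \<bullet> T x - \<psi> x = \<phi> (T x)" using AE_pot by eventually_elim simp
  qed simp
  then have int\<phi>: "integrable G \<phi>" unfolding G by (simp add: integrable_distr_eq)
  show thesis
  proof (rule that[of \<psi> \<phi> C Y])
    show "integrable F \<psi>" "integrable G \<phi>" by fact+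
    show "AE x in F. x \<in> C" using good by eventually_elim simp
    show "AE y in G. y \<in> Y" unfolding G using AE_pot by (simp add: AE_distr_iff)
    show "x \<bullet> y \<le> \<psi> x + \<phi> y" if "x \<in> C" "y \<in> Y" for x y using le[OF that] \<psi>C[OF that(1)] by simp
    show "AE x in F. x \<bullet> T x = \<psi> x + \<phi> (T x)" using AE_pot by eventually_elim simp
    show "AE x in F. \<forall>y\<in>Y. x \<bullet> y = \<psi> x + \<phi> y \<longrightarrow> y = T x"
      using good
    proof eventually_elim
      case (elim x)
      then have x: "x \<in> C" "GDERIV \<psi>0 x :> T x" by auto
      show ?case
      proof (intro ballI impI)
        fix y assume y: "y \<in> Y" "x \<bullet> y = \<psi> x + \<phi> y"
        show "y = T x"
        proof (rule subgradient_unique[OF C(1) x])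
          fix z assume "z \<in> C"
          then show "\<psi>0 x + y \<bullet> (z - x) \<le> \<psi>0 z"
            using le[of z y] y \<psi>C[OF x(1)] by (simp add: inner_diff_right inner_commute)
        qed
      qed
    qed
  qed
qed

text \<open>The integrated Young inequality has a right side that depends on the marginals only and
  is attained on the graph of \<open>T\<close>. Equality of the integrals forces equality almost
  everywhere, and then \<open>g w\<close> is a subgradient at \<open>f w\<close>. Couplings are
  pairs of maps on an arbitrary \<open>M\<close> because later they arise on a third law.\<close>

theorem optimal_map_maximal:
  assumes opt: "is_optimal_map F G T" and G2: "integrable G (\<lambda>x. (norm x)\<^sup>2)"
    and fg[measurable]: "f \<in> borel_measurable M" "g \<in> borel_measurable M"
    and f: "distr M borel f = F" and g: "distr M borel g = G"
  shows "(\<integral>w. f w \<bullet> g w \<partial>M) \<le> (\<integral>x. x \<bullet> T x \<partial>F)"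
    and "(\<integral>w. f w \<bullet> g w \<partial>M) = (\<integral>x. x \<bullet> T x \<partial>F) \<Longrightarrow> AE w in M. g w = T (f w)"
proof -
  obtain \<psi> \<phi> C Y where P: "integrable F \<psi>" "integrable G \<phi>" "AE x in F. x \<in> C" "AE y in G. y \<in> Y"
    "\<And>x y. x \<in> C \<Longrightarrow> y \<in> Y \<Longrightarrow> x \<bullet> y \<le> \<psi> x + \<phi> y"
    "AE x in F. \<forall>y\<in>Y. x \<bullet> y = \<psi> x + \<phi> y \<longrightarrow> y = T x"
    "AE x in F. x \<bullet> T x = \<psi> x + \<phi> (T x)"
    using optimal_map_potentials[OF opt G2] by blast
  have [measurable]: "T \<in> borel_measurable borel" by (rule optimal_map_measurable[OF opt])
  have m[measurable]: "\<psi> \<in> borel_measurable borel" "\<phi> \<in> borel_measurable borel"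
    using P(1,2) borel_measurable_integrable[OF P(1)] borel_measurable_integrable[OF P(2)]
    by (simp_all add: g[symmetric])
  have AEf: "AE w in M. Q (f w)" if "AE x in F. Q x" for Q
    using that unfolding f[symmetric] by (rule AE_distrD[rotated]) simp
  have AEg: "AE w in M. Q (g w)" if "AE x in G. Q x" for Q
    using that unfolding g[symmetric] by (rule AE_distrD[rotated]) simp
  have i\<psi>: "integrable M (\<lambda>w. \<psi> (f w))" "(\<integral>w. \<psi> (f w) \<partial>M) = (\<integral>x. \<psi> x \<partial>F)"
    using P(1) by (simp_all add: f[symmetric] integrable_distr_eq integral_distr)
  have i\<phi>: "integrable M (\<lambda>w. \<phi> (g w))" "(\<integral>w. \<phi> (g w) \<partial>M) = (\<integral>x. \<phi> x \<partial>G)"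
    using P(2) by (simp_all add: g[symmetric] integrable_distr_eq integral_distr)
  have "square_integrable M g"
    using G2 by (simp add: g[symmetric] integrable_distr_eq square_integrable_def)
  then have ifg: "integrable M (\<lambda>w. f w \<bullet> g w)"
    by (intro square_integrable_inner square_integrable_if_distr[OF _ f]) simp_all
  have le: "AE w in M. f w \<bullet> g w \<le> \<psi> (f w) + \<phi> (g w)"
    using AEf[OF P(3)] AEg[OF P(4)] by eventually_elim (rule P(5))
  have "integrable F (\<lambda>x. \<phi> (T x))"
    using P(2) optimal_map_distr[OF opt] by (auto simp: integrable_distr_eq)
  moreover have "(\<integral>x. \<phi> (T x) \<partial>F) = (\<integral>y. \<phi> y \<partial>G)"
    by (simp add: optimal_map_distr[OF opt, symmetric] integral_distr)
  moreover have "(\<integral>x. x \<bullet> T x \<partial>F) = (\<integral>x. \<psi> x + \<phi> (T x) \<partial>F)"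
    by (rule integral_cong_AE) (use P(7) in auto)
  ultimately have val: "(\<integral>x. x \<bullet> T x \<partial>F) = (\<integral>w. \<psi> (f w) + \<phi> (g w) \<partial>M)"
    using P(1) i\<psi> i\<phi> by simp
  show "(\<integral>w. f w \<bullet> g w \<partial>M) \<le> (\<integral>x. x \<bullet> T x \<partial>F)"
    unfolding val by (intro integral_mono_AE ifg le Bochner_Integration.integrable_add i\<psi> i\<phi>)
  assume "(\<integral>w. f w \<bullet> g w \<partial>M) = (\<integral>x. x \<bullet> T x \<partial>F)"
  then have "(\<integral>w. \<psi> (f w) + \<phi> (g w) - f w \<bullet> g w \<partial>M) = 0"
    using ifg i\<psi>(1) i\<phi>(1) val by simp
  then have "AE w in M. \<psi> (f w) + \<phi> (g w) - f w \<bullet> g w = 0"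
    using le ifg i\<psi>(1) i\<phi>(1) by (subst (asm) integral_nonneg_eq_0_iff_AE) auto
  then show "AE w in M. g w = T (f w)"
    using AEf[OF P(6)] AEg[OF P(4)] by eventually_elim auto
qed

text \<open>On \<open>A\<close> the map \<open>S\<close> has an inverse with Lipschitz constant 1 /
  c, and Lipschitz maps preserve negligible sets; so preimages of null sets are F-null.\<close>

lemma ac_prob_distr:
  fixes S :: "'a \<Rightarrow> 'a"
  assumes [measurable]: "S \<in> borel_measurable borel" and c: "0 < c" and A: "AE x in F. x \<in> A"
    and expand: "\<And>x y. x \<in> A \<Longrightarrow> y \<in> A \<Longrightarrow> c * norm (x - y) \<le> norm (S x - S y)"
    and S2: "integrable F (\<lambda>x. (norm (S x))\<^sup>2)"
  shows "ac_prob (distr F borel S)"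
proof -
  interpret S: prob_space "distr F borel S" by (rule prob_space_distr) simp
  show ?thesis
  proof
    show "absolutely_continuous lborel (distr F borel S)"
      unfolding absolutely_continuous_def
    proof
      fix N :: "'a set" assume N: "N \<in> null_sets lborel"
      then have [measurable]: "N \<in> sets borel" by auto
      have "negligible N"
        using N by (simp add: negligible_iff_null_sets null_sets_completionI)
      define R where "R = inv_into A S"
      have "inj_on S A"
      proof (rule inj_onI)
        fix x y assume "x \<in> A" "y \<in> A" "S x = S y"
        then have "c * norm (x - y) \<le> 0" using expand[of x y] by simp
        then show "x = y" using c by (simp add: mult_le_0_iff)
      qed
      then have RS: "R (S x) = x" if "x \<in> A" for x using that by (simp add: R_def)
      have "negligible (R ` (N \<inter> S ` A))"
      proof (rule negligible_locally_Lipschitz_image)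
        show "negligible (N \<inter> S ` A)" using \<open>negligible N\<close> by (rule negligible_subset) simp
        fix w assume "w \<in> N \<inter> S ` A"
        then obtain x where x: "x \<in> A" "w = S x" by auto
        have "norm (R v - R w) \<le> (1 / c) * norm (v - w)" if "v \<in> N \<inter> S ` A" for v
          using that x expand c by (auto simp: RS field_simps)
        then show "\<exists>T B. open T \<and> w \<in> T \<and> (\<forall>v\<in>N \<inter> S ` A \<inter> T. norm (R v - R w) \<le> B * norm (v - w))"
          by (intro exI[of _ UNIV] exI[of _ "1 / c"]) auto
      qed simp
      then have "AE x in F. x \<notin> R ` (N \<inter> S ` A)" by (rule AE_not_in_negligible)
      then have "AE x in F. x \<notin> S -` N"
        using A
      proof eventually_elim
        case (elim x)
        then show ?case using RS[of x] by (metis IntI image_eqI vimageE)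
      qed
      then have "emeasure F (S -` N) = 0"
        using measurable_sets[of S borel borel N] by (subst (asm) AE_iff_measurable[of "S -` N"]) auto
      then show "N \<in> null_sets (distr F borel S)"
        by (auto simp: null_sets_def emeasure_distr)
    qed
  qed (use S2 in \<open>simp_all add: integrable_distr_eq\<close>)
qed

end

text \<open>Radon-Nikodym supplies the density in the converse direction; it is finite almost
  everywhere because its integral is 1, so a real function can replace it.\<close>

lemma densities_iff_ac_prob: "F \<in> densities \<longleftrightarrow> ac_prob F"
proof
  assume "F \<in> densities"
  then obtain f where F: "F = density lborel (\<lambda>v. ennreal (f v))" and f: "\<And>v. 0 \<le> f v"
      "has_bochner_integral lborel f 1" "integrable lborel (\<lambda>v. (norm v)\<^sup>2 * f v)"
    by (auto simp: densities_def)
  have [measurable]: "f \<in> borel_measurable borel"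
    using f(2) borel_measurable_integrable[of lborel f] by (simp add: has_bochner_integral_iff)
  have "(\<integral>\<^sup>+ v. ennreal (f v) \<partial>lborel) = ennreal (\<integral>v. f v \<partial>lborel)"
    using f by (intro nn_integral_eq_integral) (auto simp: has_bochner_integral_iff)
  also have "\<dots> = 1" using f(2) by (simp add: has_bochner_integral_iff)
  finally have "(\<integral>\<^sup>+ v. ennreal (f v) \<partial>lborel) = 1" .
  then interpret prob_space F by (intro prob_spaceI) (simp add: F emeasure_density)
  show "ac_prob F"
  proof
    show "sets F = sets borel" by (simp add: F)
    show "absolutely_continuous lborel F" unfolding F by (rule absolutely_continuousI_density) measurable
    show "integrable F (\<lambda>x. (norm x)\<^sup>2)"
      using f(1,3) unfolding F by (subst integrable_density) (auto simp: mult.commute)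
  qed
next
  assume "ac_prob F"
  then interpret ac_prob F .
  obtain h where h[measurable]: "h \<in> borel_measurable lborel" and F: "density lborel h = F"
    using sigma_finite_measure.Radon_Nikodym[OF sigma_finite_lborel ac] by auto
  have "(\<integral>\<^sup>+ v. h v \<partial>lborel) = emeasure F UNIV" by (simp add: F[symmetric] emeasure_density)
  also have "\<dots> = 1" using emeasure_space_1 by simp
  finally have h1: "(\<integral>\<^sup>+ v. h v \<partial>lborel) = 1" .
  then have "AE v in lborel. h v \<noteq> \<infinity>" by (intro nn_integral_noteq_infinite) auto
  define f where "f v = enn2real (h v)" for v
  have [measurable]: "f \<in> borel_measurable lborel" unfolding f_def[abs_def] by measurable
  have hf: "AE v in lborel. h v = ennreal (f v)"
    using \<open>AE v in lborel. h v \<noteq> \<infinity>\<close> by eventually_elim (simp add: f_def less_top)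
  have Ff: "F = density lborel (\<lambda>v. ennreal (f v))"
    unfolding F[symmetric] by (rule density_cong[OF _ _ hf]) auto
  have "(\<integral>\<^sup>+ v. ennreal (f v) \<partial>lborel) = 1" using h1 nn_integral_cong_AE[OF hf] by simp
  then have "has_bochner_integral lborel f 1"
    by (intro has_bochner_integral_nn_integral) (auto simp: f_def)
  moreover have "integrable lborel (\<lambda>v. f v *\<^sub>R (norm v)\<^sup>2)"
    using square_integrable unfolding Ff by (subst (asm) integrable_density) (auto simp: f_def)
  ultimately show "F \<in> densities"
    unfolding densities_def using Ff by (auto simp: f_def mult.commute intro!: exI[of _ f])
qed

section \<open>The largest correlation of two laws\<close>

definition variance_about :: "'a::euclidean_space \<Rightarrow> 'a measure \<Rightarrow> real" where
  "variance_about u F = (\<integral>x. (norm (x - u))\<^sup>2 \<partial>F)"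

text \<open>The largest value of \<open>\<integral> (x - u) \<bullet> (y - u) d\<gamma>\<close> over the couplings \<open>\<gamma>\<close> of \<open>F\<close> and \<open>G\<close>.\<close>

definition correlation :: "'a::euclidean_space \<Rightarrow> 'a measure \<Rightarrow> 'a measure \<Rightarrow> real" where
  "correlation u F G = (\<integral>x. (x - u) \<bullet> (optimal_map F G x - u) \<partial>F)"

context ac_prob
begin

lemma is_optimal_map_optimal_map: "ac_prob G \<Longrightarrow> is_optimal_map F G (optimal_map F G)"
  unfolding optimal_map_def
  by (rule someI_ex[OF exists_optimal_map])
     (auto simp: ac_prob_def ac_prob_axioms_def)

lemmas optimal_map_meas = optimal_map_measurable[OF is_optimal_map_optimal_map]

lemmas distr_optimal_map = optimal_map_distr[OF is_optimal_map_optimal_map]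

lemma square_integrable_optimal_map: "ac_prob G \<Longrightarrow> square_integrable F (optimal_map F G)"
  by (rule ac_prob.square_integrable_if_distr[of G]) (simp_all add: optimal_map_meas distr_optimal_map)

lemma prob_space_of_distr:
  assumes "f \<in> borel_measurable M" "distr M borel f = F"
  shows "prob_space M"
  using prob_space_axioms assms by (metis prob_space_distrD)

lemma variance_about_distr:
  assumes "f \<in> borel_measurable M" "distr M borel f = F"
  shows "variance_about u F = (\<integral>x. (norm (f x - u))\<^sup>2 \<partial>M)"
  unfolding variance_about_def assms(2)[symmetric] by (subst integral_distr) (use assms(1) in auto)

text \<open>Centring at \<open>u\<close> alters the mean inner product by terms that see the
  marginals only, so maximality carries over to the centred product.\<close>

lemma integral_centred_inner:
  assumes G: "ac_prob G"
    and meas: "f \<in> borel_measurable M" "g \<in> borel_measurable M"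
    and f: "distr M borel f = F" and g: "distr M borel g = G"
  shows "(\<integral>w. (f w - u) \<bullet> (g w - u) \<partial>M) = (\<integral>w. f w \<bullet> g w \<partial>M) - (\<integral>x. x \<bullet> u \<partial>F) - (\<integral>y. u \<bullet> y \<partial>G) + u \<bullet> u"
proof -
  interpret G: ac_prob G by (rule G)
  interpret M: prob_space M by (rule prob_space_of_distr[OF meas(1) f])
  note f2 = square_integrable_if_distr[OF meas(1) f] and g2 = G.square_integrable_if_distr[OF meas(2) g]
  note c2 = M.square_integrable_const[of u]
  have "(\<integral>x. x \<bullet> u \<partial>F) = (\<integral>w. f w \<bullet> u \<partial>M)" "(\<integral>y. u \<bullet> y \<partial>G) = (\<integral>w. u \<bullet> g w \<partial>M)"
    unfolding f[symmetric] g[symmetric] by (subst integral_distr; use meas in simp)+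
  moreover have "(f w - u) \<bullet> (g w - u) = f w \<bullet> g w - f w \<bullet> u - u \<bullet> g w + u \<bullet> u" for w
    by (simp add: inner_diff_left inner_diff_right)
  ultimately show ?thesis
    using square_integrable_inner[OF f2 g2] square_integrable_inner[OF f2 c2] square_integrable_inner[OF c2 g2]
    by (simp add: M.prob_space)
qed

lemma correlation_maximal:
  assumes G: "ac_prob G"
    and meas: "f \<in> borel_measurable M" "g \<in> borel_measurable M"
    and f: "distr M borel f = F" and g: "distr M borel g = G"
  shows "(\<integral>w. (f w - u) \<bullet> (g w - u) \<partial>M) \<le> correlation u F G"
    and "(\<integral>w. (f w - u) \<bullet> (g w - u) \<partial>M) = correlation u F G \<Longrightarrow> AE w in M. g w = optimal_map F G (f w)"
proof -
  interpret G: ac_prob G by (rule G)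
  let ?T = "optimal_map F G"
  have "correlation u F G = (\<integral>x. x \<bullet> ?T x \<partial>F) - (\<integral>x. x \<bullet> u \<partial>F) - (\<integral>y. u \<bullet> y \<partial>G) + u \<bullet> u"
    unfolding correlation_def
    by (rule integral_centred_inner) (simp_all add: G optimal_map_meas[OF G] distr_optimal_map[OF G] distr_id2)
  moreover note integral_centred_inner[OF G meas f g, of u]
  ultimately show "(\<integral>w. (f w - u) \<bullet> (g w - u) \<partial>M) \<le> correlation u F G"
    and "(\<integral>w. (f w - u) \<bullet> (g w - u) \<partial>M) = correlation u F G \<Longrightarrow> AE w in M. g w = ?T (f w)"
    using optimal_map_maximal[OF is_optimal_map_optimal_map[OF G] G.square_integrable meas f g] by auto
qed

text \<open>An optimal map from \<open>A\<close> to \<open>B\<close>, with its two coordinates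
  exchanged, competes in the problem from \<open>B\<close> to \<open>A\<close>.\<close>

lemma correlation_commute:
  assumes G: "ac_prob G"
  shows "correlation u F G = correlation u G F"
proof -
  have "correlation u A B \<le> correlation u B A" if A: "ac_prob A" and B: "ac_prob B" for A B
  proof -
    interpret A: ac_prob A by (rule A)
    interpret B: ac_prob B by (rule B)
    have "(\<integral>x. (optimal_map A B x - u) \<bullet> (x - u) \<partial>A) \<le> correlation u B A"
      by (rule B.correlation_maximal(1)[OF A])
         (simp_all add: A.optimal_map_meas[OF B] A.distr_optimal_map[OF B] distr_id2)
    then show ?thesis by (simp add: correlation_def inner_commute)
  qed
  from this[OF ac_prob_axioms G] this[OF G ac_prob_axioms] show ?thesis by simp
qed

text \<open>Polarization: for fixed marginals, minimizing the quadratic cost is the same as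
  maximizing the correlation.\<close>

lemma integral_cost_eq:
  assumes G: "ac_prob G"
    and meas: "f \<in> borel_measurable M" "g \<in> borel_measurable M"
    and f: "distr M borel f = F" and g: "distr M borel g = G"
  shows "(\<integral>w. (norm (f w - g w))\<^sup>2 / 2 \<partial>M)
    = (variance_about u F + variance_about u G) / 2 - (\<integral>w. (f w - u) \<bullet> (g w - u) \<partial>M)"
proof -
  interpret G: ac_prob G by (rule G)
  let ?c = "(variance_about u F + variance_about u G) / 2"
  interpret M: prob_space M by (rule prob_space_of_distr[OF meas(1) f])
  note c2 = M.square_integrable_const[of u]
  note f2 = square_integrable_diff[OF square_integrable_if_distr[OF meas(1) f] c2]
    and g2 = square_integrable_diff[OF G.square_integrable_if_distr[OF meas(2) g] c2]
  have "(\<integral>w. (norm (f w - g w))\<^sup>2 \<partial>M) = (\<integral>w. (norm (1 *\<^sub>R (f w - u) + (-1) *\<^sub>R (g w - u)))\<^sup>2 \<partial>M)"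
    by simp
  also have "\<dots> = 2 * ?c - 2 * (\<integral>w. (f w - u) \<bullet> (g w - u) \<partial>M)"
    unfolding integral_norm_combination[OF f2 g2]
    by (simp add: variance_about_distr[OF meas(1) f] G.variance_about_distr[OF meas(2) g] power2_norm_eq_inner)
  finally show ?thesis by simp
qed

lemma W2_eq:
  assumes G: "ac_prob G"
  shows "W2 F G = sqrt ((variance_about u F + variance_about u G) / 2 - correlation u F G)"
proof -
  interpret G: ac_prob G by (rule G)
  let ?T = "optimal_map F G" and ?c = "(variance_about u F + variance_about u G) / 2"
  have "(INF \<gamma>\<in>couplings F G. \<integral>p. (norm (fst p - snd p))\<^sup>2 / 2 \<partial>\<gamma>) = ?c - correlation u F G"
  proof (rule cInf_eq_minimum)
    let ?\<gamma> = "distr F (borel \<Otimes>\<^sub>M borel) (\<lambda>x. (x, ?T x))"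
    note [measurable] = optimal_map_meas[OF G]
    have "?\<gamma> \<in> couplings F G"
      by (simp add: couplings_def distr_distr o_def distr_id2 distr_optimal_map[OF G])
    moreover have "(\<integral>p. (norm (fst p - snd p))\<^sup>2 / 2 \<partial>?\<gamma>) = (\<integral>x. (norm (x - ?T x))\<^sup>2 / 2 \<partial>F)"
      by (subst integral_distr) auto
    moreover have "(\<integral>x. (norm (x - ?T x))\<^sup>2 / 2 \<partial>F) = ?c - correlation u F G"
      unfolding correlation_def
      by (rule integral_cost_eq[OF G]) (simp_all add: distr_id2 distr_optimal_map[OF G])
    ultimately show "?c - correlation u F G \<in> (\<lambda>\<gamma>. \<integral>p. (norm (fst p - snd p))\<^sup>2 / 2 \<partial>\<gamma>) ` couplings F G"
      by (metis (no_types, lifting) image_eqI)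
  next
    fix z assume "z \<in> (\<lambda>\<gamma>. \<integral>p. (norm (fst p - snd p))\<^sup>2 / 2 \<partial>\<gamma>) ` couplings F G"
    then obtain \<gamma> where \<gamma>: "sets \<gamma> = sets (borel \<Otimes>\<^sub>M borel)" "distr \<gamma> borel fst = F" "distr \<gamma> borel snd = G"
        and z: "z = (\<integral>p. (norm (fst p - snd p))\<^sup>2 / 2 \<partial>\<gamma>)"
      by (auto simp: couplings_def)
    have m: "fst \<in> borel_measurable \<gamma>" "snd \<in> borel_measurable \<gamma>"
      by (simp_all add: measurable_cong_sets[OF \<gamma>(1) refl])
    show "?c - correlation u F G \<le> z"
      unfolding z integral_cost_eq[OF G m \<gamma>(2,3), of u] using correlation_maximal(1)[OF G m \<gamma>(2,3)] by simp
  qed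
  then show ?thesis by (simp add: W2_def)
qed

end

section \<open>Spherical geometry of densities with fixed mean and variance\<close>

text \<open>The limit is the derivative of sin (c h) at h = 0. It turns the total length of many
  short chords into arc length.\<close>

lemma tendsto_mult_sin_divide:
  fixes f :: "nat \<Rightarrow> real"
  assumes "filterlim f at_top sequentially"
  shows "(\<lambda>n. f n * sin (c / f n)) \<longlonglongrightarrow> c"
proof -
  have "((\<lambda>h. sin (c * h)) has_field_derivative cos (c * 0) * c) (at 0)"
    by (auto intro!: derivative_eq_intros)
  then have "((\<lambda>h. sin (c * h) / h) \<longlongrightarrow> c) (at 0)" by (simp add: DERIV_def)
  moreover have "filterlim (\<lambda>n. inverse (f n)) (at 0) sequentially"
    using filterlim_compose[OF filterlim_inverse_at_right_top assms]
    by (rule filterlim_mono) (simp_all add: at_le)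
  ultimately have "(\<lambda>n. sin (c * inverse (f n)) / inverse (f n)) \<longlonglongrightarrow> c"
    by (rule filterlim_compose)
  then show ?thesis by (simp add: divide_inverse mult.commute)
qed

text \<open>The point of the unit circle at angle \<open>s * \<phi>\<close> is \<open>slerp_coeff \<phi> s\<close> times the point at angle \<open>0\<close>
  plus \<open>slerp_coeff \<phi> (1 - s)\<close> times the point at angle \<open>\<phi>\<close>.\<close>

definition slerp_coeff :: "real \<Rightarrow> real \<Rightarrow> real" where
  "slerp_coeff \<phi> s = (if \<phi> = 0 then 1 - s else sin ((1 - s) * \<phi>) / sin \<phi>)"

lemma sin_pos_le_pi_half: "0 \<le> \<phi> \<Longrightarrow> \<phi> \<le> pi / 2 \<Longrightarrow> \<phi> \<noteq> 0 \<Longrightarrow> 0 < sin \<phi>"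
  using pi_gt_zero by (intro sin_gt_zero) linarith+

lemma slerp_coeff_0[simp]: "0 \<le> \<phi> \<Longrightarrow> \<phi> \<le> pi / 2 \<Longrightarrow> slerp_coeff \<phi> 0 = 1"
  and slerp_coeff_1[simp]: "slerp_coeff \<phi> 1 = 0"
  using sin_pos_le_pi_half[of \<phi>] by (cases "\<phi> = 0"; simp add: slerp_coeff_def)+

lemma slerp_coeff_inner:
  assumes "0 \<le> \<phi>" "\<phi> \<le> pi / 2"
  shows "slerp_coeff \<phi> s * slerp_coeff \<phi> t + slerp_coeff \<phi> (1 - s) * slerp_coeff \<phi> (1 - t)
    + (slerp_coeff \<phi> s * slerp_coeff \<phi> (1 - t) + slerp_coeff \<phi> (1 - s) * slerp_coeff \<phi> t) * cos \<phi>
    = cos ((t - s) * \<phi>)"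
proof (cases "\<phi> = 0")
  case True
  then show ?thesis by (simp add: slerp_coeff_def algebra_simps)
next
  case False
  define x y S C where "x = s * \<phi>" "y = t * \<phi>" "S = sin \<phi>" "C = cos \<phi>"
  note defs = this
  have S: "S \<noteq> 0" using sin_pos_le_pi_half[OF assms False] by (simp add: defs)
  have SC: "C * C = 1 - S * S" using sin_squared_eq[of \<phi>] by (simp add: defs power2_eq_square)
  have c: "slerp_coeff \<phi> s = (S * cos x - C * sin x) / S" "slerp_coeff \<phi> t = (S * cos y - C * sin y) / S"
    using False by (simp_all add: slerp_coeff_def defs left_diff_distrib sin_diff)
  have c': "slerp_coeff \<phi> (1 - s) = sin x / S" "slerp_coeff \<phi> (1 - t) = sin y / S"
    using False by (simp_all add: slerp_coeff_def defs)
  have "(S * cos x - C * sin x) * (S * cos y - C * sin y) + sin x * sin y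
      + ((S * cos x - C * sin x) * sin y + sin x * (S * cos y - C * sin y)) * C
    = S * S * (cos x * cos y) + (1 - C * C) * (sin x * sin y)"
    by (simp add: algebra_simps)
  also have "\<dots> = S * S * cos (y - x)" by (simp add: SC cos_diff algebra_simps)
  finally have "((S * cos x - C * sin x) * (S * cos y - C * sin y) + sin x * sin y
      + ((S * cos x - C * sin x) * sin y + sin x * (S * cos y - C * sin y)) * C) / (S * S) = cos (y - x)"
    using S by simp
  moreover have "p / S * (q / S) + m / S * (n / S) + (p / S * (n / S) + m / S * (q / S)) * C
      = (p * q + m * n + (p * n + m * q) * C) / (S * S)" for p q m n
    using S by (simp add: field_simps)
  moreover have "y - x = (t - s) * \<phi>" by (simp add: defs(1,2) left_diff_distrib)
  ultimately show ?thesis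
    unfolding c c' defs(4)[symmetric] by simp
qed

text \<open>Sine is strictly increasing on the range of \<open>(1 - s) * \<phi>\<close> because
  \<phi> is at most a right angle.\<close>

lemma slerp_coeff_strict_antimono:
  assumes "0 \<le> \<phi>" "\<phi> \<le> pi / 2" "0 \<le> s" "s < t" "t \<le> 1"
  shows "slerp_coeff \<phi> t < slerp_coeff \<phi> s"
proof (cases "\<phi> = 0")
  case False
  then have "0 < \<phi>" using assms(1) by simp
  have "sin ((1 - t) * \<phi>) < sin ((1 - s) * \<phi>)"
  proof (rule sin_monotone_2pi)
    have "0 \<le> (1 - t) * \<phi>" using assms by simp
    then show "- (pi / 2) \<le> (1 - t) * \<phi>" using pi_gt_zero by linarith
    show "(1 - t) * \<phi> < (1 - s) * \<phi>" using assms \<open>0 < \<phi>\<close> by simp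
    have "(1 - s) * \<phi> \<le> 1 * \<phi>" using assms by (intro mult_right_mono) auto
    then show "(1 - s) * \<phi> \<le> pi / 2" using assms by simp
  qed
  moreover have "0 < sin \<phi>" using sin_pos_le_pi_half[OF assms(1,2) False] .
  ultimately show ?thesis using False by (simp add: slerp_coeff_def divide_strict_right_mono)
qed (use assms in \<open>simp add: slerp_coeff_def\<close>)

lemma slerp_coeff_nonneg: "0 \<le> \<phi> \<Longrightarrow> \<phi> \<le> pi / 2 \<Longrightarrow> 0 \<le> s \<Longrightarrow> s \<le> 1 \<Longrightarrow> 0 \<le> slerp_coeff \<phi> s"
  using slerp_coeff_strict_antimono[of \<phi> s 1] by (cases "s = 1") auto

lemma slerp_coeff_pos: "0 \<le> \<phi> \<Longrightarrow> \<phi> \<le> pi / 2 \<Longrightarrow> 0 \<le> s \<Longrightarrow> s < 1 \<Longrightarrow> 0 < slerp_coeff \<phi> s"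
  using slerp_coeff_strict_antimono[of \<phi> s 1] by simp

lemma slerp_coeff_sum_pos:
  assumes "0 \<le> \<phi>" "\<phi> \<le> pi / 2" "0 \<le> s" "s \<le> 1"
  shows "0 < slerp_coeff \<phi> s + slerp_coeff \<phi> (1 - s)"
  using slerp_coeff_nonneg[of \<phi> "1 - s"] slerp_coeff_pos[of \<phi> s] assms
  by (cases "s = 1") (auto intro: add_pos_nonneg)

text \<open>The position on the chord of the point that projects radially to the angle \<open>s * \<phi>\<close>.\<close>

definition chord_parameter :: "real \<Rightarrow> real \<Rightarrow> real" where
  "chord_parameter \<phi> s = slerp_coeff \<phi> (1 - s) / (slerp_coeff \<phi> s + slerp_coeff \<phi> (1 - s))"

lemma is_reparametrization_chord_parameter:
  assumes \<phi>: "0 \<le> \<phi>" "\<phi> \<le> pi / 2"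
  shows "is_reparametrization (chord_parameter \<phi>)"
  unfolding is_reparametrization_def
proof (intro conjI)
  have "continuous_on {0..1} (slerp_coeff \<phi>)" "continuous_on {0..1} (\<lambda>s. slerp_coeff \<phi> (1 - s))"
    using sin_pos_le_pi_half[OF \<phi>]
    unfolding slerp_coeff_def[abs_def] by (cases "\<phi> = 0"; force intro!: continuous_intros)+
  then show "continuous_on {0..1} (chord_parameter \<phi>)"
    unfolding chord_parameter_def[abs_def]
    by (intro continuous_on_divide continuous_on_add) (use slerp_coeff_sum_pos[OF \<phi>] in force)+
  show "strict_mono_on {0..1} (chord_parameter \<phi>)"
  proof (rule strict_mono_onI)
    fix s t :: real assume st: "s \<in> {0..1}" "t \<in> {0..1}" "s < t"
    define a b a' b' where "a = slerp_coeff \<phi> s" "b = slerp_coeff \<phi> (1 - s)"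
      "a' = slerp_coeff \<phi> t" "b' = slerp_coeff \<phi> (1 - t)"
    have "a' < a" "b < b'" using st by (auto simp: a_b_a'_b'_def intro!: slerp_coeff_strict_antimono[OF \<phi>])
    moreover have "0 \<le> a'" "0 \<le> b" using st by (auto simp: a_b_a'_b'_def intro!: slerp_coeff_nonneg[OF \<phi>])
    \<comment> \<open>The cross-multiplied form of b / (a + b) < b' / (a' + b').\<close>
    ultimately have "b * a' < b' * a" by (intro mult_strict_mono') auto
    moreover have "0 < a + b" "0 < a' + b'" using \<open>a' < a\<close> \<open>b < b'\<close> \<open>0 \<le> a'\<close> \<open>0 \<le> b\<close> by linarith+
    ultimately show "chord_parameter \<phi> s < chord_parameter \<phi> t"
      unfolding chord_parameter_def a_b_a'_b'_def[symmetric] by (simp add: field_simps)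
  qed
qed (use \<phi> in \<open>simp_all add: chord_parameter_def\<close>)

lemma chord_parameter_half:
  "0 \<le> \<phi> \<Longrightarrow> \<phi> \<le> pi / 2 \<Longrightarrow> chord_parameter \<phi> (1 / 2) = 1 / 2"
  using slerp_coeff_pos[of \<phi> "1 / 2"] by (simp add: chord_parameter_def)

lemma chord_parameter_surj:
  assumes \<phi>: "0 \<le> \<phi>" "\<phi> \<le> pi / 2" and t: "0 \<le> t" "t \<le> 1"
  obtains s where "0 \<le> s" "s \<le> 1" "chord_parameter \<phi> s = t"
  using IVT'[of "chord_parameter \<phi>" 0 t 1] is_reparametrization_chord_parameter[OF \<phi>] t
  by (auto simp: is_reparametrization_def)

text \<open>Undoing the dilation lets a point of the chord inherit its density from the point of the
  arc.\<close>

lemma dilate_dilate_inverse: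
  assumes "0 < a" "sets F = sets borel"
  shows "dilate u (1 / a) (dilate u a F) = F"
proof -
  have "(\<lambda>w. u + (1 / a) *\<^sub>R (w - u)) \<in> measurable F borel"
    by (simp add: measurable_cong_sets[OF assms(2) refl])
  then have "dilate u (1 / a) (dilate u a F) = distr F borel (\<lambda>w. u + (1 / (1 / a)) *\<^sub>R (u + (1 / a) *\<^sub>R (w - u) - u))"
    unfolding dilate_def by (subst distr_distr) (simp_all add: o_def)
  also have "\<dots> = distr F borel (\<lambda>w. w)" using assms(1) by simp
  also have "\<dots> = F" by (rule distr_id2[OF assms(2)[symmetric]])
  finally show ?thesis .
qed

section \<open>Absolute continuity and variance of dilated laws\<close>

context ac_prob
begin

lemma ac_prob_dilate:
  assumes "0 < a"
  shows "ac_prob (dilate u a F)"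
  unfolding dilate_def
proof (rule ac_prob_distr[where A = UNIV and c = "1 / a"])
  show "integrable F (\<lambda>x. (norm (u + (1 / a) *\<^sub>R (x - u)))\<^sup>2)"
    using square_integrable_add[OF square_integrable_const square_integrable_scaleR[OF
          square_integrable_diff[OF square_integrable_id square_integrable_const]]]
    by (simp add: square_integrable_def)
  show "1 / a * norm (x - y) \<le> norm (u + (1 / a) *\<^sub>R (x - u) - (u + (1 / a) *\<^sub>R (y - u)))" for x y
  proof -
    have "u + (1 / a) *\<^sub>R (x - u) - (u + (1 / a) *\<^sub>R (y - u)) = (1 / a) *\<^sub>R (x - y)"
      by (simp add: algebra_simps)
    then show ?thesis using assms by simp
  qed
qed (use assms in auto)

lemma variance_about_dilate:
  "0 < a \<Longrightarrow> variance_about u (dilate u a F) = variance_about u F / a\<^sup>2"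
  unfolding dilate_def variance_about_def
  by (subst integral_distr) (auto simp: power_mult_distrib power_divide)

end

section \<open>The angle between two points of the sphere\<close>

locale density_sphere =
  fixes u :: "'a::euclidean_space" and \<theta> :: real
  assumes \<theta>_pos: "0 < \<theta>"
begin

definition radius :: real where "radius = sqrt (real DIM('a) * \<theta> / 2)"

text \<open>The squared L2 norm of a centred element; the factor 1/2 in the cost makes the radius
  seen by \<open>W2\<close> equal to \<open>sqrt (V / 2)\<close>.\<close>

definition V :: real where "V = real DIM('a) * \<theta>"

lemma V_pos: "0 < V" using \<theta>_pos by (simp add: V_def)

lemma radius_pos: "0 < radius" using \<theta>_pos by (simp add: radius_def)

lemma radius_sq: "2 * radius\<^sup>2 = V" using \<theta>_pos by (simp add: radius_def V_def)

lemma sphere_iff: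
  "F \<in> sphere_densities u \<theta> \<longleftrightarrow> ac_prob F \<and> variance_about u F = V \<and> (\<integral>v. v \<partial>F) = u"
  by (auto simp: sphere_densities_def densities_iff_ac_prob variance_about_def V_def field_simps)

lemma sphere_ac_prob: "F \<in> sphere_densities u \<theta> \<Longrightarrow> ac_prob F"
  by (simp add: sphere_iff)

definition angle :: "'a measure \<Rightarrow> 'a measure \<Rightarrow> real" where
  "angle F G = arccos (correlation u F G / V)"

lemma square_integrable_centred:
  assumes "F \<in> sphere_densities u \<theta>" "f \<in> borel_measurable M" "distr M borel f = F"
  shows "square_integrable M (\<lambda>x. f x - u)" "(\<integral>x. (f x - u) \<bullet> (f x - u) \<partial>M) = V"
proof -
  interpret F: ac_prob F by (rule sphere_ac_prob[OF assms(1)])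
  interpret M: prob_space M by (rule F.prob_space_of_distr[OF assms(2,3)])
  show "square_integrable M (\<lambda>x. f x - u)"
    by (intro square_integrable_diff F.square_integrable_if_distr[OF assms(2,3)] M.square_integrable_const)
  show "(\<integral>x. (f x - u) \<bullet> (f x - u) \<partial>M) = V"
    using F.variance_about_distr[OF assms(2,3), of u] assms(1) by (simp add: sphere_iff power2_norm_eq_inner)
qed

lemma coupling_inner_le:
  assumes F: "F \<in> sphere_densities u \<theta>" "f \<in> borel_measurable M" "distr M borel f = F"
    and G: "G \<in> sphere_densities u \<theta>" "g \<in> borel_measurable M" "distr M borel g = G"
  shows "(\<integral>x. (f x - u) \<bullet> (g x - u) \<partial>M) \<le> V"
proof -
  note f = square_integrable_centred[OF F] and g = square_integrable_centred[OF G]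
  have "0 \<le> (\<integral>x. (norm (1 *\<^sub>R (f x - u) + (-1) *\<^sub>R (g x - u)))\<^sup>2 \<partial>M)"
    by (rule Bochner_Integration.integral_nonneg) simp
  then show ?thesis
    unfolding integral_norm_combination[OF f(1) g(1)] f(2) g(2) by simp
qed

lemma correlation_le:
  assumes F: "F \<in> sphere_densities u \<theta>" and G: "G \<in> sphere_densities u \<theta>"
  shows "correlation u F G \<le> V"
proof -
  interpret F: ac_prob F by (rule sphere_ac_prob[OF F])
  show ?thesis
    unfolding correlation_def
    by (rule coupling_inner_le[OF F _ _ G])
       (simp_all add: F.optimal_map_meas F.distr_optimal_map sphere_ac_prob[OF G] distr_id2)
qed

text \<open>The independent coupling has correlation 0 because both laws have mean \<open>u\<close>.
  Hence angles never exceed a right angle.\<close>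

lemma correlation_nonneg:
  assumes F: "F \<in> sphere_densities u \<theta>" and G: "G \<in> sphere_densities u \<theta>"
  shows "0 \<le> correlation u F G"
proof -
  interpret F: ac_prob F by (rule sphere_ac_prob[OF F])
  interpret G: ac_prob G by (rule sphere_ac_prob[OF G])
  interpret FG: pair_prob_space F G ..
  have m: "fst \<in> borel_measurable (F \<Otimes>\<^sub>M G)" "snd \<in> borel_measurable (F \<Otimes>\<^sub>M G)" by measurable
  have "distr (F \<Otimes>\<^sub>M G) F fst = F" by (rule G.distr_pair_fst)
  then have f: "distr (F \<Otimes>\<^sub>M G) borel fst = F"
    by (metis F.sets_F distr_cong)
  have "distr (F \<Otimes>\<^sub>M G) G snd = G"
  proof (rule measure_eqI)
    fix A assume "A \<in> sets (distr (F \<Otimes>\<^sub>M G) G snd)"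
    then have A: "A \<in> sets G" by simp
    have "snd -` A \<inter> space (F \<Otimes>\<^sub>M G) = space F \<times> A"
      using sets.sets_into_space[OF A] by (auto simp: space_pair_measure)
    then show "emeasure (distr (F \<Otimes>\<^sub>M G) G snd) A = emeasure G A"
      using A G.emeasure_pair_measure_Times[OF sets.top A, of F] F.emeasure_space_1
      by (simp add: emeasure_distr)
  qed simp
  then have g: "distr (F \<Otimes>\<^sub>M G) borel snd = G"
    by (metis G.sets_F distr_cong)
  have int: "integrable (F \<Otimes>\<^sub>M G) (\<lambda>p. (fst p - u) \<bullet> (snd p - u))"
    by (intro square_integrable_inner square_integrable_centred(1)[OF F m(1) f] square_integrable_centred(1)[OF G m(2) g])
  have "(\<integral>p. (fst p - u) \<bullet> (snd p - u) \<partial>(F \<Otimes>\<^sub>M G)) = (\<integral>x. (\<integral>y. (x - u) \<bullet> (y - u) \<partial>G) \<partial>F)"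
    using FG.integral_fst'[OF int] by simp
  also have "(\<lambda>x. \<integral>y. (x - u) \<bullet> (y - u) \<partial>G) = (\<lambda>x. 0)"
  proof
    fix x
    have "integrable G (\<lambda>y. y)" by (rule G.square_integrable_imp_integrable[OF G.square_integrable_id])
    then have "(\<integral>y. (x - u) \<bullet> (y - u) \<partial>G) = (x - u) \<bullet> ((\<integral>y. y \<partial>G) - u)"
      by simp
    then show "(\<integral>y. (x - u) \<bullet> (y - u) \<partial>G) = 0" using G by (simp add: sphere_iff)
  qed
  finally show ?thesis using F.correlation_maximal(1)[OF sphere_ac_prob[OF G] m f g, of u] by simp
qed

lemma angle_props:
  assumes F: "F \<in> sphere_densities u \<theta>" and G: "G \<in> sphere_densities u \<theta>"
  shows "0 \<le> angle F G" "angle F G \<le> pi / 2" "correlation u F G = V * cos (angle F G)"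
proof -
  define c where "c = correlation u F G / V"
  have c: "0 \<le> c" "c \<le> 1"
    using correlation_nonneg[OF assms] correlation_le[OF assms] V_pos by (auto simp: c_def)
  show "0 \<le> angle F G" unfolding angle_def c_def[symmetric] using c by (intro arccos_lbound) auto
  show "angle F G \<le> pi / 2" unfolding angle_def c_def[symmetric] using c by (intro arccos_le_pi2) auto
  show "correlation u F G = V * cos (angle F G)"
    unfolding angle_def c_def[symmetric] using c V_pos by (simp add: cos_arccos) (simp add: c_def)
qed

lemma W2_eq_sin_angle:
  assumes F: "F \<in> sphere_densities u \<theta>" and G: "G \<in> sphere_densities u \<theta>"
  shows "W2 F G = 2 * radius * sin (angle F G / 2)"
proof -
  have "W2 F G = sqrt (V - V * cos (angle F G))"
    using ac_prob.W2_eq[OF sphere_ac_prob[OF F] sphere_ac_prob[OF G], of u] angle_props(3)[OF F G] F G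
    by (simp add: sphere_iff)
  also have "cos (angle F G) = 1 - 2 * (sin (angle F G / 2))\<^sup>2"
    using cos_double_sin[of "angle F G / 2"] by simp
  also have "V - V * (1 - 2 * (sin (angle F G / 2))\<^sup>2) = (2 * radius * sin (angle F G / 2))\<^sup>2"
    unfolding radius_sq[symmetric] by (simp add: power_mult_distrib right_diff_distrib)
  finally show ?thesis
    using radius_pos angle_props(1,2)[OF F G] sin_ge_zero[of "angle F G / 2"] by simp
qed

lemma angle_commute:
  "F \<in> sphere_densities u \<theta> \<Longrightarrow> G \<in> sphere_densities u \<theta> \<Longrightarrow> angle F G = angle G F"
  unfolding angle_def using ac_prob.correlation_commute[OF sphere_ac_prob sphere_ac_prob] by simp

lemma W2_commute:
  "F \<in> sphere_densities u \<theta> \<Longrightarrow> G \<in> sphere_densities u \<theta> \<Longrightarrow> W2 F G = W2 G F"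
  using W2_eq_sin_angle angle_commute by simp

text \<open>A coupling can only fall short of the optimal correlation, so every realization of
  \<open>F\<close> and \<open>G\<close> on a common space bounds their angle from above.\<close>

lemma angle_leI:
  assumes F: "F \<in> sphere_densities u \<theta>" and G: "G \<in> sphere_densities u \<theta>"
    and fg: "f \<in> borel_measurable M" "g \<in> borel_measurable M" "distr M borel f = F" "distr M borel g = G"
    and x: "0 \<le> x" "x \<le> pi" and le: "V * cos x \<le> (\<integral>w. (f w - u) \<bullet> (g w - u) \<partial>M)"
  shows "angle F G \<le> x"
proof -
  have "V * cos x \<le> correlation u F G"
    using le ac_prob.correlation_maximal(1)[OF sphere_ac_prob[OF F] sphere_ac_prob[OF G] fg, of u] by linarith
  then have "cos x \<le> cos (angle F G)" unfolding angle_props(3)[OF F G] using V_pos by simp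
  then show ?thesis
    using angle_props(1,2)[OF F G] x by (subst (asm) cos_mono_le_eq) auto
qed

lemma angle_triangle:
  assumes F: "F \<in> sphere_densities u \<theta>" and G: "G \<in> sphere_densities u \<theta>" and H: "H \<in> sphere_densities u \<theta>"
  shows "angle F H \<le> angle F G + angle G H"
proof -
  interpret G: ac_prob G by (rule sphere_ac_prob[OF G])
  define \<alpha> \<beta> where "\<alpha> = angle G F" "\<beta> = angle G H"
  note \<alpha> = angle_props[OF G F, folded \<alpha>_\<beta>_def(1)] and \<beta> = angle_props[OF G H, folded \<alpha>_\<beta>_def(2)]
  define f g h where "f = (\<lambda>x. optimal_map G F x - u)" "g = (\<lambda>x::'a. x - u)" "h = (\<lambda>x. optimal_map G H x - u)"
  note TF = G.optimal_map_meas[OF sphere_ac_prob[OF F]] G.distr_optimal_map[OF sphere_ac_prob[OF F]]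
  note TH = G.optimal_map_meas[OF sphere_ac_prob[OF H]] G.distr_optimal_map[OF sphere_ac_prob[OF H]]
  have f: "square_integrable G f" "(\<integral>x. f x \<bullet> f x \<partial>G) = V"
    unfolding f_g_h_def using square_integrable_centred[OF F _ TF(2)] TF(1) by simp_all
  have h: "square_integrable G h" "(\<integral>x. h x \<bullet> h x \<partial>G) = V"
    unfolding f_g_h_def using square_integrable_centred[OF H _ TH(2)] TH(1) by simp_all
  have g: "square_integrable G g" "(\<integral>x. g x \<bullet> g x \<partial>G) = V"
    unfolding f_g_h_def using square_integrable_centred[OF G, of "\<lambda>x. x" G] by (simp_all add: distr_id2)
  have gf: "(\<integral>x. f x \<bullet> g x \<partial>G) = V * cos \<alpha>"
    using \<alpha>(3) unfolding correlation_def f_g_h_def by (simp add: inner_commute)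
  have gh: "(\<integral>x. h x \<bullet> g x \<partial>G) = V * cos \<beta>"
    using \<beta>(3) unfolding correlation_def f_g_h_def by (simp add: inner_commute)
  define P where "P = (\<integral>x. f x \<bullet> h x \<partial>G)"
  \<comment> \<open>The components orthogonal to \<open>g\<close>, of norms sqrt V sin \<alpha> and
    sqrt V sin \<beta>. The Cauchy-Schwarz inequality for them gives P \<ge> V (cos \<alpha> cos
    \<beta> - sin \<alpha> sin \<beta>).\<close>
  define f' h' where "f' = (\<lambda>x. 1 *\<^sub>R f x + (- cos \<alpha>) *\<^sub>R g x)" "h' = (\<lambda>x. 1 *\<^sub>R h x + (- cos \<beta>) *\<^sub>R g x)"
  have f': "square_integrable G f'" "square_integrable G h'"
    unfolding f'_h'_def by (intro square_integrable_add square_integrable_scaleR f g h)+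
  have e: "1\<^sup>2 * V + (- c)\<^sup>2 * V + 2 * 1 * (- c) * (V * c) = V * (1 - c\<^sup>2)" for c
    by (simp add: power2_eq_square algebra_simps)
  have ff: "(\<integral>x. f' x \<bullet> f' x \<partial>G) = V * (sin \<alpha>)\<^sup>2" "(\<integral>x. h' x \<bullet> h' x \<partial>G) = V * (sin \<beta>)\<^sup>2"
    unfolding f'_h'_def power2_norm_eq_inner[symmetric]
    unfolding integral_norm_combination[OF f(1) g(1)] integral_norm_combination[OF h(1) g(1)] f(2) g(2) h(2) gf gh
    unfolding e sin_squared_eq by simp_all
  have "f' x \<bullet> h' x = f x \<bullet> h x - cos \<beta> * (f x \<bullet> g x) - cos \<alpha> * (h x \<bullet> g x) + cos \<alpha> * cos \<beta> * (g x \<bullet> g x)" for x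
    by (simp add: f'_h'_def inner_diff_left inner_diff_right inner_commute algebra_simps)
  then have "(\<integral>x. f' x \<bullet> h' x \<partial>G) = P - cos \<beta> * (V * cos \<alpha>) - cos \<alpha> * (V * cos \<beta>) + cos \<alpha> * cos \<beta> * V"
    using square_integrable_inner[OF f(1) h(1)] square_integrable_inner[OF f(1) g(1)]
      square_integrable_inner[OF h(1) g(1)] square_integrable_inner[OF g(1) g(1)]
    by (simp add: gf gh g(2) P_def)
  then have fh: "(\<integral>x. f' x \<bullet> h' x \<partial>G) = P - V * cos \<alpha> * cos \<beta>" by (simp add: algebra_simps)
  have "(P - V * cos \<alpha> * cos \<beta>)\<^sup>2 \<le> (V * sin \<alpha> * sin \<beta>)\<^sup>2"
    using Cauchy_Schwarz_integral[OF f'] unfolding ff fh by (simp add: power_mult_distrib power2_eq_square algebra_simps)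
  moreover have "0 \<le> V * sin \<alpha> * sin \<beta>"
    using V_pos \<alpha>(1,2) \<beta>(1,2) by (intro mult_nonneg_nonneg sin_ge_zero) auto
  ultimately have "\<bar>P - V * cos \<alpha> * cos \<beta>\<bar> \<le> V * sin \<alpha> * sin \<beta>" by (metis abs_le_square_iff abs_of_nonneg)
  then have "V * cos (\<alpha> + \<beta>) \<le> P" by (simp add: cos_add algebra_simps abs_le_iff)
  then have "angle F H \<le> \<alpha> + \<beta>"
    using TF TH \<alpha>(1,2) \<beta>(1,2) by (intro angle_leI[OF F H, of _ G]) (auto simp: P_def f_g_h_def)
  then show ?thesis using angle_commute[OF F G] by (simp add: \<alpha>_\<beta>_def)
qed

text \<open>The great circle in L2(F) through the identity and the optimal map, with origin at the
  constant \<open>u\<close>.\<close>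

definition slerp_map :: "'a measure \<Rightarrow> 'a measure \<Rightarrow> real \<Rightarrow> 'a \<Rightarrow> 'a" where
  "slerp_map F G s x = u + (slerp_coeff (angle F G) s *\<^sub>R (x - u)
     + slerp_coeff (angle F G) (1 - s) *\<^sub>R (optimal_map F G x - u))"

definition slerp :: "'a measure \<Rightarrow> 'a measure \<Rightarrow> real \<Rightarrow> 'a measure" where
  "slerp F G s = distr F borel (slerp_map F G s)"

text \<open>Measured from \<open>u\<close>, the law \<open>F\<close> has L2 norm a sqrt V. The mean
  square of x - u - a (T x - u), for an optimal map T to the sphere, is 2 a (a V - correlation), so
  no point of the sphere has correlation above a V with \<open>F\<close>. Dilation attains this
  value; equality makes the integrand vanish and thereby determines T and its law.\<close>

lemma closest_point:
  assumes F: "ac_prob F" and a: "0 < a" and D: "dilate u a F \<in> sphere_densities u \<theta>"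
  shows "is_closest_point u \<theta> F (dilate u a F)"
    and "is_closest_point u \<theta> F H \<Longrightarrow> H = dilate u a F"
proof -
  interpret F: ac_prob F by (rule F)
  define v where "v = variance_about u F"
  have "v / a\<^sup>2 = V" using F.variance_about_dilate[OF a, of u] D by (simp add: sphere_iff v_def)
  then have v: "v = a\<^sup>2 * V" using a by (simp add: field_simps)
  have W2: "W2 F G = sqrt ((v + V) / 2 - correlation u F G)" if "G \<in> sphere_densities u \<theta>" for G
    using F.W2_eq[of G u] that by (simp add: sphere_iff v_def)
  define f where "f = (\<lambda>x. x - u)"
  have f: "square_integrable F f" "(\<integral>x. f x \<bullet> f x \<partial>F) = a\<^sup>2 * V"
    unfolding f_def using v
    by (auto intro: square_integrable_diff F.square_integrable_id F.square_integrable_const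
        simp: v_def variance_about_def power2_norm_eq_inner)
  have expand: "(\<integral>x. (norm (f x + (- a) *\<^sub>R (optimal_map F G x - u)))\<^sup>2 \<partial>F) = 2 * a * (a * V - correlation u F G)"
    and sq: "square_integrable F (\<lambda>x. f x + (- a) *\<^sub>R (optimal_map F G x - u))"
    if G: "G \<in> sphere_densities u \<theta>" for G
  proof -
    note T = F.optimal_map_meas[OF sphere_ac_prob[OF G]] F.distr_optimal_map[OF sphere_ac_prob[OF G]]
    have g: "square_integrable F (\<lambda>x. optimal_map F G x - u)" "(\<integral>x. (optimal_map F G x - u) \<bullet> (optimal_map F G x - u) \<partial>F) = V"
      using square_integrable_centred[OF G _ T(2)] T(1) by simp_all
    show "square_integrable F (\<lambda>x. f x + (- a) *\<^sub>R (optimal_map F G x - u))"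
      by (intro square_integrable_add square_integrable_scaleR f g)
    show "(\<integral>x. (norm (f x + (- a) *\<^sub>R (optimal_map F G x - u)))\<^sup>2 \<partial>F) = 2 * a * (a * V - correlation u F G)"
      using integral_norm_combination[OF f(1) g(1), of 1 "- a"]
      unfolding f(2) g(2) by (simp add: correlation_def f_def power2_eq_square algebra_simps)
  qed
  have le: "correlation u F G \<le> a * V" if G: "G \<in> sphere_densities u \<theta>" for G
  proof -
    have "0 \<le> 2 * a * (a * V - correlation u F G)"
      unfolding expand[OF G, symmetric] by (rule Bochner_Integration.integral_nonneg) simp
    then show ?thesis using a by (simp add: zero_le_mult_iff)
  qed
  have ge: "a * V \<le> correlation u F (dilate u a F)"
  proof -
    have "(\<integral>x. (x - u) \<bullet> ((u + (1 / a) *\<^sub>R (x - u)) - u) \<partial>F) \<le> correlation u F (dilate u a F)"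
      by (rule F.correlation_maximal(1)[OF sphere_ac_prob[OF D]]) (simp_all add: dilate_def distr_id2)
    moreover have "(\<integral>x. (x - u) \<bullet> ((u + (1 / a) *\<^sub>R (x - u)) - u) \<partial>F) = a * V"
      using f(2) a by (simp add: f_def power2_eq_square)
    ultimately show ?thesis by simp
  qed
  show "is_closest_point u \<theta> F (dilate u a F)"
    unfolding is_closest_point_def using D le ge W2 by (auto intro: order_trans)
  assume H: "is_closest_point u \<theta> F H"
  then have HE: "H \<in> sphere_densities u \<theta>" and "W2 F H \<le> W2 F (dilate u a F)"
    using D by (auto simp: is_closest_point_def)
  then have "correlation u F (dilate u a F) \<le> correlation u F H" using W2[OF HE] W2[OF D] by simp
  then have "correlation u F H = a * V" using ge le[OF HE] by linarith
  then have "(\<integral>x. (norm (f x + (- a) *\<^sub>R (optimal_map F H x - u)))\<^sup>2 \<partial>F) = 0"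
    using expand[OF HE] by simp
  then have "AE x in F. (norm (f x + (- a) *\<^sub>R (optimal_map F H x - u)))\<^sup>2 = 0"
    using sq[OF HE] by (subst (asm) integral_nonneg_eq_0_iff_AE) (auto simp: square_integrable_def)
  then have "AE x in F. optimal_map F H x = u + (1 / a) *\<^sub>R (x - u)"
  proof eventually_elim
    case (elim x)
    then have "x - u = a *\<^sub>R (optimal_map F H x - u)" by (simp add: f_def)
    then show ?case using a by simp
  qed
  then have "distr F borel (optimal_map F H) = dilate u a F"
    unfolding dilate_def using F.optimal_map_meas[OF sphere_ac_prob[OF HE]]
    by (intro distr_cong_AE) auto
  then show "H = dilate u a F" using F.distr_optimal_map[OF sphere_ac_prob[OF HE]] by simp
qed

lemma dilation_factor_unique:
  assumes "ac_prob F" "0 < a" "dilate u a F \<in> sphere_densities u \<theta>" "0 < b" "dilate u b F \<in> sphere_densities u \<theta>"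
  shows "a = b"
proof -
  have "variance_about u F / a\<^sup>2 = V" "variance_about u F / b\<^sup>2 = V"
    using ac_prob.variance_about_dilate[OF assms(1), of _ u] assms by (simp_all add: sphere_iff)
  then have "a\<^sup>2 * V = b\<^sup>2 * V" using assms(2,4) by (simp add: field_simps)
  then have "a\<^sup>2 = b\<^sup>2" using V_pos by simp
  then show ?thesis using assms(2,4) by (simp add: power2_eq_iff_nonneg)
qed

lemma dilation_projection_eq:
  assumes "ac_prob F" "0 < a" "dilate u a F \<in> sphere_densities u \<theta>"
  shows "dilation_projection u \<theta> F = dilate u a F"
proof -
  have "(THE a. 0 < a \<and> dilate u a F \<in> sphere_densities u \<theta>) = a"
    using assms dilation_factor_unique[OF assms(1)] by (intro the_equality) auto
  then show ?thesis by (simp add: dilation_projection_def)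
qed

section \<open>The arc between two points of the sphere\<close>

context
  fixes F G :: "'a measure"
  assumes F: "F \<in> sphere_densities u \<theta>" and G: "G \<in> sphere_densities u \<theta>"
begin

interpretation F: ac_prob F by (rule sphere_ac_prob[OF F])

lemmas FG_angle = angle_props[OF F G]

lemma T_meas[measurable]: "optimal_map F G \<in> borel_measurable borel"
  by (rule F.optimal_map_meas[OF sphere_ac_prob[OF G]])

lemma T_distr: "distr F borel (optimal_map F G) = G"
  by (rule F.distr_optimal_map[OF sphere_ac_prob[OF G]])

lemma slerp_map_meas[measurable]: "slerp_map F G s \<in> borel_measurable borel"
  unfolding slerp_map_def[abs_def] by measurable

lemma centred_pair:
  "square_integrable F (\<lambda>x. x - u)" "(\<integral>x. (x - u) \<bullet> (x - u) \<partial>F) = V"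
  "square_integrable F (\<lambda>x. optimal_map F G x - u)" "(\<integral>x. (optimal_map F G x - u) \<bullet> (optimal_map F G x - u) \<partial>F) = V"
  "(\<integral>x. (x - u) \<bullet> (optimal_map F G x - u) \<partial>F) = V * cos (angle F G)"
  using square_integrable_centred[OF F, of "\<lambda>x. x" F] square_integrable_centred[OF G _ T_distr] FG_angle(3)
  by (simp_all add: distr_id2 correlation_def)

lemma integral_slerp_map:
  "(\<integral>x. (slerp_map F G s x - u) \<bullet> (slerp_map F G t x - u) \<partial>F) = V * cos ((t - s) * angle F G)"
proof -
  define a b c d where "a = slerp_coeff (angle F G) s" "b = slerp_coeff (angle F G) (1 - s)"
    "c = slerp_coeff (angle F G) t" "d = slerp_coeff (angle F G) (1 - t)"
  note defs = this
  let ?f = "\<lambda>x. x - u" and ?h = "\<lambda>x. optimal_map F G x - u"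
  have "(slerp_map F G s x - u) \<bullet> (slerp_map F G t x - u)
      = a * c * (?f x \<bullet> ?f x) + b * d * (?h x \<bullet> ?h x) + (a * d + b * c) * (?f x \<bullet> ?h x)" for x
  proof -
    have "(slerp_map F G s x - u) \<bullet> (slerp_map F G t x - u)
        = (a *\<^sub>R ?f x + b *\<^sub>R ?h x) \<bullet> (c *\<^sub>R ?f x + d *\<^sub>R ?h x)"
      by (simp add: slerp_map_def defs)
    also have "\<dots> = a * c * (?f x \<bullet> ?f x) + b * d * (?h x \<bullet> ?h x) + (a * d + b * c) * (?f x \<bullet> ?h x)"
      unfolding inner_add_left inner_add_right inner_scaleR_left inner_scaleR_right
        inner_commute[of "?h x" "?f x"] by (simp only: distrib_left distrib_right mult_ac add_ac)
    finally show ?thesis .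
  qed
  then have "(\<integral>x. (slerp_map F G s x - u) \<bullet> (slerp_map F G t x - u) \<partial>F)
      = (\<integral>x. a * c * (?f x \<bullet> ?f x) + b * d * (?h x \<bullet> ?h x) + (a * d + b * c) * (?f x \<bullet> ?h x) \<partial>F)"
    by simp
  also have "\<dots> = a * c * V + b * d * V + (a * d + b * c) * (V * cos (angle F G))"
  proof -
    have i: "integrable F (\<lambda>x. a * c * (?f x \<bullet> ?f x))" "integrable F (\<lambda>x. b * d * (?h x \<bullet> ?h x))"
      "integrable F (\<lambda>x. (a * d + b * c) * (?f x \<bullet> ?h x))"
      by (intro integrable_mult_right square_integrable_inner centred_pair)+
    show ?thesis
      unfolding Bochner_Integration.integral_add[OF Bochner_Integration.integrable_add[OF i(1,2)] i(3)]
        Bochner_Integration.integral_add[OF i(1,2)] integral_mult_right_zero centred_pair ..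
  qed
  also have "\<dots> = V * (a * c + b * d + (a * d + b * c) * cos (angle F G))" by (simp add: algebra_simps)
  finally show ?thesis unfolding defs slerp_coeff_inner[OF FG_angle(1,2)] .
qed

lemma slerp_0: "slerp F G 0 = F"
proof -
  have "slerp_map F G 0 = (\<lambda>x. x)" using FG_angle by (auto simp: slerp_map_def)
  then show ?thesis by (simp add: slerp_def distr_id2)
qed

lemma slerp_1: "slerp F G 1 = G"
proof -
  have "slerp_map F G 1 = optimal_map F G" using FG_angle by (auto simp: slerp_map_def)
  then show ?thesis by (simp add: slerp_def T_distr)
qed

text \<open>Monotonicity of the optimal map makes \<open>slerp_map\<close> expand distances by at
  least the coefficient \<open>a\<close> of the identity, and this yields the density. At s = 1 this
  coefficient is 0, and membership of \<open>G\<close> is used instead.\<close>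

lemma slerp_in_sphere:
  assumes s: "0 \<le> s" "s \<le> 1"
  shows "slerp F G s \<in> sphere_densities u \<theta>"
proof (cases "s = 1")
  case True
  then show ?thesis using slerp_1 G by simp
next
  case False
  define a b where "a = slerp_coeff (angle F G) s" "b = slerp_coeff (angle F G) (1 - s)"
  have ab: "0 < a" "0 \<le> b"
    using s False FG_angle by (auto simp: a_b_def intro: slerp_coeff_pos slerp_coeff_nonneg)
  let ?S = "slerp_map F G s"
  have S: "?S x = u + (a *\<^sub>R (x - u) + b *\<^sub>R (optimal_map F G x - u))" for x by (simp add: slerp_map_def a_b_def)
  have S2: "square_integrable F ?S"
    unfolding S[abs_def]
    by (intro square_integrable_add square_integrable_scaleR centred_pair F.square_integrable_const)
  obtain A where A: "AE x in F. x \<in> A" "\<And>x y. x \<in> A \<Longrightarrow> y \<in> A \<Longrightarrow> 0 \<le> (optimal_map F G x - optimal_map F G y) \<bullet> (x - y)"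
    using F.optimal_map_monotone[OF F.is_optimal_map_optimal_map[OF sphere_ac_prob[OF G]]] by blast
  have "ac_prob (slerp F G s)"
    unfolding slerp_def
  proof (rule F.ac_prob_distr[OF _ ab(1) A(1)])
    fix x y assume xy: "x \<in> A" "y \<in> A"
    have "a * (norm (x - y))\<^sup>2 \<le> a * (norm (x - y))\<^sup>2 + b * ((optimal_map F G x - optimal_map F G y) \<bullet> (x - y))"
      using A(2)[OF xy] ab(2) by simp
    also have "\<dots> = (a *\<^sub>R (x - y) + b *\<^sub>R (optimal_map F G x - optimal_map F G y)) \<bullet> (x - y)"
      by (simp add: inner_add_left power2_norm_eq_inner)
    also have "a *\<^sub>R (x - y) + b *\<^sub>R (optimal_map F G x - optimal_map F G y) = ?S x - ?S y"
      by (simp add: S algebra_simps)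
    also have "(?S x - ?S y) \<bullet> (x - y) \<le> norm (?S x - ?S y) * norm (x - y)" by (rule norm_cauchy_schwarz)
    finally have "(a * norm (x - y)) * norm (x - y) \<le> norm (?S x - ?S y) * norm (x - y)"
      by (simp add: power2_eq_square mult.assoc)
    then show "a * norm (x - y) \<le> norm (?S x - ?S y)"
      by (cases "x = y") (auto simp: mult_le_cancel_right)
  qed (use S2 in \<open>auto simp: square_integrable_def\<close>)
  moreover have "variance_about u (slerp F G s) = V"
    using integral_slerp_map[of s s] unfolding variance_about_def slerp_def
    by (subst integral_distr) (auto simp: power2_norm_eq_inner)
  moreover have "(\<integral>v. v \<partial>slerp F G s) = u"
  proof -
    have iF: "integrable F (\<lambda>x. x - u)" "integrable F (\<lambda>x. optimal_map F G x - u)"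
      by (intro F.square_integrable_imp_integrable centred_pair)+
    have iG: "integrable F (optimal_map F G)"
      by (intro F.square_integrable_imp_integrable F.square_integrable_optimal_map sphere_ac_prob[OF G])
    have "(\<integral>x. x - u \<partial>F) = 0"
      using F F.square_integrable_imp_integrable[OF F.square_integrable_id] by (simp add: sphere_iff)
    moreover have "(\<integral>x. optimal_map F G x \<partial>F) = (\<integral>v. v \<partial>distr F borel (optimal_map F G))"
      by (subst integral_distr) auto
    then have "(\<integral>x. optimal_map F G x - u \<partial>F) = 0"
      using G iG by (simp add: T_distr sphere_iff)
    moreover have "(\<integral>v. v \<partial>slerp F G s) = (\<integral>x. u + (a *\<^sub>R (x - u) + b *\<^sub>R (optimal_map F G x - u)) \<partial>F)"
      unfolding slerp_def by (subst integral_distr) (auto simp: S[abs_def])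
    ultimately show ?thesis
      using iF by (simp del: scaleR_right_diff_distrib Bochner_Integration.integral_diff)
  qed
  ultimately show ?thesis by (simp add: sphere_iff)
qed

text \<open>The slerp maps realize both laws on \<open>F\<close>, which bounds each angle from above
  by the expected value. The bounds for [0, s], [s, t] and [t, 1] add up to the whole angle, so the
  triangle inequality leaves no room for a smaller one.\<close>

lemma angle_slerp:
  assumes st: "0 \<le> s" "s \<le> t" "t \<le> 1"
  shows "angle (slerp F G s) (slerp F G t) = (t - s) * angle F G"
proof -
  have le: "angle (slerp F G p) (slerp F G q) \<le> (q - p) * angle F G" if "0 \<le> p" "p \<le> q" "q \<le> 1" for p q
  proof (rule angle_leI[OF slerp_in_sphere slerp_in_sphere, where M = F and f = "slerp_map F G p" and g = "slerp_map F G q"])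
    have "(q - p) * angle F G \<le> 1 * angle F G" using that FG_angle(1) by (intro mult_right_mono) auto
    then show "(q - p) * angle F G \<le> pi" using FG_angle(2) pi_gt_zero by linarith
  qed (use that FG_angle(1) in \<open>auto simp: slerp_def integral_slerp_map\<close>)
  have "angle F G \<le> angle (slerp F G 0) (slerp F G s) + angle (slerp F G s) (slerp F G t) + angle (slerp F G t) (slerp F G 1)"
    using angle_triangle[of "slerp F G 0" "slerp F G s" "slerp F G 1"] angle_triangle[of "slerp F G s" "slerp F G t" "slerp F G 1"]
      slerp_in_sphere[of 0] slerp_in_sphere[of s] slerp_in_sphere[of t] slerp_in_sphere[of 1] st
    unfolding slerp_0 slerp_1 by linarith
  moreover have "angle (slerp F G 0) (slerp F G s) \<le> s * angle F G" "angle (slerp F G t) (slerp F G 1) \<le> (1 - t) * angle F G"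
    using le[of 0 s] le[of t 1] st by auto
  ultimately have "(t - s) * angle F G \<le> angle (slerp F G s) (slerp F G t)"
    by (simp add: left_diff_distrib)
  then show ?thesis using le[OF st] by linarith
qed

text \<open>The slerp coefficients are nonnegative but need not sum to 1. Division by their sum
  \<open>l\<close> gives a convex combination, so the point of the arc is a point of the chord
  scaled by \<open>l\<close> about \<open>u\<close>; \<open>dilate\<close> takes the inverse factor
  1 / l.\<close>

lemma slerp_eq_dilate_chord:
  assumes s: "0 \<le> s" "s \<le> 1"
  shows "\<exists>a>0. slerp F G s = dilate u a (chordal_geodesic F G (chord_parameter (angle F G) s))
    \<and> ac_prob (chordal_geodesic F G (chord_parameter (angle F G) s))"
proof -
  define a b l where "a = slerp_coeff (angle F G) s" "b = slerp_coeff (angle F G) (1 - s)" "l = a + b"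
  have l: "0 < l" using slerp_coeff_sum_pos[OF FG_angle(1,2) s] by (simp add: a_b_l_def)
  let ?t = "chord_parameter (angle F G) s"
  have "?t = b / l" by (simp add: chord_parameter_def a_b_l_def)
  then have lt: "l * ?t = b" "l * (1 - ?t) = a" using l by (simp_all add: a_b_l_def right_diff_distrib)
  have ch: "(\<lambda>v. (1 - ?t) *\<^sub>R v + ?t *\<^sub>R optimal_map F G v) \<in> borel_measurable F" by simp
  have "dilate u (1 / l) (chordal_geodesic F G ?t)
      = distr F borel (\<lambda>x. u + l *\<^sub>R ((1 - ?t) *\<^sub>R x + ?t *\<^sub>R optimal_map F G x - u))"
    unfolding dilate_def chordal_geodesic_def by (subst distr_distr) (simp_all add: o_def)
  also have "(\<lambda>x. u + l *\<^sub>R ((1 - ?t) *\<^sub>R x + ?t *\<^sub>R optimal_map F G x - u)) = slerp_map F G s"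
  proof
    fix x
    have "l *\<^sub>R ((1 - ?t) *\<^sub>R x + ?t *\<^sub>R optimal_map F G x - u)
        = (l * (1 - ?t)) *\<^sub>R x + (l * ?t) *\<^sub>R optimal_map F G x - l *\<^sub>R u"
      by (simp only: scaleR_diff_right scaleR_add_right scaleR_scaleR)
    also have "\<dots> = a *\<^sub>R (x - u) + b *\<^sub>R (optimal_map F G x - u)"
      unfolding lt by (simp add: a_b_l_def(3) scaleR_diff_right scaleR_add_left)
    finally show "u + l *\<^sub>R ((1 - ?t) *\<^sub>R x + ?t *\<^sub>R optimal_map F G x - u) = slerp_map F G s x"
      by (simp add: slerp_map_def a_b_l_def)
  qed
  finally have eq: "slerp F G s = dilate u (1 / l) (chordal_geodesic F G ?t)" by (simp add: slerp_def)
  have "dilate u (1 / (1 / l)) (slerp F G s) = chordal_geodesic F G ?t"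
    unfolding eq using l by (intro dilate_dilate_inverse) (simp_all add: chordal_geodesic_def)
  moreover have "ac_prob (dilate u (1 / (1 / l)) (slerp F G s))"
    using ac_prob.ac_prob_dilate[OF sphere_ac_prob[OF slerp_in_sphere[OF s]]] l by simp
  ultimately have "ac_prob (chordal_geodesic F G ?t)" by simp
  then show ?thesis using eq l by (intro exI[of _ "1 / l"]) simp
qed

lemma projected_chord:
  assumes s: "0 \<le> s" "s \<le> 1"
  defines "C \<equiv> chordal_geodesic F G (chord_parameter (angle F G) s)"
  shows "is_closest_point u \<theta> C H \<longleftrightarrow> H = slerp F G s"
    and "projected_chord u \<theta> F G (chord_parameter (angle F G) s) = slerp F G s"
    and "dilation_projection u \<theta> C = slerp F G s"
    and "\<exists>a>0. slerp F G s = dilate u a C"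
proof -
  obtain a where a: "0 < a" "slerp F G s = dilate u a C" "ac_prob C"
    using slerp_eq_dilate_chord[OF s] unfolding C_def by blast
  have E: "dilate u a C \<in> sphere_densities u \<theta>" using slerp_in_sphere[OF s] a(2) by simp
  show iff: "is_closest_point u \<theta> C H \<longleftrightarrow> H = slerp F G s" for H
    unfolding a(2) using closest_point(1)[OF a(3,1) E] closest_point(2)[OF a(3,1) E, of H] by blast
  show "projected_chord u \<theta> F G (chord_parameter (angle F G) s) = slerp F G s"
    unfolding projected_chord_def closest_point_on_sphere_def C_def[symmetric] iff by simp
  show "dilation_projection u \<theta> C = slerp F G s"
    using dilation_projection_eq[OF a(3,1) E] a(2) by simp
  show "\<exists>a>0. slerp F G s = dilate u a C" using a by blast
qed

text \<open>The optimal maps from \<open>H\<close> to the two ends give vectors f and h in L2(H); on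
  the arc the centred identity g would equal k = a f + b h. The angle bounds make the mean square of
  g - k at most - 2 a b (V cos \<phi> - P), while P is at most the optimal V cos \<phi>, so both
  vanish. As a b > 0, the pair (S, T) is an optimal coupling of \<open>F\<close> and
  \<open>G\<close>, and g = k exhibits \<open>H\<close> as the image of \<open>F\<close> under the
  slerp map.\<close>

lemma slerp_unique:
  assumes H: "H \<in> sphere_densities u \<theta>" and t: "0 < t" "t < 1"
    and FH: "angle F H \<le> t * angle F G" and HG: "angle H G \<le> (1 - t) * angle F G"
  shows "H = slerp F G t"
proof -
  interpret H: ac_prob H by (rule sphere_ac_prob[OF H])
  define \<phi> where "\<phi> = angle F G"
  note \<phi> = FG_angle[folded \<phi>_def]
  define a b where "a = slerp_coeff \<phi> t" "b = slerp_coeff \<phi> (1 - t)"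
  have ab: "0 < a" "0 < b" using t \<phi> by (auto simp: a_b_def intro: slerp_coeff_pos)
  have "cos (t * \<phi>) \<le> cos (angle H F)"
  proof (rule cos_monotone_0_pi_le)
    have "t * \<phi> \<le> 1 * \<phi>" using t \<phi>(1) by (intro mult_right_mono) auto
    then show "t * \<phi> \<le> pi" using \<phi>(2) pi_gt_zero by linarith
  qed (use FH angle_commute[OF F H] angle_props[OF H F] in \<open>simp_all add: \<phi>_def\<close>)
  then have cF: "V * cos (t * \<phi>) \<le> correlation u H F" using angle_props(3)[OF H F] V_pos by simp
  have "cos ((1 - t) * \<phi>) \<le> cos (angle H G)"
  proof (rule cos_monotone_0_pi_le)
    have "(1 - t) * \<phi> \<le> 1 * \<phi>" using t \<phi>(1) by (intro mult_right_mono) auto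
    then show "(1 - t) * \<phi> \<le> pi" using \<phi>(2) pi_gt_zero by linarith
  qed (use HG angle_props[OF H G] in \<open>simp_all add: \<phi>_def\<close>)
  then have cG: "V * cos ((1 - t) * \<phi>) \<le> correlation u H G" using angle_props(3)[OF H G] V_pos by simp
  \<comment> \<open>Inner products, in units of \<open>V\<close>, of the arc point with the two ends
    and with itself.\<close>
  have cos1: "cos (t * \<phi>) = a + b * cos \<phi>" and cos2: "cos ((1 - t) * \<phi>) = b + a * cos \<phi>"
    and one: "a * a + b * b + 2 * (a * b) * cos \<phi> = 1"
    using slerp_coeff_inner[OF \<phi>(1,2), of 0 t] slerp_coeff_inner[OF \<phi>(1,2), of t 1]
      slerp_coeff_inner[OF \<phi>(1,2), of t t] \<phi>(1,2)
    by (simp_all add: a_b_def mult.commute)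
  define S T where "S = optimal_map H F" "T = optimal_map H G"
  have S: "S \<in> borel_measurable borel" "distr H borel S = F"
    and T: "T \<in> borel_measurable borel" "distr H borel T = G"
    unfolding S_T_def using H.optimal_map_meas H.distr_optimal_map sphere_ac_prob[OF F] sphere_ac_prob[OF G] by auto
  note [measurable] = S(1) T(1)
  define f g h where "f = (\<lambda>x. S x - u)" "g = (\<lambda>x::'a. x - u)" "h = (\<lambda>x. T x - u)"
  have f: "square_integrable H f" "(\<integral>x. f x \<bullet> f x \<partial>H) = V"
    unfolding f_g_h_def using square_integrable_centred[OF F _ S(2)] S(1) by simp_all
  have h: "square_integrable H h" "(\<integral>x. h x \<bullet> h x \<partial>H) = V"
    unfolding f_g_h_def using square_integrable_centred[OF G _ T(2)] T(1) by simp_all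
  have g: "square_integrable H g" "(\<integral>x. g x \<bullet> g x \<partial>H) = V"
    unfolding f_g_h_def using square_integrable_centred[OF H, of "\<lambda>x. x" H] by (simp_all add: distr_id2)
  define P where "P = (\<integral>x. f x \<bullet> h x \<partial>H)"
  have P: "P \<le> V * cos \<phi>"
    using F.correlation_maximal(1)[OF sphere_ac_prob[OF G] _ _ S(2) T(2), of u] S(1) T(1) \<phi>(3)
    by (simp add: P_def f_g_h_def)
  define k where "k = (\<lambda>x. a *\<^sub>R f x + b *\<^sub>R h x)"
  have k: "square_integrable H k" unfolding k_def by (intro square_integrable_add square_integrable_scaleR f h)
  have kk: "(\<integral>x. k x \<bullet> k x \<partial>H) = a * a * V + b * b * V + 2 * (a * b) * P"
  proof -
    have "(\<integral>x. k x \<bullet> k x \<partial>H) = (\<integral>x. (norm (a *\<^sub>R f x + b *\<^sub>R h x))\<^sup>2 \<partial>H)"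
      by (simp only: k_def power2_norm_eq_inner)
    then show ?thesis
      unfolding integral_norm_combination[OF f(1) h(1)] f(2) h(2) by (simp add: P_def power2_eq_square)
  qed
  have gk: "(\<integral>x. g x \<bullet> k x \<partial>H) = a * correlation u H F + b * correlation u H G"
  proof -
    have "(\<integral>x. g x \<bullet> k x \<partial>H) = (\<integral>x. a * (g x \<bullet> f x) + b * (g x \<bullet> h x) \<partial>H)"
      by (simp add: k_def inner_add_right)
    also have "\<dots> = a * (\<integral>x. g x \<bullet> f x \<partial>H) + b * (\<integral>x. g x \<bullet> h x \<partial>H)"
      using square_integrable_inner[OF g(1) f(1)] square_integrable_inner[OF g(1) h(1)] by simp
    finally show ?thesis by (simp add: correlation_def f_g_h_def S_T_def)
  qed
  have total: "(\<integral>x. (norm (1 *\<^sub>R g x + (-1) *\<^sub>R k x))\<^sup>2 \<partial>H)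
      = V + (a * a * V + b * b * V + 2 * (a * b) * P) - 2 * (a * correlation u H F + b * correlation u H G)"
    unfolding integral_norm_combination[OF g(1) k] g(2) kk gk by simp
  have lower: "a * (V * cos (t * \<phi>)) + b * (V * cos ((1 - t) * \<phi>)) \<le> a * correlation u H F + b * correlation u H G"
    using cF cG ab by (intro add_mono mult_left_mono) auto
  have "a * (V * cos (t * \<phi>)) + b * (V * cos ((1 - t) * \<phi>)) = V * (a * a + b * b + 2 * (a * b) * cos \<phi>)"
    unfolding cos1 cos2 by (simp add: algebra_simps)
  then have lower': "V \<le> a * correlation u H F + b * correlation u H G" using lower one by simp
  have "a * a * V + b * b * V + 2 * (a * b) * P = V * (a * a + b * b + 2 * (a * b) * cos \<phi>) - 2 * (a * b) * (V * cos \<phi> - P)"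
    by (simp add: algebra_simps)
  then have up: "(\<integral>x. (norm (1 *\<^sub>R g x + (-1) *\<^sub>R k x))\<^sup>2 \<partial>H) \<le> - (2 * (a * b) * (V * cos \<phi> - P))"
    unfolding total one using lower' by simp
  have nn: "0 \<le> (\<integral>x. (norm (1 *\<^sub>R g x + (-1) *\<^sub>R k x))\<^sup>2 \<partial>H)"
    by (rule Bochner_Integration.integral_nonneg) simp
  have "0 \<le> 2 * (a * b) * (V * cos \<phi> - P)" using ab P by (intro mult_nonneg_nonneg) auto
  then have z: "2 * (a * b) * (V * cos \<phi> - P) = 0" "(\<integral>x. (norm (1 *\<^sub>R g x + (-1) *\<^sub>R k x))\<^sup>2 \<partial>H) = 0"
    using up nn by linarith+
  have "P = correlation u F G" using z(1) ab \<phi>(3) by simp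
  then have AE1: "AE x in H. T x = optimal_map F G (S x)"
    using F.correlation_maximal(2)[OF sphere_ac_prob[OF G] _ _ S(2) T(2), of u] S(1) T(1)
    by (simp add: P_def f_g_h_def)
  have "square_integrable H (\<lambda>x. 1 *\<^sub>R g x + (-1) *\<^sub>R k x)"
    by (intro square_integrable_add square_integrable_scaleR g k)
  then have "AE x in H. (norm (1 *\<^sub>R g x + (-1) *\<^sub>R k x))\<^sup>2 = 0"
    using z(2) by (subst (asm) integral_nonneg_eq_0_iff_AE) (auto simp: square_integrable_def)
  \<comment> \<open>\<open>AE1\<close> replaces \<open>T x\<close> by the optimal map at
    \<open>S x\<close>, so the combination of both becomes the slerp map at \<open>S x\<close>; and
    \<open>S\<close> pushes \<open>H\<close> to \<open>F\<close>.\<close>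
  then have "AE x in H. x = slerp_map F G t (S x)"
    using AE1
  proof eventually_elim
    case (elim x)
    then have "g x = k x" by simp
    then show ?case using elim(2)
      by (simp add: f_g_h_def k_def slerp_map_def a_b_def \<phi>_def algebra_simps)
  qed
  then have "distr H borel (\<lambda>x. x) = distr H borel (slerp_map F G t \<circ> S)"
    by (intro distr_cong_AE) (auto intro: measurable_compose[OF S(1) slerp_map_meas] simp: o_def)
  also have "\<dots> = distr (distr H borel S) borel (slerp_map F G t)"
    by (rule distr_distr[symmetric]) simp_all
  also have "\<dots> = slerp F G t" by (simp add: S(2) slerp_def)
  finally show ?thesis by (simp add: distr_id2)
qed

end

end

section \<open>Lengths and geodesics\<close>

context density_sphere
begin

lemma midpoint_projection:
  assumes F: "F \<in> sphere_densities u \<theta>" and G: "G \<in> sphere_densities u \<theta>"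
  shows "dilation_projection u \<theta> (chordal_geodesic F G (1 / 2)) = slerp F G (1 / 2)"
  using projected_chord(3)[OF F G, of "1 / 2"] chord_parameter_half[OF angle_props(1,2)[OF F G]] by simp

text \<open>Projecting the midpoint of a chord gives the midpoint of the arc, so each refinement
  halves all consecutive angles exactly.\<close>

lemma dyadic_points_angle:
  assumes F: "F \<in> sphere_densities u \<theta>" and G: "G \<in> sphere_densities u \<theta>"
  shows "(\<forall>j\<le>2 ^ k. dyadic_points u \<theta> F G k j \<in> sphere_densities u \<theta>) \<and>
    (\<forall>j<2 ^ k. angle (dyadic_points u \<theta> F G k j) (dyadic_points u \<theta> F G k (Suc j)) = angle F G / 2 ^ k)"
proof (induction k)
  case 0
  then show ?case using F G by simp
next
  case (Suc k)
  let ?D = "dyadic_points u \<theta> F G k" and ?D' = "dyadic_points u \<theta> F G (Suc k)"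
  have even: "?D' (2 * i) = ?D i" for i by simp
  have odd: "?D' (Suc (2 * i)) = slerp (?D i) (?D (Suc i)) (1 / 2)" if "i < 2 ^ k" for i
    using Suc.IH that by (simp add: midpoint_projection)
  have angles: "angle (?D i) (slerp (?D i) (?D (Suc i)) (1 / 2)) = angle F G / 2 ^ Suc k"
      "angle (slerp (?D i) (?D (Suc i)) (1 / 2)) (?D (Suc i)) = angle F G / 2 ^ Suc k" if "i < 2 ^ k" for i
  proof -
    have E: "?D i \<in> sphere_densities u \<theta>" "?D (Suc i) \<in> sphere_densities u \<theta>" using Suc.IH that by simp_all
    have "angle (?D i) (?D (Suc i)) = angle F G / 2 ^ k" using Suc.IH that by simp
    then show "angle (?D i) (slerp (?D i) (?D (Suc i)) (1 / 2)) = angle F G / 2 ^ Suc k"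
      "angle (slerp (?D i) (?D (Suc i)) (1 / 2)) (?D (Suc i)) = angle F G / 2 ^ Suc k"
      using angle_slerp[OF E, of 0 "1 / 2"] angle_slerp[OF E, of "1 / 2" 1] slerp_0[OF E] slerp_1[OF E] by simp_all
  qed
  show ?case
  proof (intro conjI allI impI)
    fix j :: nat assume j: "j \<le> 2 ^ Suc k"
    show "?D' j \<in> sphere_densities u \<theta>"
    proof (cases "even j")
      case True
      then obtain i where "j = 2 * i" by blast
      then show ?thesis using even[of i] Suc.IH j by (simp del: dyadic_points.simps)
    next
      case False
      then obtain i where i: "j = Suc (2 * i)" by (metis oddE Suc_eq_plus1)
      then have "i < 2 ^ k" using j by simp
      then show ?thesis
        using odd[of i] Suc.IH slerp_in_sphere[of "?D i" "?D (Suc i)" "1 / 2"] i by (simp del: dyadic_points.simps)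
    qed
  next
    fix j :: nat assume j: "j < 2 ^ Suc k"
    show "angle (?D' j) (?D' (Suc j)) = angle F G / 2 ^ Suc k"
    proof (cases "even j")
      case True
      then obtain i where i: "j = 2 * i" by blast
      then have "i < 2 ^ k" using j by simp
      then show ?thesis using angles(1) unfolding i even by (simp only: odd)
    next
      case False
      then obtain i where i: "j = Suc (2 * i)" by (metis oddE Suc_eq_plus1)
      then have "i < 2 ^ k" using j by simp
      moreover have "Suc j = 2 * Suc i" using i by simp
      ultimately show ?thesis using angles(2) unfolding \<open>Suc j = 2 * Suc i\<close> even unfolding i by (simp only: odd)
    qed
  qed
qed

text \<open>Level k consists of \<open>2 ^ k\<close> chords of equal length; the factor 2 of the
  chord formula and the half angle inside it combine to \<open>2 ^ Suc k\<close>.\<close>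

lemma induced_distance_eq:
  assumes F: "F \<in> sphere_densities u \<theta>" and G: "G \<in> sphere_densities u \<theta>"
  shows "induced_distance u \<theta> F G = radius * angle F G"
proof -
  let ?D = "dyadic_points u \<theta> F G"
  have "(\<Sum>j<2 ^ k. W2 (?D k j) (?D k (Suc j))) = radius * (2 ^ Suc k * sin (angle F G / 2 ^ Suc k))" for k
  proof -
    have "(\<Sum>j<2 ^ k. W2 (?D k j) (?D k (Suc j))) = (\<Sum>j<(2::nat) ^ k. 2 * radius * sin (angle F G / 2 ^ k / 2))"
    proof (rule sum.cong[OF refl])
      fix j :: nat assume "j \<in> {..<2 ^ k}"
      then show "W2 (?D k j) (?D k (Suc j)) = 2 * radius * sin (angle F G / 2 ^ k / 2)"
        using dyadic_points_angle[OF assms, of k] by (simp add: W2_eq_sin_angle)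
    qed
    then show ?thesis by (simp add: mult.commute mult.left_commute)
  qed
  moreover have "(\<lambda>k. 2 ^ Suc k * sin (angle F G / 2 ^ Suc k)) \<longlonglongrightarrow> angle F G"
  proof (rule tendsto_mult_sin_divide)
    have "real n \<le> 2 ^ n" for n using of_nat_less_two_power[of n] by (rule less_imp_le)
    then have "filterlim (\<lambda>n. 2 ^ n :: real) at_top sequentially"
      by (intro filterlim_at_top_mono[OF filterlim_real_sequentially] always_eventually) simp
    then show "filterlim (\<lambda>n. 2 ^ Suc n :: real) at_top sequentially" by (subst filterlim_sequentially_Suc)
  qed
  then have "(\<lambda>k. radius * (2 ^ Suc k * sin (angle F G / 2 ^ Suc k))) \<longlonglongrightarrow> radius * angle F G"
    by (intro tendsto_mult tendsto_const)
  ultimately show ?thesis unfolding induced_distance_def by (simp add: limI)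
qed

text \<open>The inequality sin x \<le> x bounds every chord sum by the arc, and partitions into many
  equal pieces approach it.\<close>

lemma W2_length_arc:
  assumes W2: "\<And>s t. 0 \<le> s \<Longrightarrow> s \<le> t \<Longrightarrow> t \<le> 1 \<Longrightarrow> W2 (\<gamma> s) (\<gamma> t) = 2 * radius * sin ((t - s) * \<phi> / 2)"
    and \<phi>: "0 \<le> \<phi>" and ab: "0 \<le> a" "a \<le> b" "b \<le> 1"
  shows "W2_length \<gamma> a b = ereal (radius * \<phi> * (b - a))"
  unfolding W2_length_def
proof (rule antisym)
  show "Sup {ereal (\<Sum>i<n. W2 (\<gamma> (s i)) (\<gamma> (s (Suc i)))) | n s. s 0 = a \<and> s n = b \<and> mono_on {..n} s}
      \<le> ereal (radius * \<phi> * (b - a))"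
  proof (rule Sup_least, safe)
    fix n :: nat and s :: "nat \<Rightarrow> real" assume s: "a = s 0" "b = s n" "mono_on {..n} s"
    have "(\<Sum>i<n. W2 (\<gamma> (s i)) (\<gamma> (s (Suc i)))) \<le> (\<Sum>i<n. radius * \<phi> * (s (Suc i) - s i))"
    proof (rule sum_mono)
      fix i assume "i \<in> {..<n}"
      then have i: "s 0 \<le> s i" "s i \<le> s (Suc i)" "s (Suc i) \<le> s n"
        by (auto intro!: mono_onD[OF s(3)])
      then have "W2 (\<gamma> (s i)) (\<gamma> (s (Suc i))) = 2 * radius * sin ((s (Suc i) - s i) * \<phi> / 2)"
        using ab s by (intro W2) auto
      also have "\<dots> \<le> 2 * radius * ((s (Suc i) - s i) * \<phi> / 2)"
        using i \<phi> radius_pos by (intro mult_left_mono sin_x_le_x) auto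
      also have "\<dots> = radius * \<phi> * (s (Suc i) - s i)" by simp
      finally show "W2 (\<gamma> (s i)) (\<gamma> (s (Suc i))) \<le> radius * \<phi> * (s (Suc i) - s i)" .
    qed
    also have "\<dots> = radius * \<phi> * (s n - s 0)"
      by (simp only: sum_distrib_left[symmetric] sum_lessThan_telescope)
    finally show "ereal (\<Sum>i<n. W2 (\<gamma> (s i)) (\<gamma> (s (Suc i)))) \<le> ereal (radius * \<phi> * (s n - s 0))" by simp
  qed
next
  let ?S = "{ereal (\<Sum>i<n. W2 (\<gamma> (s i)) (\<gamma> (s (Suc i)))) | n s. s 0 = a \<and> s n = b \<and> mono_on {..n} s}"
  \<comment> \<open>The chord sum of the partition of [a, b] into \<open>Suc n\<close> equal pieces,
    written so that the same number multiplies the sine and divides inside it.\<close>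
  define L where "L n = radius * ((2 * real (Suc n)) * sin ((b - a) * \<phi> / (2 * real (Suc n))))" for n
  have upper: "ereal (L n) \<le> Sup ?S" for n
  proof -
    define s where "s i = a + (b - a) * (real i / real (Suc n))" for i
    have "(\<Sum>i<Suc n. W2 (\<gamma> (s i)) (\<gamma> (s (Suc i)))) = (\<Sum>i<Suc n. 2 * radius * sin ((b - a) * \<phi> / (2 * real (Suc n))))"
    proof (rule sum.cong[OF refl])
      fix i assume "i \<in> {..<Suc n}"
      then have q: "real (Suc i) / real (Suc n) \<le> 1" by simp
      have "(b - a) * (real (Suc i) / real (Suc n)) \<le> (b - a) * 1" using q ab by (intro mult_left_mono) auto
      then have "s (Suc i) \<le> 1" using ab by (simp add: s_def)
      moreover have "0 \<le> s i" using ab by (simp add: s_def)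
      moreover have d: "s (Suc i) - s i = (b - a) / real (Suc n)"
      proof -
        have "s (Suc i) - s i = (b - a) * (real (Suc i) / real (Suc n) - real i / real (Suc n))"
          unfolding s_def by (simp only: right_diff_distrib add_diff_cancel_left)
        also have "\<dots> = (b - a) / real (Suc n)" unfolding diff_divide_distrib[symmetric] by simp
        finally show ?thesis .
      qed
      moreover have "s i \<le> s (Suc i)"
      proof -
        have "0 \<le> s (Suc i) - s i" unfolding d using ab by simp
        then show ?thesis by simp
      qed
      ultimately have "W2 (\<gamma> (s i)) (\<gamma> (s (Suc i))) = 2 * radius * sin ((b - a) / real (Suc n) * \<phi> / 2)"
        using W2 by metis
      then show "W2 (\<gamma> (s i)) (\<gamma> (s (Suc i))) = 2 * radius * sin ((b - a) * \<phi> / (2 * real (Suc n)))"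
        by (simp add: field_simps)
    qed
    also have "\<dots> = L n" by (simp add: L_def del: of_nat_Suc)
    finally have "L n = (\<Sum>i<Suc n. W2 (\<gamma> (s i)) (\<gamma> (s (Suc i))))" by simp
    moreover have "mono_on {..Suc n} s"
      using ab by (intro mono_onI) (auto simp: s_def intro!: mult_left_mono divide_right_mono)
    moreover have "s 0 = a" "s (Suc n) = b" by (simp_all add: s_def del: of_nat_Suc)
    ultimately show ?thesis by (intro Sup_upper) blast
  qed
  have "(\<lambda>n. (2 * real (Suc n)) * sin ((b - a) * \<phi> / (2 * real (Suc n)))) \<longlonglongrightarrow> (b - a) * \<phi>"
  proof (rule tendsto_mult_sin_divide)
    show "filterlim (\<lambda>n. (2 * real (Suc n))) at_top sequentially"
      by (intro filterlim_tendsto_pos_mult_at_top[OF tendsto_const]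
          filterlim_compose[OF filterlim_real_sequentially filterlim_Suc]) simp
  qed
  then have "(\<lambda>n. ereal (L n)) \<longlonglongrightarrow> ereal (radius * ((b - a) * \<phi>))"
    unfolding L_def by (rule tendsto_ereal[OF tendsto_mult[OF tendsto_const]])
  then have "ereal (radius * ((b - a) * \<phi>)) \<le> Sup ?S"
    by (rule LIMSEQ_le_const2) (use upper in blast)
  then show "ereal (radius * \<phi> * (b - a)) \<le> Sup ?S" by (simp add: mult.commute mult.left_commute)
qed

lemma slerp_is_sphere_geodesic:
  assumes F: "F \<in> sphere_densities u \<theta>" and G: "G \<in> sphere_densities u \<theta>"
    and \<gamma>: "\<And>t. 0 \<le> t \<Longrightarrow> t \<le> 1 \<Longrightarrow> \<gamma> t = slerp F G t"
  shows "is_sphere_geodesic u \<theta> F G \<gamma>"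
proof -
  note \<phi> = angle_props(1,2)[OF F G]
  have W2: "W2 (\<gamma> s) (\<gamma> t) = 2 * radius * sin ((t - s) * angle F G / 2)"
    if "0 \<le> s" "s \<le> t" "t \<le> 1" for s t
    using that by (simp add: \<gamma> W2_eq_sin_angle slerp_in_sphere[OF F G] angle_slerp[OF F G])
  have len: "W2_length \<gamma> a b = ereal (radius * angle F G * (b - a))" if "0 \<le> a" "a \<le> b" "b \<le> 1" for a b
    using W2_length_arc[OF W2 \<phi>(1) that] by simp
  have abs: "W2 (\<gamma> s) (\<gamma> t) = 2 * radius * sin (\<bar>t - s\<bar> * angle F G / 2)"
    if "s \<in> {0..1}" "t \<in> {0..1}" for s t
    using W2[of s t] W2[of t s] W2_commute[OF slerp_in_sphere[OF F G, of s] slerp_in_sphere[OF F G, of t]] that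
    by (cases "s \<le> t") (auto simp: abs_if \<gamma>)
  have "W2_continuous \<gamma>"
    unfolding W2_continuous_def
  proof
    fix t :: real assume t: "t \<in> {0..1}"
    have "((\<lambda>s. 2 * radius * sin (\<bar>t - s\<bar> * angle F G / 2)) \<longlongrightarrow> 2 * radius * sin (\<bar>t - t\<bar> * angle F G / 2)) (at t within {0..1})"
      by (intro tendsto_intros) simp
    moreover have "eventually (\<lambda>s. 2 * radius * sin (\<bar>t - s\<bar> * angle F G / 2) = W2 (\<gamma> s) (\<gamma> t)) (at t within {0..1})"
      unfolding eventually_at_filter using abs[OF _ t] by (intro always_eventually) simp
    ultimately show "((\<lambda>s. W2 (\<gamma> s) (\<gamma> t)) \<longlongrightarrow> 0) (at t within {0..1})"
      by (auto intro: Lim_transform_eventually)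
  qed
  moreover have "constant_speed \<gamma>"
    unfolding constant_speed_def by (auto simp: len mult.commute)
  ultimately show ?thesis
    unfolding is_sphere_geodesic_def
    using slerp_in_sphere[OF F G] slerp_0[OF F G] slerp_1[OF F G] by (simp add: \<gamma> len induced_distance_eq[OF F G])
qed

text \<open>Constant speed bounds chords, whereas the claim is about arcs. Cut [s, t] into N equal
  pieces: by the triangle inequality some piece carries an angle of at least \<alpha> / N, and the
  bound on its chord reads 2 N sin (\<alpha> / (2 N)) \<le> (t - s) \<open>angle F G\<close>. Then N
  tends to infinity.\<close>

lemma angle_along_geodesic_le:
  assumes F: "F \<in> sphere_densities u \<theta>" and G: "G \<in> sphere_densities u \<theta>"
    and geo: "is_sphere_geodesic u \<theta> F G \<gamma>" and st: "0 \<le> s" "s \<le> t" "t \<le> 1"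
  shows "angle (\<gamma> s) (\<gamma> t) \<le> (t - s) * angle F G"
proof -
  let ?\<alpha> = "angle (\<gamma> s) (\<gamma> t)"
  have E: "\<gamma> r \<in> sphere_densities u \<theta>" if "0 \<le> r" "r \<le> 1" for r
    using geo that by (simp add: is_sphere_geodesic_def)
  have W2_le: "W2 (\<gamma> a) (\<gamma> b) \<le> (b - a) * (radius * angle F G)" if ab: "0 \<le> a" "a \<le> b" "b \<le> 1" for a b
  proof -
    \<comment> \<open>The one-step partition of [a, b]: its single chord is among the sums bounded
      by the length.\<close>
    define p where "p i = (if i = 0 then a else b)" for i :: nat
    have "ereal (\<Sum>i<1. W2 (\<gamma> (p i)) (\<gamma> (p (Suc i)))) \<le> W2_length \<gamma> a b"
      unfolding W2_length_def
      by (intro Sup_upper CollectI exI[of _ 1] exI[of _ p] conjI refl mono_onI) (use ab in \<open>auto simp: p_def\<close>)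
    also have "W2_length \<gamma> a b = ereal (b - a) * ereal (radius * angle F G)"
      using geo ab by (simp add: is_sphere_geodesic_def constant_speed_def induced_distance_eq[OF F G])
    finally show ?thesis by (simp add: p_def)
  qed
  have step: "(2 * real (Suc n)) * sin (?\<alpha> / (2 * real (Suc n))) \<le> (t - s) * angle F G" for n
  proof -
    define N where "N = Suc n"
    define p where "p i = s + (t - s) * (real i / real N)" for i
    have p: "0 \<le> p i" "p i \<le> 1" if "i \<le> N" for i
    proof -
      have "(t - s) * (real i / real N) \<le> (t - s) * 1" using st that by (intro mult_left_mono) (auto simp: N_def)
      then show "p i \<le> 1" using st by (simp add: p_def)
      show "0 \<le> p i" using st by (simp add: p_def)
    qed
    have pN: "p 0 = s" "p N = t" by (simp_all add: p_def N_def del: of_nat_Suc)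
    have pd: "p (Suc i) - p i = (t - s) / real N" for i
    proof -
      have "p (Suc i) - p i = (t - s) * (real (Suc i) / real N - real i / real N)"
        unfolding p_def by (simp only: right_diff_distrib add_diff_cancel_left)
      also have "\<dots> = (t - s) / real N" unfolding diff_divide_distrib[symmetric] by simp
      finally show ?thesis .
    qed
    have p_mono: "p i \<le> p (Suc i)" for i
    proof -
      have "0 \<le> p (Suc i) - p i" unfolding pd using st by simp
      then show ?thesis by simp
    qed
    have "angle (\<gamma> (p 0)) (\<gamma> (p (Suc m))) \<le> (\<Sum>i<Suc m. angle (\<gamma> (p i)) (\<gamma> (p (Suc i))))" if "Suc m \<le> N" for m
      using that
    proof (induction m)
      case (Suc m)
      have "angle (\<gamma> (p 0)) (\<gamma> (p (Suc (Suc m)))) \<le> angle (\<gamma> (p 0)) (\<gamma> (p (Suc m))) + angle (\<gamma> (p (Suc m))) (\<gamma> (p (Suc (Suc m))))"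
        using Suc.prems by (intro angle_triangle E p) auto
      then show ?case using Suc by simp
    qed simp
    from this[of n] have sum: "?\<alpha> \<le> (\<Sum>i<N. angle (\<gamma> (p i)) (\<gamma> (p (Suc i))))" using pN by (simp add: N_def)
    have "\<exists>i<N. ?\<alpha> / real N \<le> angle (\<gamma> (p i)) (\<gamma> (p (Suc i)))"
    proof (rule ccontr)
      assume "\<not> ?thesis"
      then have "(\<Sum>i<N. angle (\<gamma> (p i)) (\<gamma> (p (Suc i)))) < (\<Sum>i<N. ?\<alpha> / real N)"
        by (intro sum_strict_mono) (auto simp: N_def not_le)
      also have "\<dots> = ?\<alpha>" by (simp add: N_def)
      finally show False using sum by simp
    qed
    then obtain i where i: "i < N" "?\<alpha> / real N \<le> angle (\<gamma> (p i)) (\<gamma> (p (Suc i)))" by blast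
    have Ei: "\<gamma> (p i) \<in> sphere_densities u \<theta>" "\<gamma> (p (Suc i)) \<in> sphere_densities u \<theta>"
      using i(1) by (auto intro!: E p)
    have a0: "0 \<le> ?\<alpha>" using angle_props(1)[OF E E] st by simp
    have "sin (?\<alpha> / real N / 2) \<le> sin (angle (\<gamma> (p i)) (\<gamma> (p (Suc i))) / 2)"
    proof (rule sin_monotone_2pi_le)
      have "0 \<le> ?\<alpha> / real N / 2" using a0 by simp
      then show "- (pi / 2) \<le> ?\<alpha> / real N / 2" using pi_gt_zero by linarith
      show "angle (\<gamma> (p i)) (\<gamma> (p (Suc i))) / 2 \<le> pi / 2" using angle_props(1,2)[OF Ei] pi_gt_zero by linarith
    qed (use i(2) in simp)
    then have "2 * radius * sin (?\<alpha> / real N / 2) \<le> W2 (\<gamma> (p i)) (\<gamma> (p (Suc i)))"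
      unfolding W2_eq_sin_angle[OF Ei] using radius_pos by simp
    also have "\<dots> \<le> (p (Suc i) - p i) * (radius * angle F G)"
      using p[of i] p[of "Suc i"] i(1) p_mono by (intro W2_le) auto
    also have "\<dots> = radius * ((t - s) / real N * angle F G)" unfolding pd by simp
    also have "2 * radius * sin (?\<alpha> / real N / 2) = radius * (2 * sin (?\<alpha> / real N / 2))" by simp
    finally have "2 * sin (?\<alpha> / real N / 2) \<le> (t - s) / real N * angle F G"
      by (simp only: mult_le_cancel_left_pos[OF radius_pos])
    then have "real N * (2 * sin (?\<alpha> / real N / 2)) \<le> real N * ((t - s) / real N * angle F G)"
      by (intro mult_left_mono) auto
    moreover have "?\<alpha> / real N / 2 = ?\<alpha> / (2 * real N)" by simp
    moreover have "real N * ((t - s) / real N * angle F G) = (t - s) * angle F G" by (simp add: N_def)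
    ultimately show ?thesis unfolding N_def by (simp only: mult.assoc mult.left_commute)
  qed
  have "(\<lambda>n. (2 * real (Suc n)) * sin (?\<alpha> / (2 * real (Suc n)))) \<longlonglongrightarrow> ?\<alpha>"
  proof (rule tendsto_mult_sin_divide)
    show "filterlim (\<lambda>n. (2 * real (Suc n))) at_top sequentially"
      by (intro filterlim_tendsto_pos_mult_at_top[OF tendsto_const]
          filterlim_compose[OF filterlim_real_sequentially filterlim_Suc]) simp
  qed
  then show ?thesis by (rule LIMSEQ_le_const2) (use step in blast)
qed

text \<open>At an interior time the bounds of \<open>angle_along_geodesic_le\<close> towards either
  end are the hypotheses of \<open>slerp_unique\<close>; at the end points the values are
  prescribed.\<close>

lemma sphere_geodesic_unique:
  assumes F: "F \<in> sphere_densities u \<theta>" and G: "G \<in> sphere_densities u \<theta>"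
    and geo: "is_sphere_geodesic u \<theta> F G \<gamma>" and t: "0 \<le> t" "t \<le> 1"
  shows "\<gamma> t = slerp F G t"
proof -
  have ends: "\<gamma> 0 = F" "\<gamma> 1 = G" and E: "\<gamma> t \<in> sphere_densities u \<theta>"
    using geo t by (simp_all add: is_sphere_geodesic_def)
  consider "t = 0" | "t = 1" | "0 < t" "t < 1" using t by linarith
  then show ?thesis
  proof cases
    case 3
    then show ?thesis
      using angle_along_geodesic_le[OF F G geo, of 0 t] angle_along_geodesic_le[OF F G geo, of t 1] ends
      by (intro slerp_unique[OF F G E]) auto
  qed (use ends slerp_0[OF F G] slerp_1[OF F G] in auto)
qed

end

theorem theorem3p5:
  fixes u :: "'a::euclidean_space" and \<theta> R :: real and F0 F1 :: "'a measure"
  assumes "0 < \<theta>"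
    and "F0 \<in> sphere_densities u \<theta>" and "F1 \<in> sphere_densities u \<theta>"
    and "R = sqrt (real DIM('a) * \<theta> / 2)"
  shows "W2 F0 F1 = 2 * R * sin (induced_distance u \<theta> F0 F1 / (2 * R)) \<and>
    induced_distance u \<theta> F0 F1 = 2 * R * arcsin (W2 F0 F1 / (2 * R)) \<and>
    (\<forall>t\<in>{0..1}.
      (\<exists>!H. is_closest_point u \<theta> (chordal_geodesic F0 F1 t) H) \<and>
      (\<exists>a>0. projected_chord u \<theta> F0 F1 t = dilate u a (chordal_geodesic F0 F1 t))) \<and>
    (\<exists>\<tau>. is_reparametrization \<tau> \<and>
      is_sphere_geodesic u \<theta> F0 F1 (\<lambda>t. projected_chord u \<theta> F0 F1 (\<tau> t)) \<and>
      (\<forall>\<gamma>. is_sphere_geodesic u \<theta> F0 F1 \<gamma> \<longrightarrow>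
        (\<forall>t\<in>{0..1}. \<gamma> t = projected_chord u \<theta> F0 F1 (\<tau> t))))"
proof -
  interpret density_sphere u \<theta> by unfold_locales fact
  note F = assms(2,3)
  have R: "R = radius" "0 < R" using assms(4) radius_pos by (simp_all add: radius_def)
  define \<phi> where "\<phi> = angle F0 F1"
  note \<phi> = angle_props(1,2)[OF F, folded \<phi>_def]
  let ?\<tau> = "chord_parameter \<phi>"
  have ind: "induced_distance u \<theta> F0 F1 = R * \<phi>" using induced_distance_eq[OF F] by (simp add: R \<phi>_def)
  have W2: "W2 F0 F1 = 2 * R * sin (\<phi> / 2)" using W2_eq_sin_angle[OF F] by (simp add: R \<phi>_def)
  have 1: "W2 F0 F1 = 2 * R * sin (induced_distance u \<theta> F0 F1 / (2 * R))" using W2 ind R(2) by simp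
  \<comment> \<open>The half angle is at most pi / 4, inside the range where arcsin inverts the
    sine.\<close>
  have "arcsin (sin (\<phi> / 2)) = \<phi> / 2" using \<phi> pi_gt_zero by (intro arcsin_sin) linarith+
  then have 2: "induced_distance u \<theta> F0 F1 = 2 * R * arcsin (W2 F0 F1 / (2 * R))" using W2 ind R(2) by simp
  have 3: "(\<exists>!H. is_closest_point u \<theta> (chordal_geodesic F0 F1 t) H) \<and>
      (\<exists>a>0. projected_chord u \<theta> F0 F1 t = dilate u a (chordal_geodesic F0 F1 t))" if t: "t \<in> {0..1}" for t
  proof -
    \<comment> \<open>Closest points are known at the chord parameters of arc points; surjectivity
      of \<open>chord_parameter\<close> covers every t.\<close>
    obtain s where s: "0 \<le> s" "s \<le> 1" "?\<tau> s = t"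
      by (rule chord_parameter_surj[OF \<phi>, of t]) (use t in auto)
    show ?thesis
      using projected_chord[OF F s(1,2), folded \<phi>_def, unfolded s(3)] by simp
  qed
  have \<tau>: "is_reparametrization ?\<tau>" by (rule is_reparametrization_chord_parameter[OF \<phi>])
  have pc: "projected_chord u \<theta> F0 F1 (?\<tau> t) = slerp F0 F1 t" if "0 \<le> t" "t \<le> 1" for t
    using projected_chord(2)[OF F that] by (simp add: \<phi>_def)
  have geo: "is_sphere_geodesic u \<theta> F0 F1 (\<lambda>t. projected_chord u \<theta> F0 F1 (?\<tau> t))"
    by (rule slerp_is_sphere_geodesic[OF F pc])
  have "\<gamma> t = projected_chord u \<theta> F0 F1 (?\<tau> t)" if "is_sphere_geodesic u \<theta> F0 F1 \<gamma>" "t \<in> {0..1}" for \<gamma> t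
    using sphere_geodesic_unique[OF F that(1), of t] pc[of t] that(2) by simp
  with 1 2 3 \<tau> geo show ?thesis by blast
qed

end
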